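(* Let $[\Lambda,q,r,\beta]$ and $[\Lambda,q,r,\beta']$ be two non-zero semisimple strata in $A=\mathrm{End}_F(V)$ which intertwine, with associated splittings $V=\bigoplus_{i\in I}V^i$ and $V=\bigoplus_{j\in I'}V'^j$, and let $\zeta:I\to I'$ be their matching. Put $\Lambda^i=\Lambda\cap V^i$ and $\Lambda'^{j}=\Lambda\cap V'^{j}$, and suppose that $$\dim_{\kappa_F}(\Lambda^i_j/\Lambda^i_{j+1})=\dim_{\kappa_F}(\Lambda'^{\zeta(i)}_j/\Lambda'^{\zeta(i)}_{j+1})\quad\text{for all }i\in I,\ j\in\mathbb Z.$$ Then the strata are conjugate by an element of $\tilde{\mathrm U}(\Lambda)$, i.e. there is $g\in\tilde{\mathrm U}(\Lambda)$ such that $[\Lambda,q,r,g\beta g^{-1}]$ is equivalent to $[\Lambda,q,r,\beta']$.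
   Context: $F$ nonarchimedean local field of odd residual characteristic, $o_F$, residue field $\kappa_F$, uniformizer $\pi$. $V$ finite-dimensional, $A=\mathrm{End}_F(V)$, $\tilde G=A^\times$. Lattice sequences $\Lambda$: decreasing maps $\mathbb Z\to$ full-rank $o_F$-lattices with $\Lambda_s\pi=\Lambda_{s+e}$ ($e$ = period). $\mathfrak a_n(\Lambda)=\{a:a\Lambda_s\subseteq\Lambda_{s+n}\forall s\}$, $\tilde{\mathrm U}(\Lambda)=\mathfrak a_0(\Lambda)^\times$, $\nu_\Lambda(a)=\sup\{n:a\in\mathfrak a_n\}$, normalizing: $\nu_\Lambda(g^{-1})=-\nu_\Lambda(g)$. Strata $[\Lambda,q,r,\beta]$ ($q\ge r\ge0$, $\beta\in\mathfrak a_{-q}$); equivalence: $\beta+\mathfrak a_{-r-j}(\Lambda)=\beta'+\mathfrak a_{-r'-j}(\Lambda')$ $\forall j\ge0$; intertwining: some $g\in\tilde G$ with $g(\beta+\mathfrak a_{-r}(\Lambda))g^{-1}\cap(\beta'+\mathfrak a_{-r'}(\Lambda'))\ne\emptyset$. Zero: $\beta=0,q=r$; pure: $F[\beta]$ a field, $F[\beta]^\times$ normalizes $\Lambda$, $\nu_\Lambda(\beta)=-q<-r$; simple: zero or pure with minimal $[F[\beta]:F]$ among equivalent pure strata; semisimple: zero, or $\nu_\Lambda(\beta)=-q<-r$ and there is a decomposition $V=\bigoplus_{i\in I}V^i$ (projections $1^i$, the associated splitting) with $1^i\beta1^j=0$ ($i\ne j$), $\Lambda_s=\bigoplus_i(\Lambda_s\cap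 V^i)$, each $[\Lambda^i,q_i,r,\beta_i]$ simple ($\beta_i=1^i\beta1^i$, $q_i=-\min\{\nu_\Lambda(\beta_i),-r\}$) and for $i\ne j$ $[\Lambda^i\oplus\Lambda^j,\max\{q_i,q_j\},r,\beta_i+\beta_j]$ not equivalent to any simple stratum. Matching: for two intertwining non-zero semisimple strata whose lattice sequences have the same period, the unique bijection $\zeta:I\to I'$ such that $[\Lambda^i\oplus\Lambda'^{\zeta(i)},\max\{q_i,q'_{\zeta(i)}\},r,\beta_i+\beta'_{\zeta(i)}]$ is equivalent to a simple stratum for every $i\in I$. *)

theory Defs
  imports Main "HOL.Vector_Spaces" "HOL-Library.Product_Plus" "HOL-Library.Function_Algebras"
begin

text \<open>A field F with a valuation v : F -> Z (the value of v at 0 is irrelevant,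
  0 is treated as having valuation +infinity everywhere below).\<close>

definition oF :: "('f::field \<Rightarrow> int) \<Rightarrow> 'f set" where
  "oF v = {x. x = 0 \<or> 0 \<le> v x}"

definition pF :: "('f::field \<Rightarrow> int) \<Rightarrow> 'f set" where
  "pF v = {x. x = 0 \<or> 1 \<le> v x}"

definition nonarch_local_field :: "('f::field \<Rightarrow> int) \<Rightarrow> bool" where
  "nonarch_local_field v \<longleftrightarrow>
     (\<forall>x y. x \<noteq> 0 \<longrightarrow> y \<noteq> 0 \<longrightarrow> v (x * y) = v x + v y)
   \<and> (\<forall>x y. x \<noteq> 0 \<longrightarrow> y \<noteq> 0 \<longrightarrow> x + y \<noteq> 0 \<longrightarrow> min (v x) (v y) \<le> v (x + y))
   \<and> (\<exists>p. p \<noteq> 0 \<and> v p = 1)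
   \<comment> \<open>completeness\<close>
   \<and> (\<forall>X :: nat \<Rightarrow> 'f.
        (\<forall>k. \<exists>N. \<forall>m\<ge>N. \<forall>n\<ge>N. X m - X n = 0 \<or> k \<le> v (X m - X n))
        \<longrightarrow> (\<exists>L. \<forall>k. \<exists>N. \<forall>n\<ge>N. X n - L = 0 \<or> k \<le> v (X n - L)))
   \<comment> \<open>finite residue field\<close>
   \<and> (\<exists>S. finite S \<and> S \<subseteq> oF v \<and> (\<forall>x\<in>oF v. \<exists>s\<in>S. x - s \<in> pF v))"

definition odd_residual_char :: "('f::field \<Rightarrow> int) \<Rightarrow> bool" where
  "odd_residual_char v \<longleftrightarrow> (2::'f) \<noteq> 0 \<and> v 2 = 0"

definition unif :: "('f::field \<Rightarrow> int) \<Rightarrow> 'f" where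
  "unif v = (SOME p. p \<noteq> 0 \<and> v p = 1)"

definition lattice :: "('f::field \<Rightarrow> int) \<Rightarrow> ('f \<Rightarrow> 'v::ab_group_add \<Rightarrow> 'v) \<Rightarrow> 'v set \<Rightarrow> 'v set \<Rightarrow> bool" where
  "lattice v sc W L \<longleftrightarrow>
     (\<exists>B. finite B \<and> B \<subseteq> W \<and> \<not> module.dependent sc B \<and> module.span sc B = W
        \<and> L = {(\<Sum>b\<in>B. sc (c b) b) | c. \<forall>b\<in>B. c b \<in> oF v})"

definition lattice_seq :: "('f::field \<Rightarrow> int) \<Rightarrow> ('f \<Rightarrow> 'v::ab_group_add \<Rightarrow> 'v) \<Rightarrow> 'v set \<Rightarrow> (int \<Rightarrow> 'v set) \<Rightarrow> bool" where
  "lattice_seq v sc W \<Lambda> \<longleftrightarrow>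
     (\<forall>s. lattice v sc W (\<Lambda> s)) \<and> (\<forall>s. \<Lambda> (s + 1) \<subseteq> \<Lambda> s)
   \<and> (\<exists>e>0. \<forall>s. \<Lambda> (s + e) = sc (unif v) ` \<Lambda> s)"

definition endo :: "('f::field \<Rightarrow> 'v::ab_group_add \<Rightarrow> 'v) \<Rightarrow> 'v set \<Rightarrow> ('v \<Rightarrow> 'v) \<Rightarrow> bool" where
  "endo sc W a \<longleftrightarrow> (\<forall>x\<in>W. a x \<in> W) \<and> (\<forall>x\<in>W. \<forall>y\<in>W. a (x + y) = a x + a y)
     \<and> (\<forall>c. \<forall>x\<in>W. a (sc c x) = sc c (a x)) \<and> (\<forall>x. x \<notin> W \<longrightarrow> a x = 0)"

definition idW :: "'v set \<Rightarrow> 'v::ab_group_add \<Rightarrow> 'v" where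
  "idW W = (\<lambda>x. if x \<in> W then x else 0)"

definition zeroE :: "'v \<Rightarrow> 'v::ab_group_add" where
  "zeroE = (\<lambda>x. 0)"

definition restr :: "'v set \<Rightarrow> ('v \<Rightarrow> 'v) \<Rightarrow> 'v \<Rightarrow> 'v::ab_group_add" where
  "restr U a = (\<lambda>x. if x \<in> U then a x else 0)"

definition unitE :: "('f::field \<Rightarrow> 'v::ab_group_add \<Rightarrow> 'v) \<Rightarrow> 'v set \<Rightarrow> ('v \<Rightarrow> 'v) \<Rightarrow> bool" where
  "unitE sc W a \<longleftrightarrow> endo sc W a \<and> (\<exists>b. endo sc W b \<and> a \<circ> b = idW W \<and> b \<circ> a = idW W)"

definition invE :: "('f::field \<Rightarrow> 'v::ab_group_add \<Rightarrow> 'v) \<Rightarrow> 'v set \<Rightarrow> ('v \<Rightarrow> 'v) \<Rightarrow> 'v \<Rightarrow> 'v" where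
  "invE sc W a = (SOME b. endo sc W b \<and> a \<circ> b = idW W \<and> b \<circ> a = idW W)"

definition afil :: "('f::field \<Rightarrow> 'v::ab_group_add \<Rightarrow> 'v) \<Rightarrow> 'v set \<Rightarrow> (int \<Rightarrow> 'v set) \<Rightarrow> int \<Rightarrow> ('v \<Rightarrow> 'v) set" where
  "afil sc W \<Lambda> n = {a. endo sc W a \<and> (\<forall>s. a ` \<Lambda> s \<subseteq> \<Lambda> (s + n))}"

definition Ut :: "('f::field \<Rightarrow> 'v::ab_group_add \<Rightarrow> 'v) \<Rightarrow> 'v set \<Rightarrow> (int \<Rightarrow> 'v set) \<Rightarrow> ('v \<Rightarrow> 'v) set" where
  "Ut sc W \<Lambda> = {g. unitE sc W g \<and> g \<in> afil sc W \<Lambda> 0 \<and> invE sc W g \<in> afil sc W \<Lambda> 0}"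

definition coset :: "('v \<Rightarrow> 'v::ab_group_add) \<Rightarrow> ('v \<Rightarrow> 'v) set \<Rightarrow> ('v \<Rightarrow> 'v) set" where
  "coset \<beta> S = {(\<lambda>x. \<beta> x + a x) | a. a \<in> S}"

text \<open>q_i = - min(nu_Lambda(gamma), -r).\<close>
definition qcomp :: "('f::field \<Rightarrow> 'v::ab_group_add \<Rightarrow> 'v) \<Rightarrow> 'v set \<Rightarrow> (int \<Rightarrow> 'v set) \<Rightarrow> int \<Rightarrow> ('v \<Rightarrow> 'v) \<Rightarrow> int" where
  "qcomp sc W \<Lambda> r \<gamma> = (if \<gamma> \<in> afil sc W \<Lambda> (- r) then r else - (GREATEST n. \<gamma> \<in> afil sc W \<Lambda> n))"

definition stratum :: "('f::field \<Rightarrow> int) \<Rightarrow> ('f \<Rightarrow> 'v::ab_group_add \<Rightarrow> 'v) \<Rightarrow> 'v set \<Rightarrow> (int \<Rightarrow> 'v set) \<Rightarrow> int \<Rightarrow> int \<Rightarrow> ('v \<Rightarrow> 'v) \<Rightarrow> bool" where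
  "stratum v sc W \<Lambda> q r \<beta> \<longleftrightarrow> lattice_seq v sc W \<Lambda> \<and> 0 \<le> r \<and> r \<le> q \<and> \<beta> \<in> afil sc W \<Lambda> (- q)"

definition strata_equiv :: "('f::field \<Rightarrow> int) \<Rightarrow> ('f \<Rightarrow> 'v::ab_group_add \<Rightarrow> 'v) \<Rightarrow> 'v set
    \<Rightarrow> (int \<Rightarrow> 'v set) \<Rightarrow> int \<Rightarrow> int \<Rightarrow> ('v \<Rightarrow> 'v) \<Rightarrow> (int \<Rightarrow> 'v set) \<Rightarrow> int \<Rightarrow> int \<Rightarrow> ('v \<Rightarrow> 'v) \<Rightarrow> bool" where
  "strata_equiv v sc W \<Lambda> q r \<beta> \<Lambda>' q' r' \<beta>' \<longleftrightarrow>
     stratum v sc W \<Lambda> q r \<beta> \<and> stratum v sc W \<Lambda>' q' r' \<beta>' \<and>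
     (\<forall>j::int. 0 \<le> j \<longrightarrow> coset \<beta> (afil sc W \<Lambda> (- r - j)) = coset \<beta>' (afil sc W \<Lambda>' (- r' - j)))"

definition intertwine :: "('f::field \<Rightarrow> int) \<Rightarrow> ('f \<Rightarrow> 'v::ab_group_add \<Rightarrow> 'v) \<Rightarrow> 'v set
    \<Rightarrow> (int \<Rightarrow> 'v set) \<Rightarrow> int \<Rightarrow> int \<Rightarrow> ('v \<Rightarrow> 'v) \<Rightarrow> (int \<Rightarrow> 'v set) \<Rightarrow> int \<Rightarrow> int \<Rightarrow> ('v \<Rightarrow> 'v) \<Rightarrow> bool" where
  "intertwine v sc W \<Lambda> q r \<beta> \<Lambda>' q' r' \<beta>' \<longleftrightarrow>
     stratum v sc W \<Lambda> q r \<beta> \<and> stratum v sc W \<Lambda>' q' r' \<beta>' \<and>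
     (\<exists>g. unitE sc W g \<and> (\<exists>a\<in>coset \<beta> (afil sc W \<Lambda> (- r)).
            g \<circ> a \<circ> invE sc W g \<in> coset \<beta>' (afil sc W \<Lambda>' (- r'))))"

definition zero_stratum :: "('f::field \<Rightarrow> int) \<Rightarrow> ('f \<Rightarrow> 'v::ab_group_add \<Rightarrow> 'v) \<Rightarrow> 'v set \<Rightarrow> (int \<Rightarrow> 'v set) \<Rightarrow> int \<Rightarrow> int \<Rightarrow> ('v \<Rightarrow> 'v) \<Rightarrow> bool" where
  "zero_stratum v sc W \<Lambda> q r \<beta> \<longleftrightarrow> stratum v sc W \<Lambda> q r \<beta> \<and> \<beta> = zeroE \<and> q = r"

definition Falg :: "('f::field \<Rightarrow> 'v::ab_group_add \<Rightarrow> 'v) \<Rightarrow> 'v set \<Rightarrow> ('v \<Rightarrow> 'v) \<Rightarrow> ('v \<Rightarrow> 'v) set" where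
  "Falg sc W \<beta> = {(\<lambda>x. if x \<in> W then (\<Sum>k<m. sc (c k) ((\<beta> ^^ k) x)) else 0) | c m. True}"

definition Falg_is_field :: "('f::field \<Rightarrow> 'v::ab_group_add \<Rightarrow> 'v) \<Rightarrow> 'v set \<Rightarrow> ('v \<Rightarrow> 'v) \<Rightarrow> bool" where
  "Falg_is_field sc W \<beta> \<longleftrightarrow> idW W \<noteq> zeroE \<and>
     (\<forall>a\<in>Falg sc W \<beta>. a \<noteq> zeroE \<longrightarrow> (\<exists>b\<in>Falg sc W \<beta>. a \<circ> b = idW W \<and> b \<circ> a = idW W))"

definition deg :: "('f::field \<Rightarrow> 'v::ab_group_add \<Rightarrow> 'v) \<Rightarrow> 'v set \<Rightarrow> ('v \<Rightarrow> 'v) \<Rightarrow> nat" where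
  "deg sc W \<beta> = vector_space.dim (\<lambda>c a x. sc c (a x)) (Falg sc W \<beta>)"

definition pure :: "('f::field \<Rightarrow> int) \<Rightarrow> ('f \<Rightarrow> 'v::ab_group_add \<Rightarrow> 'v) \<Rightarrow> 'v set \<Rightarrow> (int \<Rightarrow> 'v set) \<Rightarrow> int \<Rightarrow> int \<Rightarrow> ('v \<Rightarrow> 'v) \<Rightarrow> bool" where
  "pure v sc W \<Lambda> q r \<beta> \<longleftrightarrow> stratum v sc W \<Lambda> q r \<beta> \<and> Falg_is_field sc W \<beta>
     \<and> (\<forall>a\<in>Falg sc W \<beta>. a \<noteq> zeroE \<longrightarrow> (\<exists>k. \<forall>s. a ` \<Lambda> s = \<Lambda> (s + k)))
     \<and> \<beta> \<in> afil sc W \<Lambda> (- q) \<and> \<beta> \<notin> afil sc W \<Lambda> (- q + 1) \<and> - q < - r"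

definition simple :: "('f::field \<Rightarrow> int) \<Rightarrow> ('f \<Rightarrow> 'v::ab_group_add \<Rightarrow> 'v) \<Rightarrow> 'v set \<Rightarrow> (int \<Rightarrow> 'v set) \<Rightarrow> int \<Rightarrow> int \<Rightarrow> ('v \<Rightarrow> 'v) \<Rightarrow> bool" where
  "simple v sc W \<Lambda> q r \<beta> \<longleftrightarrow> zero_stratum v sc W \<Lambda> q r \<beta> \<or>
     (pure v sc W \<Lambda> q r \<beta> \<and>
      (\<forall>\<Lambda>' q' r' \<gamma>. pure v sc W \<Lambda>' q' r' \<gamma> \<and> strata_equiv v sc W \<Lambda> q r \<beta> \<Lambda>' q' r' \<gamma>
          \<longrightarrow> deg sc W \<beta> \<le> deg sc W \<gamma>))"

definition dsum :: "('f::field \<Rightarrow> 'v::ab_group_add \<Rightarrow> 'v) \<Rightarrow> 'v set \<Rightarrow> 'i set \<Rightarrow> ('i \<Rightarrow> 'v set) \<Rightarrow> bool" where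
  "dsum sc W I Vs \<longleftrightarrow> finite I \<and> (\<forall>i\<in>I. module.subspace sc (Vs i))
     \<and> W = {(\<Sum>i\<in>I. f i) | f. \<forall>i\<in>I. f i \<in> Vs i}
     \<and> (\<forall>f. (\<forall>i\<in>I. f i \<in> Vs i) \<and> (\<Sum>i\<in>I. f i) = 0 \<longrightarrow> (\<forall>i\<in>I. f i = 0))"

definition proj :: "'v set \<Rightarrow> 'i set \<Rightarrow> ('i \<Rightarrow> 'v set) \<Rightarrow> 'i \<Rightarrow> 'v \<Rightarrow> 'v::ab_group_add" where
  "proj W I Vs i = (\<lambda>x. if x \<in> W then
      (THE f. (\<forall>j\<in>I. f j \<in> Vs j) \<and> (\<forall>j. j \<notin> I \<longrightarrow> f j = 0) \<and> x = (\<Sum>j\<in>I. f j)) i else 0)"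

definition blk :: "'v set \<Rightarrow> 'i set \<Rightarrow> ('i \<Rightarrow> 'v set) \<Rightarrow> ('v \<Rightarrow> 'v) \<Rightarrow> 'i \<Rightarrow> 'v \<Rightarrow> 'v::ab_group_add" where
  "blk W I Vs \<beta> i = proj W I Vs i \<circ> \<beta> \<circ> proj W I Vs i"

definition ssum :: "'v set \<Rightarrow> 'v set \<Rightarrow> 'v::ab_group_add set" where
  "ssum U U' = {x + y | x y. x \<in> U \<and> y \<in> U'}"

definition ss_split :: "('f::field \<Rightarrow> int) \<Rightarrow> ('f \<Rightarrow> 'v::ab_group_add \<Rightarrow> 'v) \<Rightarrow> 'v set \<Rightarrow> (int \<Rightarrow> 'v set)
    \<Rightarrow> int \<Rightarrow> int \<Rightarrow> ('v \<Rightarrow> 'v) \<Rightarrow> 'i set \<Rightarrow> ('i \<Rightarrow> 'v set) \<Rightarrow> bool" where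
  "ss_split v sc W \<Lambda> q r \<beta> I Vs \<longleftrightarrow>
     stratum v sc W \<Lambda> q r \<beta> \<and> \<beta> \<notin> afil sc W \<Lambda> (- q + 1) \<and> - q < - r
   \<and> dsum sc W I Vs
   \<and> (\<forall>i\<in>I. \<forall>j\<in>I. i \<noteq> j \<longrightarrow> proj W I Vs i \<circ> \<beta> \<circ> proj W I Vs j = zeroE)
   \<and> (\<forall>s. \<Lambda> s = {(\<Sum>i\<in>I. f i) | f. \<forall>i\<in>I. f i \<in> \<Lambda> s \<inter> Vs i})
   \<and> (\<forall>i\<in>I. simple v sc (Vs i) (\<lambda>s. \<Lambda> s \<inter> Vs i)
              (qcomp sc W \<Lambda> r (blk W I Vs \<beta> i)) r (restr (Vs i) (blk W I Vs \<beta> i)))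
   \<and> (\<forall>i\<in>I. \<forall>j\<in>I. i \<noteq> j \<longrightarrow>
        \<not> (\<exists>\<Lambda>'' q'' r'' \<gamma>. simple v sc (ssum (Vs i) (Vs j)) \<Lambda>'' q'' r'' \<gamma> \<and>
              strata_equiv v sc (ssum (Vs i) (Vs j)) (\<lambda>s. \<Lambda> s \<inter> ssum (Vs i) (Vs j))
                (max (qcomp sc W \<Lambda> r (blk W I Vs \<beta> i)) (qcomp sc W \<Lambda> r (blk W I Vs \<beta> j))) r
                (restr (ssum (Vs i) (Vs j)) (\<lambda>x. blk W I Vs \<beta> i x + blk W I Vs \<beta> j x))
                \<Lambda>'' q'' r'' \<gamma>))"

definition sc2 :: "('f \<Rightarrow> 'v \<Rightarrow> 'v) \<Rightarrow> 'f \<Rightarrow> 'v \<times> 'v \<Rightarrow> 'v \<times> 'v" where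
  "sc2 sc = (\<lambda>c p. (sc c (fst p), sc c (snd p)))"

definition matching :: "('f::field \<Rightarrow> int) \<Rightarrow> ('f \<Rightarrow> 'v::ab_group_add \<Rightarrow> 'v) \<Rightarrow> 'v set \<Rightarrow> (int \<Rightarrow> 'v set) \<Rightarrow> int
    \<Rightarrow> ('v \<Rightarrow> 'v) \<Rightarrow> 'i set \<Rightarrow> ('i \<Rightarrow> 'v set) \<Rightarrow> ('v \<Rightarrow> 'v) \<Rightarrow> 'j set \<Rightarrow> ('j \<Rightarrow> 'v set) \<Rightarrow> ('i \<Rightarrow> 'j) \<Rightarrow> bool" where
  "matching v sc W \<Lambda> r \<beta> I Vs \<beta>' I' Vs' \<zeta> \<longleftrightarrow> bij_betw \<zeta> I I' \<and>
     (\<forall>i\<in>I. \<exists>\<Lambda>'' q'' r'' \<gamma>.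
        simple v (sc2 sc) (Vs i \<times> Vs' (\<zeta> i)) \<Lambda>'' q'' r'' \<gamma> \<and>
        strata_equiv v (sc2 sc) (Vs i \<times> Vs' (\<zeta> i))
          (\<lambda>s. (\<Lambda> s \<inter> Vs i) \<times> (\<Lambda> s \<inter> Vs' (\<zeta> i)))
          (max (qcomp sc W \<Lambda> r (blk W I Vs \<beta> i)) (qcomp sc W \<Lambda> r (blk W I' Vs' \<beta>' (\<zeta> i)))) r
          (\<lambda>p. if p \<in> Vs i \<times> Vs' (\<zeta> i)
                then (blk W I Vs \<beta> i (fst p), blk W I' Vs' \<beta>' (\<zeta> i) (snd p)) else 0)
          \<Lambda>'' q'' r'' \<gamma>)"

text \<open>S is a finite subset of L whose images in L/M are kappa_F-linearly independent.\<close>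
definition kindep :: "('f::field \<Rightarrow> int) \<Rightarrow> ('f \<Rightarrow> 'v::ab_group_add \<Rightarrow> 'v) \<Rightarrow> 'v set \<Rightarrow> 'v set \<Rightarrow> 'v set \<Rightarrow> bool" where
  "kindep v sc L M S \<longleftrightarrow> finite S \<and> S \<subseteq> L \<and>
     (\<forall>c. (\<forall>s\<in>S. c s \<in> oF v) \<and> (\<Sum>s\<in>S. sc (c s) s) \<in> M \<longrightarrow> (\<forall>s\<in>S. c s \<in> pF v))"

definition kdim :: "('f::field \<Rightarrow> int) \<Rightarrow> ('f \<Rightarrow> 'v::ab_group_add \<Rightarrow> 'v) \<Rightarrow> 'v set \<Rightarrow> 'v set \<Rightarrow> nat" where
  "kdim v sc L M = (GREATEST n. \<exists>S. kindep v sc L M S \<and> card S = n)"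

end

theory Submission
  imports Defs "HOL-Computational_Algebra.Polynomial"
begin

text \<open>
  For a matched pair of blocks let \<open>\<gamma>\<close> be the simple element on \<open>V\<^sup>i \<oplus> V'\<^sup>\<zeta>\<^sup>(\<^sup>i\<^sup>)\<close> equivalent to
  \<open>\<beta>\<^sub>i \<oplus> \<beta>'\<^sub>\<zeta>\<^sub>(\<^sub>i\<^sub>)\<close>, and \<open>n\<close> its degree. The projection \<open>x\<close> onto \<open>V\<^sup>i\<close> lies in \<open>\<aa>\<^sub>0\<close> and its commutator with \<open>\<gamma>\<close>
  lies in \<open>\<aa>\<^sub>-\<^sub>r\<close>. The key claim is that \<open>x\<close> then commutes with every \<open>p(\<gamma>)\<close>, \<open>deg p < n\<close>, modulo operators
  of valuation larger than that of \<open>p(\<gamma>)\<close>. Let \<open>\<phi>\<close> be a monic polynomial of least degree \<open>d < n\<close> with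
  \<open>\<phi>(\<gamma>)\<close> of largest valuation for which this fails. Then polynomials of degree less than \<open>d\<close> multiply
  modulo \<open>\<phi>\<close> without loss of valuation, so \<open>F[X]/\<phi>\<close> is a field acting on the lattice sequence, and
  its generator differs from \<open>\<gamma>\<close> by an operator whose valuation is that of \<open>\<phi>(\<gamma>)\<close> minus the largest
  valuation of a monic polynomial of degree \<open>d - 1\<close> at \<open>\<gamma>\<close>. Minimality of \<open>n\<close> makes this less than
  \<open>-r\<close>, while expressing \<open>[\<phi>(\<gamma>), x]\<close> through \<open>[\<gamma>, x]\<close> and dual bases of \<open>F[X]/\<phi>\<close> shows that \<open>\<phi>\<close> does
  not fail after all.

  Consequently \<open>V\<^sup>i\<close> and \<open>V'\<^sup>\<zeta>\<^sup>(\<^sup>i\<^sup>)\<close> are, up to higher valuation, modules over \<open>F[\<gamma>]\<close>. They have split bases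
  over it, which the equality of dimensions allows to choose with the same valuations; matching
  these bases gives isometries \<open>V\<^sup>i \<rightarrow> V'\<^sup>\<zeta>\<^sup>(\<^sup>i\<^sup>)\<close> intertwining the blocks up to \<open>\<aa>\<^sub>-\<^sub>r\<close>, and their direct sum is \<open>g\<close>.
\<close>

section \<open>Lattice sequences as filtrations\<close>

text \<open>Two obstacles shape the proof. A block is stable under \<gamma> only up to level -r, so
  it is not a module over F[\<gamma>]; and a commutator at level -r says little about p(\<gamma>)
  once cancellation makes p(\<gamma>) much smaller than its monomials. Everything is therefore
  stated to leading order: an almost action multiplies and inverts correctly only up to higher
  valuation, which still suffices for splitting bases. It occurs three times: for the residues
  modulo \<phi>, for the compressions of F[\<gamma>] to the blocks, and for bare scalars when the
  simple stratum is zero. The two valuations compared for \<phi> have one source. Reducing X p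
  modulo \<phi> subtracts the top coefficient of p times \<phi>, and the best monic polynomial of
  degree d - 1 bounds how large that coefficient can be. The dual bases are taken for the same
  top-coefficient functional, so the same number bounds the terms of [\<phi>(\<gamma>), x]. As this
  functional is not a field trace, F[X]/\<phi> may be inseparable. Equivalent strata may have
  different lattice sequences; what is transported between them is the filtration on
  endomorphisms.\<close>

lemma int_bounded_max:
  fixes f :: "'a \<Rightarrow> int"
  assumes "x \<in> A" and "\<And>y. y \<in> A \<Longrightarrow> f y \<le> b"
  shows "\<exists>y\<in>A. \<forall>z\<in>A. f z \<le> f y"
proof -
  obtain y where "y \<in> A" and y: "\<And>z. z \<in> A \<Longrightarrow> nat (b - f y) \<le> nat (b - f z)"
    using ex_has_least_nat[of "\<lambda>y. y \<in> A" x "\<lambda>y. nat (b - f y)"] assms(1) by blast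
  have "f z \<le> f y" if "z \<in> A" for z
    using y[OF that] assms(2)[OF that] assms(2)[OF \<open>y \<in> A\<close>] by linarith
  then show ?thesis using \<open>y \<in> A\<close> by blast
qed

locale valued_field =
  fixes v :: "'f::field \<Rightarrow> int"
  assumes local_field: "nonarch_local_field v"
begin

lemma v_mult: "x \<noteq> 0 \<Longrightarrow> y \<noteq> 0 \<Longrightarrow> v (x * y) = v x + v y"
  using local_field unfolding nonarch_local_field_def by blast

lemma v_add: "x \<noteq> 0 \<Longrightarrow> y \<noteq> 0 \<Longrightarrow> x + y \<noteq> 0 \<Longrightarrow> min (v x) (v y) \<le> v (x + y)"
  using local_field unfolding nonarch_local_field_def by blast

lemma unif: "unif v \<noteq> 0" "v (unif v) = 1"
proof -
  have "\<exists>p. p \<noteq> 0 \<and> v p = 1" using local_field unfolding nonarch_local_field_def by blast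
  then have "unif v \<noteq> 0 \<and> v (unif v) = 1" unfolding unif_def by (rule someI_ex)
  then show "unif v \<noteq> 0" "v (unif v) = 1" by auto
qed

lemma v_1 [simp]: "v 1 = 0"
  using v_mult[of 1 1] by simp

lemma v_minus_1 [simp]: "v (- 1) = 0"
  using v_mult[of "- 1" "- 1"] by simp

lemma v_inverse: "x \<noteq> 0 \<Longrightarrow> v (inverse x) = - v x"
  using v_mult[of x "inverse x"] by simp

lemma v_divide: "x \<noteq> 0 \<Longrightarrow> y \<noteq> 0 \<Longrightarrow> v (x / y) = v x - v y"
  by (simp add: divide_inverse v_mult v_inverse)

lemma v_power: "x \<noteq> 0 \<Longrightarrow> v (x ^ n) = int n * v x"
  by (induction n) (auto simp: v_mult algebra_simps)

lemma oF_add: "x \<in> oF v \<Longrightarrow> y \<in> oF v \<Longrightarrow> x + y \<in> oF v"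
  using v_add[of x y] by (cases "x = 0"; cases "y = 0"; cases "x + y = 0") (auto simp: oF_def)

lemma oF_mult: "x \<in> oF v \<Longrightarrow> y \<in> oF v \<Longrightarrow> x * y \<in> oF v"
  by (cases "x = 0"; cases "y = 0") (auto simp: oF_def v_mult)

lemma oF_1: "1 \<in> oF v" and oF_0: "0 \<in> oF v" and oF_minus_1: "- 1 \<in> oF v"
  by (auto simp: oF_def)

lemma sum_lower_bound:
  assumes "\<And>b. b \<in> B \<Longrightarrow> f b = 0 \<or> m \<le> v (f b)"
  shows "sum f B = 0 \<or> m \<le> v (sum f B)"
  using assms
proof (induction B rule: infinite_finite_induct)
  case (insert b B)
  have "f b = 0 \<or> m \<le> v (f b)" "sum f B = 0 \<or> m \<le> v (sum f B)"
    using insert by auto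
  then show ?case
    using v_add[of "f b" "sum f B"] insert.hyps by (cases "f b + sum f B = 0"; cases "f b = 0"; cases "sum f B = 0") auto
qed auto

lemma common_denominator:
  assumes "finite B"
  shows "\<exists>n::nat. \<forall>b\<in>B. unif v ^ n * c b \<in> oF v"
proof -
  define n where "n = nat (Max (insert 0 ((\<lambda>b. - v (c b)) ` B)))"
  have "unif v ^ n * c b \<in> oF v" if "b \<in> B" for b
  proof (cases "c b = 0")
    case False
    have "- v (c b) \<le> Max (insert 0 ((\<lambda>b. - v (c b)) ` B))"
      using that assms by (intro Max_ge) auto
    then show ?thesis using False unif by (auto simp: oF_def v_mult v_power n_def)
  qed (simp add: oF_0)
  then show ?thesis by blast
qed

end

text \<open>A basis-free form of a lattice sequence with period \<open>e\<close>, used alike for the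
  blocks and for their products. \<open>M_closed\<close> says that subspaces are closed in the
  topology of the filtration; it is what makes best approximations exist.\<close>

locale lattice_space = vector_space sc + valued_field v
  for sc :: "'f::field \<Rightarrow> 'v::ab_group_add \<Rightarrow> 'v" and v :: "'f \<Rightarrow> int" +
  fixes e :: int and W :: "'v set" and M :: "int \<Rightarrow> 'v set"
  assumes e_pos: "0 < e"
    and subspace_W: "subspace W"
    and finite_dim: "\<exists>B. finite B \<and> W \<subseteq> span B"
    and M_sub: "x \<in> M t \<Longrightarrow> x \<in> W"
    and M_0: "0 \<in> M t"
    and M_add: "x \<in> M t \<Longrightarrow> y \<in> M t \<Longrightarrow> x + y \<in> M t"
    and M_scale: "c \<noteq> 0 \<Longrightarrow> x \<in> W \<Longrightarrow> sc c x \<in> M (t + e * v c) \<longleftrightarrow> x \<in> M t"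
    and M_Suc: "M (t + 1) \<subseteq> M t"
    and M_exhaust: "x \<in> W \<Longrightarrow> \<exists>t. x \<in> M t"
    and M_closed: "subspace U \<Longrightarrow> U \<subseteq> W \<Longrightarrow> w \<in> W \<Longrightarrow> w \<notin> U \<Longrightarrow> \<exists>t. \<forall>z\<in>U. w - z \<notin> M t"
begin

lemmas W_add = subspace_add[OF subspace_W]
  and W_scale = subspace_scale[OF subspace_W]
  and W_0 = subspace_0[OF subspace_W]
  and W_diff = subspace_diff[OF subspace_W]
  and W_neg = subspace_neg[OF subspace_W]
  and W_sum = subspace_sum[OF subspace_W]

lemma M_antimono: "s \<le> t \<Longrightarrow> x \<in> M t \<Longrightarrow> x \<in> M s"
proof (induction t rule: int_ge_induct)
  case (step i)
  then show ?case using M_Suc by blast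
qed

lemma M_neg: "x \<in> M t \<Longrightarrow> - x \<in> M t"
  using M_scale[of "- 1" x t] M_sub by simp

lemma M_diff: "x \<in> M t \<Longrightarrow> y \<in> M t \<Longrightarrow> x - y \<in> M t"
  using M_add[of x t "- y"] M_neg by simp

lemma M_sum: "(\<And>i. i \<in> A \<Longrightarrow> f i \<in> M t) \<Longrightarrow> sum f A \<in> M t"
  by (induction A rule: infinite_finite_induct) (auto simp: M_0 M_add)

lemma M_oF: "c \<in> oF v \<Longrightarrow> x \<in> M t \<Longrightarrow> sc c x \<in> M t"
proof (cases "c = 0")
  case False
  assume "c \<in> oF v" "x \<in> M t"
  then have "sc c x \<in> M (t + e * v c)" using M_scale[of c x t] M_sub False by auto
  moreover have "t \<le> t + e * v c" using \<open>c \<in> oF v\<close> e_pos False by (auto simp: oF_def)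
  ultimately show ?thesis using M_antimono by blast
qed (simp add: M_0)

lemma M_pF: "c \<in> pF v \<Longrightarrow> x \<in> M t \<Longrightarrow> sc c x \<in> M (t + 1)"
proof (cases "c = 0")
  case False
  assume "c \<in> pF v" "x \<in> M t"
  then have "sc c x \<in> M (t + e * v c)" using M_scale[of c x t] M_sub False by auto
  moreover have "1 \<le> e * v c" using \<open>c \<in> pF v\<close> e_pos False mult_mono[of 1 e 1 "v c"]
    by (auto simp: pF_def)
  ultimately show ?thesis using M_antimono[of "t + 1" "t + e * v c"] by simp
qed (simp add: M_0)

text \<open>The valuation of a nonzero vector. At 0 no \<open>t\<close> qualifies and the value is
  unspecified, hence the nonzero hypotheses around it.\<close>

definition ord :: "'v \<Rightarrow> int" where
  "ord w = (THE t. w \<in> M t \<and> w \<notin> M (t + 1))"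

lemma ord_iff:
  assumes "w \<in> W" "w \<noteq> 0"
  shows "w \<in> M t \<longleftrightarrow> t \<le> ord w"
proof -
  \<comment> \<open>Closedness of the zero subspace is separatedness, so the levels containing
    \<open>w\<close> are bounded above.\<close>
  obtain b where b: "w \<notin> M b"
    using M_closed[of "{0}" w] assms subspace_single_0 W_0 by auto
  obtain a where a: "w \<in> M a" using M_exhaust assms by blast
  have "\<exists>y\<in>{t. w \<in> M t}. \<forall>z\<in>{t. w \<in> M t}. z \<le> y"
  proof (rule int_bounded_max[of a])
    fix y assume "y \<in> {t. w \<in> M t}"
    then show "y \<le> b" using M_antimono[of b y w] b by force
  qed (use a in auto)
  then obtain y where y: "w \<in> M y" "\<And>z. w \<in> M z \<Longrightarrow> z \<le> y" by blast
  have *: "w \<in> M t \<longleftrightarrow> t \<le> y" for t using y M_antimono by blast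
  have "ord w = y"
    unfolding ord_def by (rule the_equality) (auto simp: *)
  then show ?thesis by (simp add: *)
qed

lemma ord_in_M: "w \<in> W \<Longrightarrow> w \<noteq> 0 \<Longrightarrow> w \<in> M (ord w)"
  by (simp add: ord_iff)

lemma M_eq_0: "w \<in> W \<Longrightarrow> (\<And>t. w \<in> M t) \<Longrightarrow> w = 0"
  using ord_iff[of w "ord w + 1"] by (cases "w = 0") auto

lemma ord_eqI:
  assumes "w \<in> W" "w \<noteq> 0" "\<And>t. w \<in> M t \<longleftrightarrow> t \<le> k"
  shows "ord w = k"
  using assms ord_iff by (metis order_refl order_antisym)

lemma ord_scale: "w \<in> W \<Longrightarrow> w \<noteq> 0 \<Longrightarrow> c \<noteq> 0 \<Longrightarrow> ord (sc c w) = e * v c + ord w"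
proof (rule ord_eqI)
  fix t assume w: "w \<in> W" "w \<noteq> 0" "c \<noteq> 0"
  show "sc c w \<in> M t \<longleftrightarrow> t \<le> e * v c + ord w"
    using M_scale[of c w "t - e * v c"] w ord_iff[of w "t - e * v c"] by auto
qed (auto intro: W_scale)

lemma finite_independent:
  "\<exists>N. \<forall>S. independent S \<longrightarrow> S \<subseteq> W \<longrightarrow> finite S \<and> card S \<le> N"
  using finite_dim independent_span_bound by (meson subset_trans)

end

lemma (in vector_space) exists_functional:
  assumes U: "subspace U" and w: "w \<notin> U"
  obtains f :: "'b \<Rightarrow> 'a"
  where "\<And>x y. f (x + y) = f x + f y" "\<And>c x. f (scale c x) = c * f x"
    "\<And>x. x \<in> U \<Longrightarrow> f x = 0" "f w = 1"
proof -
  obtain C where C: "C \<subseteq> U" "independent C" "U \<subseteq> span C"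
    using maximal_independent_subset by blast
  have span_C: "span C \<subseteq> U" using C(1) U by (simp add: span_minimal)
  have "w \<notin> span C" using span_C w by auto
  then have ind: "independent (insert w C)" using C by (simp add: independent_insertI)
  obtain D where D: "insert w C \<subseteq> D" "independent D" "UNIV \<subseteq> span D"
    using maximal_independent_subset_extend[of "insert w C" UNIV] ind by auto
  have sp: "x \<in> span D" for x using D by auto
  show thesis
  proof (rule that[of "\<lambda>x. representation D x w"])
    show "representation D (x + y) w = representation D x w + representation D y w" for x y
      using representation_add[OF D(2) sp sp, of x y] by (simp add: add.commute)
    show "representation D (scale c x) w = c * representation D x w" for c x
      using representation_scale[OF D(2) sp, of c x] by simp
    show "representation D w w = 1" using representation_basis[OF D(2), of w] D by auto
    show "representation D x w = 0" if "x \<in> U" for x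
    proof -
      have "representation D x = representation C x"
        using representation_extend[OF D(2), of x C] C D that by auto
      moreover have "w \<notin> C" using C w by auto
      ultimately show ?thesis using representation_ne_zero by metis
    qed
  qed
qed

text \<open>Units preserve every lattice and the uniformizer shifts by \<open>e\<close>, which
  settles scaling by every nonzero c. Exhaustion and closedness come from a single integral basis of
  \<open>M 0\<close>: it gives a common denominator for the coordinates of a vector and for the
  values of a linear functional.\<close>

lemma lattice_seq_lattice_space:
  assumes vs: "vector_space sc" and F: "nonarch_local_field v"
    and L: "lattice_seq v sc W M"
    and e: "0 < e" "\<And>s. M (s + e) = sc (unif v) ` M s"
  shows "lattice_space sc v e W M"
proof -
  interpret vector_space sc by (rule vs)
  interpret valued_field v by standard (rule F)
  let ?p = "unif v"
  have lat: "\<exists>B. finite B \<and> B \<subseteq> W \<and> independent B \<and> span B = W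
        \<and> M s = {(\<Sum>b\<in>B. sc (c b) b) | c. \<forall>b\<in>B. c b \<in> oF v}" for s
    using L unfolding lattice_seq_def lattice_def by blast
  obtain B where B: "finite B" "span B = W"
    and B0: "M 0 = {(\<Sum>b\<in>B. sc (c b) b) | c. \<forall>b\<in>B. c b \<in> oF v}"
    using lat[of 0] by auto
  have sub: "subspace W" using B by auto
  have M_W: "x \<in> W" if "x \<in> M s" for x s
  proof -
    obtain B c where "span B = W" "x = (\<Sum>b\<in>B. sc (c b) b)"
      using lat[of s] \<open>x \<in> M s\<close> by auto
    moreover have "(\<Sum>b\<in>B. sc (c b) b) \<in> span B" by (intro span_sum span_scale span_base)
    ultimately show ?thesis by simp
  qed
  have add: "x + y \<in> M s" if xy: "x \<in> M s" "y \<in> M s" for x y s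
  proof -
    obtain B where B: "M s = {(\<Sum>b\<in>B. sc (c b) b) | c. \<forall>b\<in>B. c b \<in> oF v}"
      using lat[of s] by auto
    then obtain c d where c: "\<forall>b\<in>B. c b \<in> oF v" "x = (\<Sum>b\<in>B. sc (c b) b)"
      and d: "\<forall>b\<in>B. d b \<in> oF v" "y = (\<Sum>b\<in>B. sc (d b) b)" using xy unfolding B by blast
    have "x + y = (\<Sum>b\<in>B. sc (c b + d b) b)"
      by (simp add: c d sum.distrib scale_left_distrib)
    moreover have "\<forall>b\<in>B. c b + d b \<in> oF v" using c d oF_add by blast
    ultimately show ?thesis unfolding B by (intro CollectI exI[of _ "\<lambda>b. c b + d b"]) simp
  qed
  have oF: "sc a x \<in> M s" if xa: "x \<in> M s" "a \<in> oF v" for a x s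
  proof -
    obtain B where B: "M s = {(\<Sum>b\<in>B. sc (c b) b) | c. \<forall>b\<in>B. c b \<in> oF v}"
      using lat[of s] by auto
    then obtain c where c: "\<forall>b\<in>B. c b \<in> oF v" "x = (\<Sum>b\<in>B. sc (c b) b)"
      using xa unfolding B by blast
    have "sc a x = (\<Sum>b\<in>B. sc (a * c b) b)"
      by (simp add: c scale_sum_right)
    moreover have "\<forall>b\<in>B. a * c b \<in> oF v" using c xa oF_mult by blast
    ultimately show ?thesis unfolding B by (intro CollectI exI[of _ "\<lambda>b. a * c b"]) simp
  qed
  have zero: "0 \<in> M s" for s
  proof -
    obtain B where B: "M s = {(\<Sum>b\<in>B. sc (c b) b) | c. \<forall>b\<in>B. c b \<in> oF v}"
      using lat[of s] by auto
    have "0 = (\<Sum>b\<in>B. sc 0 b)" by simp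
    then show ?thesis unfolding B using oF_0 by (intro CollectI exI[of _ "\<lambda>b. 0"]) simp
  qed
  have shift: "sc (?p ^ n) x \<in> M (s + e * int n) \<longleftrightarrow> x \<in> M s" for n x s
  proof (induction n)
    case (Suc n)
    have "sc (?p ^ Suc n) x \<in> M (s + e * int (Suc n)) \<longleftrightarrow>
        sc ?p (sc (?p ^ n) x) \<in> sc ?p ` M (s + e * int n)"
      using e(2)[of "s + e * int n"] by (simp add: algebra_simps)
    also have "\<dots> \<longleftrightarrow> sc (?p ^ n) x \<in> M (s + e * int n)"
      by (rule inj_image_mem_iff) (use unif in \<open>auto intro!: injI\<close>)
    finally show ?case using Suc by simp
  qed auto
  have unit: "sc c x \<in> M s \<longleftrightarrow> x \<in> M s" if "c \<noteq> 0" "v c = 0" for c x s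
    using oF[of x s c] oF[of "sc c x" s "inverse c"] that
    by (auto simp: oF_def v_inverse)
  have pos: "sc c x \<in> M (s + e * v c) \<longleftrightarrow> x \<in> M s" if c: "c \<noteq> 0" "0 \<le> v c" for c x s
  proof -
    define n where "n = nat (v c)"
    define u where "u = c / ?p ^ n"
    have u: "u \<noteq> 0" "v u = 0" using c unif by (auto simp: u_def n_def v_divide v_power)
    have cu: "?p ^ n * u = c" using unif by (simp add: u_def)
    have "int n = v c" using c by (simp add: n_def)
    then show ?thesis using shift[of n "sc u x" s] unit[OF u, of x s] by (simp add: cu)
  qed
  have scale: "sc c x \<in> M (s + e * v c) \<longleftrightarrow> x \<in> M s" if c: "c \<noteq> 0" for c x s
  proof (cases "0 \<le> v c")
    case False
    then show ?thesis
      using pos[of "inverse c" "sc c x" "s + e * v c"] c by (simp add: v_inverse)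
  qed (use pos c in blast)
  have exhaust: "\<exists>t. x \<in> M t" if xW: "x \<in> W" for x
  proof -
    obtain c where c: "x = (\<Sum>b\<in>B. sc (c b) b)"
      using xW B by (auto simp: span_finite)
    obtain n where n: "\<forall>b\<in>B. ?p ^ n * c b \<in> oF v" using common_denominator[OF B(1)] by blast
    have "sc (?p ^ n) x = (\<Sum>b\<in>B. sc (?p ^ n * c b) b)"
      by (simp add: c scale_sum_right)
    then have "sc (?p ^ n) x \<in> M 0" unfolding B0 using n by (auto intro!: exI[of _ "\<lambda>b. ?p ^ n * c b"])
    then show ?thesis using shift[of n x "- e * int n"] by auto
  qed
  \<comment> \<open>A functional with kernel containing \<open>U\<close> and value 1 at
    \<open>w\<close> becomes integral on \<open>M 0\<close> after multiplication by the n-th power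
    of the uniformizer. The level \<open>e * int (Suc n)\<close> has one factor to spare, so
    membership of \<open>w - z\<close> would make 1 divisible by the uniformizer.\<close>
  have closed: "\<exists>t. \<forall>z\<in>U. w - z \<notin> M t" if U: "subspace U" "w \<notin> U" for U w
  proof -
    obtain f where f: "\<And>x y. f (x + y) = f x + f y" "\<And>c x. f (sc c x) = c * f x"
      "\<And>x. x \<in> U \<Longrightarrow> f x = 0" "f w = 1"
      using exists_functional[OF U] by metis
    have f0: "f 0 = 0" using f(2)[of 0 0] by simp
    have f_sum: "f (sum h A) = (\<Sum>a\<in>A. f (h a))" for h and A :: "'b set"
      by (induction A rule: infinite_finite_induct) (auto simp: f f0)
    have f_diff: "f (x - y) = f x - f y" for x y
      using f(1)[of "x - y" y] by simp
    obtain n where n: "\<forall>b\<in>B. ?p ^ n * f b \<in> oF v" using common_denominator[OF B(1)] by blast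
    have "w - z \<notin> M (e * int (Suc n))" if "z \<in> U" for z
    proof
      assume m: "w - z \<in> M (e * int (Suc n))"
      define y where "y = sc (inverse (?p ^ Suc n)) (w - z)"
      have "?p ^ Suc n \<noteq> 0" using unif by simp
      then have y: "w - z = sc (?p ^ Suc n) y" by (simp add: y_def del: power_Suc)
      then have "y \<in> M 0" using m shift[of "Suc n" y 0] by simp
      then obtain c where c: "\<forall>b\<in>B. c b \<in> oF v" "y = (\<Sum>b\<in>B. sc (c b) b)" unfolding B0 by auto
      have "1 = f (w - z)" using f_diff f that by simp
      also have "\<dots> = ?p * (?p ^ n * f y)" unfolding y f(2) by simp
      also have "?p ^ n * f y = (\<Sum>b\<in>B. c b * (?p ^ n * f b))"
        by (simp add: c f_sum f sum_distrib_left algebra_simps)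
      finally have eq: "1 = ?p * (\<Sum>b\<in>B. c b * (?p ^ n * f b))" (is "1 = ?p * ?s") .
      have "?s = 0 \<or> 0 \<le> v ?s"
      proof (rule sum_lower_bound)
        fix b assume "b \<in> B"
        then have "c b * (?p ^ n * f b) \<in> oF v" using n c oF_mult by blast
        then show "c b * (?p ^ n * f b) = 0 \<or> 0 \<le> v (c b * (?p ^ n * f b))" by (simp add: oF_def)
      qed
      moreover have "?s \<noteq> 0" using eq by auto
      ultimately show False using v_mult[of ?p ?s] unif eq v_1 by simp
    qed
    then show ?thesis by blast
  qed
  show ?thesis
  proof
    show "M (t + 1) \<subseteq> M t" for t using L unfolding lattice_seq_def by blast
    show "\<exists>B. finite B \<and> W \<subseteq> span B" using B by blast
  qed (use e sub M_W zero add scale exhaust closed in blast)+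
qed

section \<open>Split bases over almost actions\<close>

text \<open>Phrased by coefficients so that 0 belongs even for \<open>d = 0\<close> and closure
  under linear combinations is immediate.\<close>

definition lowdeg :: "nat \<Rightarrow> 'a::zero poly set" where
  "lowdeg d = {p. \<forall>i\<ge>d. coeff p i = 0}"

lemma lowdeg_iff: "p \<in> lowdeg d \<longleftrightarrow> p = 0 \<or> degree p < d"
  unfolding lowdeg_def by (auto simp: coeff_eq_0) (meson leading_coeff_0_iff not_le)

lemma lowdeg_0 [simp]: "0 \<in> lowdeg d"
  by (simp add: lowdeg_def)

lemma lowdeg_add: "p \<in> lowdeg d \<Longrightarrow> q \<in> lowdeg d \<Longrightarrow> p + q \<in> lowdeg d"
  by (simp add: lowdeg_def)

lemma lowdeg_diff: "p \<in> lowdeg d \<Longrightarrow> q \<in> lowdeg d \<Longrightarrow> p - q \<in> lowdeg d"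
  for p :: "'a::ab_group_add poly"
  by (simp add: lowdeg_def)

lemma lowdeg_smult: "p \<in> lowdeg d \<Longrightarrow> smult c p \<in> lowdeg d"
  by (simp add: lowdeg_def)

lemma lowdeg_sum: "(\<And>i. i \<in> A \<Longrightarrow> f i \<in> lowdeg d) \<Longrightarrow> sum f A \<in> lowdeg d"
  by (induction A rule: infinite_finite_induct) (auto simp: lowdeg_add)

lemma lowdeg_1: "0 < d \<Longrightarrow> (1 :: 'a::comm_semiring_1 poly) \<in> lowdeg d"
  by (simp add: lowdeg_iff)

text \<open>Polynomials of degree less than \<open>D\<close> act by operators that multiply like the elements of a
  valued field, but only up to operators of larger valuation.\<close>

locale almost_action = lattice_space sc v e V M
  for sc :: "'f::field \<Rightarrow> 'v::ab_group_add \<Rightarrow> 'v" and v :: "'f \<Rightarrow> int" and e :: int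
    and V :: "'v set" and M :: "int \<Rightarrow> 'v set" +
  fixes D :: nat and \<rho> :: "'f poly \<Rightarrow> 'v \<Rightarrow> 'v" and N :: "'f poly \<Rightarrow> int"
  assumes D_pos: "0 < D"
    and rho_closed: "w \<in> V \<Longrightarrow> \<rho> p w \<in> V"
    and rho_add_left: "w \<in> V \<Longrightarrow> \<rho> (p + q) w = \<rho> p w + \<rho> q w"
    and rho_smult: "w \<in> V \<Longrightarrow> \<rho> (smult c p) w = sc c (\<rho> p w)"
    and rho_add: "w \<in> V \<Longrightarrow> w' \<in> V \<Longrightarrow> \<rho> p (w + w') = \<rho> p w + \<rho> p w'"
    and rho_1: "w \<in> V \<Longrightarrow> \<rho> 1 w = w"
    and rho_val: "p \<in> lowdeg D \<Longrightarrow> p \<noteq> 0 \<Longrightarrow> w \<in> V \<Longrightarrow> \<rho> p w \<in> M (t + N p) \<longleftrightarrow> w \<in> M t"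
    and rho_mult: "p \<in> lowdeg D \<Longrightarrow> p \<noteq> 0 \<Longrightarrow> q \<in> lowdeg D \<Longrightarrow> q \<noteq> 0 \<Longrightarrow>
      \<exists>h\<in>lowdeg D. \<forall>t. \<forall>w\<in>M t. \<rho> p (\<rho> q w) - \<rho> h w \<in> M (t + N p + N q + 1)"
    and rho_inverse: "p \<in> lowdeg D \<Longrightarrow> p \<noteq> 0 \<Longrightarrow>
      \<exists>q\<in>lowdeg D. q \<noteq> 0 \<and> N q = - N p \<and> (\<forall>t. \<forall>w\<in>M t. \<rho> q (\<rho> p w) - w \<in> M (t + 1))"
begin

lemma rho_0_left: "w \<in> V \<Longrightarrow> \<rho> 0 w = 0"
  using rho_add_left[of w 0 0] by simp

lemma rho_0: "\<rho> p 0 = 0"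
  using rho_add[of 0 0 p] W_0 by simp

lemma rho_sum: "(\<And>i. i \<in> A \<Longrightarrow> f i \<in> V) \<Longrightarrow> \<rho> p (sum f A) = (\<Sum>i\<in>A. \<rho> p (f i))"
  by (induction A rule: infinite_finite_induct) (auto simp: rho_0 rho_add W_sum)

lemma rho_sum_left: "w \<in> V \<Longrightarrow> \<rho> (sum f A) w = (\<Sum>i\<in>A. \<rho> (f i) w)"
  by (induction A rule: infinite_finite_induct) (auto simp: rho_0_left rho_add_left)

definition comb :: "nat \<Rightarrow> (nat \<Rightarrow> 'v) \<Rightarrow> (nat \<Rightarrow> 'f poly) \<Rightarrow> 'v" where
  "comb m b ps = (\<Sum>j<m. \<rho> (ps j) (b j))"

definition combs :: "nat \<Rightarrow> (nat \<Rightarrow> 'v) \<Rightarrow> 'v set" where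
  "combs m b = {comb m b ps | ps. \<forall>j. ps j \<in> lowdeg D}"

text \<open>A splitting (norm-orthogonal) family: the valuation of a combination is the minimum of
  the valuations of its terms.\<close>

definition split :: "nat \<Rightarrow> (nat \<Rightarrow> 'v) \<Rightarrow> bool" where
  "split m b \<longleftrightarrow> (\<forall>j<m. b j \<in> V \<and> b j \<noteq> 0) \<and>
    (\<forall>ps t. (\<forall>j. ps j \<in> lowdeg D) \<longrightarrow> comb m b ps \<in> M t \<longrightarrow> (\<forall>j<m. \<rho> (ps j) (b j) \<in> M t))"

lemma split_V: "split m b \<Longrightarrow> j < m \<Longrightarrow> b j \<in> V"
  and split_nz: "split m b \<Longrightarrow> j < m \<Longrightarrow> b j \<noteq> 0"
  by (auto simp: split_def)

lemma split_comb_iff: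
  assumes "split m b" "\<forall>j. ps j \<in> lowdeg D"
  shows "comb m b ps \<in> M t \<longleftrightarrow> (\<forall>j<m. \<rho> (ps j) (b j) \<in> M t)"
  using assms unfolding split_def comb_def by (auto intro!: M_sum)

lemma rho_in_M_iff:
  assumes "p \<in> lowdeg D" "w \<in> V"
  shows "\<rho> p w \<in> M t \<longleftrightarrow> p = 0 \<or> w \<in> M (t - N p)"
  using rho_val[OF assms(1) _ assms(2), of "t - N p"] assms rho_0_left[OF assms(2)] M_0
  by (cases "p = 0") auto

lemma comb_closed: "split m b \<Longrightarrow> comb m b ps \<in> V"
  unfolding comb_def by (intro W_sum) (auto intro: rho_closed split_V)

lemma comb_add:
  assumes "split m b"
  shows "comb m b (\<lambda>j. ps j + qs j) = comb m b ps + comb m b qs"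
  using split_V[OF assms] by (simp add: comb_def rho_add_left sum.distrib)

lemma comb_smult:
  assumes "split m b"
  shows "comb m b (\<lambda>j. smult c (ps j)) = sc c (comb m b ps)"
  using split_V[OF assms] by (simp add: comb_def rho_smult scale_sum_right)

lemma comb_sum:
  assumes "split m b"
  shows "comb m b (\<lambda>j. \<Sum>i\<in>A. ps i j) = (\<Sum>i\<in>A. comb m b (ps i))"
proof -
  have "comb m b (\<lambda>j. \<Sum>i\<in>A. ps i j) = (\<Sum>j<m. \<Sum>i\<in>A. \<rho> (ps i j) (b j))"
    unfolding comb_def using split_V[OF assms] by (intro sum.cong) (auto simp: rho_sum_left)
  then show ?thesis unfolding comb_def by (simp add: sum.swap[of _ A])
qed

lemma comb_zero: "split m b \<Longrightarrow> comb m b (\<lambda>j. 0) = 0"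
  using comb_smult[of m b 0 "\<lambda>j. 0"] by simp

lemma comb_inj:
  assumes s: "split m b" and ps: "\<forall>j. ps j \<in> lowdeg D" and qs: "\<forall>j. qs j \<in> lowdeg D"
    and eq: "comb m b ps = comb m b qs" and j: "j < m"
  shows "ps j = qs j"
proof (rule ccontr)
  assume ne: "ps j \<noteq> qs j"
  let ?r = "\<lambda>j. ps j + smult (- 1) (qs j)"
  have r: "\<forall>j. ?r j \<in> lowdeg D" using ps qs by (blast intro: lowdeg_add lowdeg_smult)
  have "comb m b ?r = 0"
    using comb_add[OF s, of ps "\<lambda>j. smult (- 1) (qs j)"] comb_smult[OF s, of "- 1" qs] eq
    by simp
  then have "\<rho> (?r j) (b j) \<in> M t" for t using split_comb_iff[OF s r] M_0 j by auto
  moreover have "?r j \<noteq> 0" using ne by simp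
  ultimately have "b j \<in> M (t - N (?r j))" for t
    using rho_in_M_iff[OF r[rule_format, of j] split_V[OF s j]] by blast
  then have "b j \<in> M t" for t using add_diff_cancel_right' by metis
  then show False using M_eq_0 split_V[OF s j] split_nz[OF s j] by blast
qed

lemma subspace_combs:
  assumes "split m b" shows "subspace (combs m b)"
proof (rule subspaceI)
  show "0 \<in> combs m b" unfolding combs_def using comb_zero[OF assms] by (force intro: exI[of _ "\<lambda>j. 0"])
  fix x y c assume x: "x \<in> combs m b"
  then obtain ps where ps: "x = comb m b ps" "\<forall>j. ps j \<in> lowdeg D" unfolding combs_def by blast
  have "sc c x = comb m b (\<lambda>j. smult c (ps j))" using comb_smult[OF assms] ps by simp
  moreover have "\<forall>j. smult c (ps j) \<in> lowdeg D" using ps lowdeg_smult by blast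
  ultimately show "sc c x \<in> combs m b" unfolding combs_def by blast
  assume "y \<in> combs m b"
  then obtain qs where qs: "y = comb m b qs" "\<forall>j. qs j \<in> lowdeg D" unfolding combs_def by blast
  have "x + y = comb m b (\<lambda>j. ps j + qs j)" using comb_add[OF assms] ps qs by simp
  moreover have "\<forall>j. ps j + qs j \<in> lowdeg D" using ps qs lowdeg_add by blast
  ultimately show "x + y \<in> combs m b" unfolding combs_def by blast
qed

lemma combs_subset: "split m b \<Longrightarrow> combs m b \<subseteq> V"
  unfolding combs_def using comb_closed by blast

lemma split_empty: "split 0 b"
  by (simp add: split_def)

lemma comb_Suc: "comb (Suc m) b ps = comb m b ps + \<rho> (ps m) (b m)"
  by (simp add: comb_def)

lemma comb_upd: "comb m (b(m := w)) ps = comb m b ps"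
  by (simp add: comb_def)

text \<open>The combinations need not be stable under \<open>\<rho> q\<close>, since products leave
  the range of low degrees. Each product can be replaced by its leading-order representative, and
  splitting locates every term in \<open>M t\<close>, so the errors are bounded one by one.\<close>

lemma rho_combs:
  assumes s: "split m b" and z: "z \<in> combs m b" "z \<in> M t" and q: "q \<in> lowdeg D" "q \<noteq> 0"
  shows "\<exists>z'\<in>combs m b. \<rho> q z - z' \<in> M (t + N q + 1)"
proof -
  obtain ps where ps: "z = comb m b ps" "\<forall>j. ps j \<in> lowdeg D" using z unfolding combs_def by blast
  have "\<exists>h\<in>lowdeg D. j < m \<longrightarrow> \<rho> q (\<rho> (ps j) (b j)) - \<rho> h (b j) \<in> M (t + N q + 1)" for j
  proof (cases "ps j = 0 \<or> \<not> j < m")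
    case True
    then show ?thesis
      by (intro bexI[of _ 0]) (auto simp: rho_0_left rho_0 M_0 split_V[OF s])
  next
    case False
    then have "\<rho> (ps j) (b j) \<in> M t" using split_comb_iff[OF s ps(2)] ps z by auto
    then have bj: "b j \<in> M (t - N (ps j))"
      using rho_in_M_iff[of "ps j" "b j" t] ps False split_V[OF s] by auto
    obtain h where h: "h \<in> lowdeg D"
      and *: "\<And>t w. w \<in> M t \<Longrightarrow> \<rho> q (\<rho> (ps j) w) - \<rho> h w \<in> M (t + N q + N (ps j) + 1)"
      using rho_mult[of q "ps j"] q ps False by blast
    show ?thesis using *[OF bj] h by (intro bexI[of _ h]) (auto simp: algebra_simps)
  qed
  then obtain hs where hs: "\<And>j. hs j \<in> lowdeg D"
    "\<And>j. j < m \<Longrightarrow> \<rho> q (\<rho> (ps j) (b j)) - \<rho> (hs j) (b j) \<in> M (t + N q + 1)" by metis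
  have "\<rho> q z = (\<Sum>j<m. \<rho> q (\<rho> (ps j) (b j)))"
    unfolding ps comb_def by (intro rho_sum) (auto intro: rho_closed split_V[OF s])
  then have "\<rho> q z - comb m b hs = (\<Sum>j<m. \<rho> q (\<rho> (ps j) (b j)) - \<rho> (hs j) (b j))"
    by (simp add: comb_def sum_subtractf)
  also have "\<dots> \<in> M (t + N q + 1)" using hs by (intro M_sum) auto
  finally show ?thesis unfolding combs_def using hs by blast
qed

text \<open>If the new term were larger than the whole combination, it would cancel against
  \<open>z\<close> to leading order. Multiplying by an approximate inverse \<open>q\<close> of its
  coefficient turns this into a congruence of \<open>w\<close> with minus \<open>\<rho> q z\<close>,
  hence by \<open>rho_combs\<close> with an old combination, modulo \<open>M (t + 1)\<close>; that
  is excluded by the choice of \<open>w\<close>.\<close>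

lemma split_extend:
  assumes s: "split m b" and w: "w \<in> M t" "\<And>z. z \<in> combs m b \<Longrightarrow> w - z \<notin> M (t + 1)"
  shows "split (Suc m) (b(m := w))"
proof -
  have wV: "w \<in> V" using w M_sub by blast
  have zero_mem: "0 \<in> combs m b" using subspace_combs[OF s] subspace_0 by blast
  then have w0: "w \<noteq> 0" using w(2) M_0 by force
  have last: "\<rho> p w \<in> M u" if p: "p \<in> lowdeg D" and z: "z \<in> combs m b" "z + \<rho> p w \<in> M u" for p z u
  proof (rule ccontr)
    assume n: "\<rho> p w \<notin> M u"
    then have p0: "p \<noteq> 0" using rho_0_left[OF wV] M_0 by auto
    have "w \<notin> M (u - N p)" using n rho_in_M_iff[OF p wV] p0 by blast
    then have less: "t < u - N p" using w(1) M_antimono by (meson not_le)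
    have pw: "\<rho> p w \<in> M (t + N p)" using rho_val[OF p p0 wV] w(1) by blast
    have sum: "z + \<rho> p w \<in> M (t + N p + 1)" using M_antimono[OF _ z(2)] less by simp
    have "z = (z + \<rho> p w) - \<rho> p w" by simp
    then have zM: "z \<in> M (t + N p)"
      using M_diff[OF M_antimono[OF _ sum, of "t + N p"] pw] by simp
    obtain q where q: "q \<in> lowdeg D" "q \<noteq> 0" "N q = - N p"
      and qp: "\<And>t w. w \<in> M t \<Longrightarrow> \<rho> q (\<rho> p w) - w \<in> M (t + 1)"
      using rho_inverse[OF p p0] by blast
    obtain z' where z': "z' \<in> combs m b" "\<rho> q z - z' \<in> M (t + 1)"
      using rho_combs[OF s z(1) zM q(1,2)] q(3) by auto
    have zV: "z \<in> V" using combs_subset[OF s] z by blast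
    have "\<rho> q (z + \<rho> p w) \<in> M (t + 1)"
      using rho_val[OF q(1,2), of "z + \<rho> p w" "t + N p + 1"] sum zV wV q(3) W_add rho_closed by simp
    moreover have "\<rho> q (z + \<rho> p w) = \<rho> q z + \<rho> q (\<rho> p w)"
      using rho_add zV wV rho_closed by blast
    ultimately have "\<rho> q z + \<rho> q (\<rho> p w) - (\<rho> q z - z') - (\<rho> q (\<rho> p w) - w) \<in> M (t + 1)"
      by (intro M_diff[OF M_diff[OF _ z'(2)] qp[OF w(1)]]) simp
    then have "w - (- z') \<in> M (t + 1)" by (simp add: algebra_simps)
    moreover have "- z' \<in> combs m b" using z' subspace_combs[OF s] subspace_neg by blast
    ultimately show False using w(2) by blast
  qed
  show ?thesis
    unfolding split_def
  proof (intro conjI allI impI)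
    fix j assume "j < Suc m"
    then show "(b(m := w)) j \<in> V" "(b(m := w)) j \<noteq> 0"
      using w0 wV split_V[OF s] split_nz[OF s] by (auto simp: less_Suc_eq)
  next
    fix ps u j
    assume ps: "\<forall>j. ps j \<in> lowdeg D" and c: "comb (Suc m) (b(m := w)) ps \<in> M u" and j: "j < Suc m"
    have c': "comb m b ps + \<rho> (ps m) w \<in> M u" using c by (simp add: comb_Suc comb_upd)
    have m: "\<rho> (ps m) w \<in> M u"
      using last[of "ps m" "comb m b ps" u] c' ps unfolding combs_def by blast
    then have "comb m b ps \<in> M u" using M_diff[OF c' m] by simp
    then show "\<rho> (ps j) ((b(m := w)) j) \<in> M u"
      using m j split_comb_iff[OF s ps] by (auto simp: less_Suc_eq)
  qed
qed

text \<open>Closedness bounds how well a vector outside the span can be approximated from it, so a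
  best approximation exists; its error is the required \<open>w\<close>.\<close>

lemma exists_extension:
  assumes s: "split m b" and ne: "combs m b \<noteq> V"
  shows "\<exists>w t. w \<in> M t \<and> (\<forall>z\<in>combs m b. w - z \<notin> M (t + 1))"
proof -
  obtain w where w: "w \<in> V" "w \<notin> combs m b" using combs_subset[OF s] ne by blast
  obtain b' where b': "\<And>z. z \<in> combs m b \<Longrightarrow> w - z \<notin> M b'"
    using M_closed[OF subspace_combs[OF s] combs_subset[OF s] w] by blast
  obtain a where a: "w \<in> M a" using M_exhaust w by blast
  have h0: "0 \<in> combs m b" using subspace_combs[OF s] subspace_0 by blast
  have "\<exists>y\<in>{t. \<exists>z\<in>combs m b. w - z \<in> M t}. \<forall>z\<in>{t. \<exists>z\<in>combs m b. w - z \<in> M t}. z \<le> y"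
  proof (rule int_bounded_max[of a])
    show "a \<in> {t. \<exists>z\<in>combs m b. w - z \<in> M t}" using a h0 by force
    fix y assume "y \<in> {t. \<exists>z\<in>combs m b. w - z \<in> M t}"
    then show "y \<le> b'" using b' M_antimono[of b' y] by force
  qed
  then obtain t z where t: "z \<in> combs m b" "w - z \<in> M t"
    "\<And>t' z. z \<in> combs m b \<Longrightarrow> w - z \<in> M t' \<Longrightarrow> t' \<le> t" by blast
  have "w - z - z' \<notin> M (t + 1)" if "z' \<in> combs m b" for z'
  proof
    assume "w - z - z' \<in> M (t + 1)"
    then have "w - (z + z') \<in> M (t + 1)" by (simp add: diff_diff_add)
    then show False using t(3)[of "z + z'" "t + 1"] t(1) that subspace_add[OF subspace_combs[OF s]] by force
  qed
  then show ?thesis using t by blast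
qed

text \<open>Since \<open>0 < D\<close>, constants are admissible coefficients, and uniqueness of
  coefficients makes a split family linearly independent over F.\<close>

lemma split_length_bounded: "\<exists>K. \<forall>m b. split m b \<longrightarrow> m \<le> K"
proof -
  obtain K where K: "\<And>S. independent S \<Longrightarrow> S \<subseteq> V \<Longrightarrow> finite S \<and> card S \<le> K"
    using finite_independent by blast
  have "m \<le> K" if s: "split m b" for m b
  proof -
    have const: "comb m b (\<lambda>j. [:c j:]) = (\<Sum>j<m. sc (c j) (b j))" for c
    proof -
      have "\<rho> [:c j:] (b j) = sc (c j) (b j)" if "j < m" for j
        using rho_smult[OF split_V[OF s that], of "c j" 1] rho_1[OF split_V[OF s that]] by simp
      then show ?thesis by (simp add: comb_def)
    qed
    have low: "\<forall>j. [:c j:] \<in> lowdeg D" for c :: "nat \<Rightarrow> 'f"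
      using D_pos by (auto simp: lowdeg_iff)
    have inj: "inj_on b {..<m}"
    proof (rule inj_onI)
      fix i j assume ij: "i \<in> {..<m}" "j \<in> {..<m}" "b i = b j"
      have "comb m b (\<lambda>k. [:if k = i then 1 else 0:]) = comb m b (\<lambda>k. [:if k = j then 1 else 0:])"
        unfolding const using ij by (simp add: if_distrib[of "\<lambda>c. sc c _"] sum.delta cong: if_cong)
      from comb_inj[OF s low low this, of i] show "i = j" using ij by (simp split: if_splits)
    qed
    have "independent (b ` {..<m})"
    proof
      assume "dependent (b ` {..<m})"
      then obtain u y where y: "y \<in> b ` {..<m}" "u y \<noteq> 0" "(\<Sum>v\<in>b ` {..<m}. sc (u v) v) = 0"
        by (auto simp: dependent_finite)
      then have "comb m b (\<lambda>j. [:u (b j):]) = comb m b (\<lambda>j. [:0:])"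
        unfolding const by (simp add: sum.reindex[OF inj])
      from comb_inj[OF s low low this] show False using y by auto
    qed
    then have "card (b ` {..<m}) \<le> K" using K split_V[OF s] by blast
    then show ?thesis using card_image[OF inj] by simp
  qed
  then show ?thesis by blast
qed

lemma exists_split_basis: "\<exists>m b. split m b \<and> combs m b = V"
proof -
  obtain K where K: "\<And>m b. split m b \<Longrightarrow> m \<le> K" using split_length_bounded by blast
  define m where "m = (GREATEST m. \<exists>b. split m b)"
  have "\<exists>b. split m b" unfolding m_def
    by (rule GreatestI_nat[where b = K]) (use split_empty K in blast)+
  then obtain b where b: "split m b" by blast
  have "combs m b = V"
  proof (rule ccontr)
    assume "combs m b \<noteq> V"
    then obtain w t where "w \<in> M t" "\<And>z. z \<in> combs m b \<Longrightarrow> w - z \<notin> M (t + 1)"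
      using exists_extension[OF b] by blast
    then have "\<exists>b. split (Suc m) b" using split_extend[OF b] by blast
    then have "Suc m \<le> m" unfolding m_def
      by (rule Greatest_le_nat[where b = K]) (use K in blast)
    then show False by simp
  qed
  then show ?thesis using b by blast
qed

end

section \<open>Aligned split bases and isometries\<close>

context lattice_space
begin

text \<open>Dividing a linear relation by a coefficient of least valuation makes it integral with a
  coefficient 1, which residual independence forbids.\<close>

lemma kindep_independent:
  assumes S: "kindep v sc (M t) (M (t + 1)) S"
  shows "independent S"
proof
  have fin: "finite S" using S unfolding kindep_def by blast
  assume "dependent S"
  then obtain u y where y: "y \<in> S" "u y \<noteq> 0" "(\<Sum>s\<in>S. sc (u s) s) = 0"
    using fin by (auto simp: dependent_finite)
  define y0 where "y0 = arg_min_on (\<lambda>s. v (u s)) {s \<in> S. u s \<noteq> 0}"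
  have fin': "finite {s \<in> S. u s \<noteq> 0}" "{s \<in> S. u s \<noteq> 0} \<noteq> {}" using fin y by auto
  have y0: "y0 \<in> S" "u y0 \<noteq> 0" using arg_min_if_finite(1)[OF fin', of "\<lambda>s. v (u s)"]
    unfolding y0_def by auto
  have min: "v (u y0) \<le> v (u s)" if "s \<in> S" "u s \<noteq> 0" for s
    using arg_min_least[OF fin', of s "\<lambda>s. v (u s)"] that unfolding y0_def by auto
  have "\<forall>s\<in>S. u s / u y0 \<in> oF v"
  proof
    fix s assume "s \<in> S"
    then show "u s / u y0 \<in> oF v"
      using min[of s] y0 v_divide[of "u s" "u y0"] by (cases "u s = 0") (auto simp: oF_def)
  qed
  moreover have "(\<Sum>s\<in>S. sc (u s / u y0) s) = sc (inverse (u y0)) (\<Sum>s\<in>S. sc (u s) s)"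
    by (simp add: scale_sum_right divide_inverse mult.commute)
  then have "(\<Sum>s\<in>S. sc (u s / u y0) s) \<in> M (t + 1)" using y(3) M_0 by simp
  ultimately have "u y0 / u y0 \<in> pF v"
    using S y0(1) unfolding kindep_def by meson
  then show False using y0 by (simp add: pF_def)
qed

text \<open>Needed so that \<open>GREATEST\<close> in \<open>kdim\<close> is an attained
  maximum.\<close>

lemma kindep_bounded: "\<exists>K. \<forall>S t. kindep v sc (M t) (M (t + 1)) S \<longrightarrow> card S \<le> K"
proof -
  obtain K where K: "\<And>S. independent S \<Longrightarrow> S \<subseteq> W \<Longrightarrow> finite S \<and> card S \<le> K"
    using finite_independent by blast
  have "card S \<le> K" if "kindep v sc (M t) (M (t + 1)) S" for S t
    using K[OF kindep_independent[OF that]] that M_sub unfolding kindep_def by blast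
  then show ?thesis by blast
qed

lemma kindep_le_kdim:
  assumes "kindep v sc (M t) (M (t + 1)) S"
  shows "card S \<le> kdim v sc (M t) (M (t + 1))"
proof -
  obtain K where "\<And>S t. kindep v sc (M t) (M (t + 1)) S \<Longrightarrow> card S \<le> K"
    using kindep_bounded by blast
  then show ?thesis unfolding kdim_def
    by (intro Greatest_le_nat[where b = K]) (use assms in blast)+
qed

lemma kdim_attained: "\<exists>S. kindep v sc (M t) (M (t + 1)) S \<and> card S = kdim v sc (M t) (M (t + 1))"
proof -
  obtain K where "\<And>S t. kindep v sc (M t) (M (t + 1)) S \<Longrightarrow> card S \<le> K"
    using kindep_bounded by blast
  moreover have "kindep v sc (M t) (M (t + 1)) {}" by (simp add: kindep_def)
  ultimately show ?thesis unfolding kdim_def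
    by (intro GreatestI_nat[where P = "\<lambda>n. \<exists>S. kindep v sc (M t) (M (t + 1)) S \<and> card S = n"
          and k = 0 and b = K]) (auto intro: exI[of _ "{}"])
qed

end

text \<open>Both actions share \<open>D\<close> and \<open>N\<close>: the same coefficient applied
  to vectors of equal valuation then gives vectors of equal valuation. All transfer between the two
  sides rests on this.\<close>

locale almost_action_pair =
  A: almost_action sc v e V M D \<rho> N + B: almost_action sc v e V' M' D \<rho>' N
  for sc :: "'f::field \<Rightarrow> 'v::ab_group_add \<Rightarrow> 'v" and v :: "'f \<Rightarrow> int" and e :: int
    and V :: "'v set" and M :: "int \<Rightarrow> 'v set" and V' :: "'v set" and M' :: "int \<Rightarrow> 'v set"
    and D :: nat and \<rho> :: "'f poly \<Rightarrow> 'v \<Rightarrow> 'v" and \<rho>' :: "'f poly \<Rightarrow> 'v \<Rightarrow> 'v"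
    and N :: "'f poly \<Rightarrow> int"
begin

definition aligned :: "nat \<Rightarrow> (nat \<Rightarrow> 'v) \<Rightarrow> (nat \<Rightarrow> 'v) \<Rightarrow> bool" where
  "aligned m b b' \<longleftrightarrow> A.split m b \<and> B.split m b' \<and> (\<forall>j<m. \<forall>t. b j \<in> M t \<longleftrightarrow> b' j \<in> M' t)"

lemma aligned_comb_iff:
  assumes al: "aligned m b b'" and ps: "\<forall>j. ps j \<in> lowdeg D"
  shows "A.comb m b ps \<in> M t \<longleftrightarrow> B.comb m b' ps \<in> M' t"
proof -
  have s: "A.split m b" "B.split m b'" using al by (auto simp: aligned_def)
  have "\<rho> (ps j) (b j) \<in> M t \<longleftrightarrow> \<rho>' (ps j) (b' j) \<in> M' t" if "j < m" for j
    using A.rho_in_M_iff[of "ps j" "b j" t] B.rho_in_M_iff[of "ps j" "b' j" t] ps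
      A.split_V[OF s(1) that] B.split_V[OF s(2) that] al that by (auto simp: aligned_def)
  then show ?thesis using A.split_comb_iff[OF s(1) ps] B.split_comb_iff[OF s(2) ps] by auto
qed

text \<open>If no vector of \<open>M' t\<close> extended the second family, a maximal independent subset of
  \<open>M' t / M' (t + 1)\<close> could be moved into the span of the second family, hence into that of the first,
  and \<open>w\<close> would make it larger than \<open>kdim\<close> allows.\<close>

lemma exists_aligned_extension:
  assumes al: "aligned m b b'" and ne: "A.combs m b \<noteq> V"
    and kdim: "\<And>t. kdim v sc (M t) (M (t + 1)) = kdim v sc (M' t) (M' (t + 1))"
  shows "\<exists>w w'. aligned (Suc m) (b(m := w)) (b'(m := w'))"
proof -
  have s: "A.split m b" "B.split m b'" using al by (auto simp: aligned_def)
  obtain w t where w: "w \<in> M t" "\<And>z. z \<in> A.combs m b \<Longrightarrow> w - z \<notin> M (t + 1)"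
    using A.exists_extension[OF s(1) ne] by blast
  have "\<exists>w'. w' \<in> M' t \<and> (\<forall>z\<in>B.combs m b'. w' - z \<notin> M' (t + 1))"
  proof (rule ccontr)
    assume no: "\<not> ?thesis"
    obtain S where S: "kindep v sc (M' t) (M' (t + 1)) S"
      and card_S: "card S = kdim v sc (M' t) (M' (t + 1))" using B.kdim_attained by blast
    have fin: "finite S" and SM: "S \<subseteq> M' t" using S by (auto simp: kindep_def)
    have ind: "c s \<in> pF v" if "\<And>s. s \<in> S \<Longrightarrow> c s \<in> oF v" "(\<Sum>s\<in>S. sc (c s) s) \<in> M' (t + 1)" "s \<in> S" for c s
      using S that unfolding kindep_def by blast
    have "\<exists>ps. (\<forall>j. ps j \<in> lowdeg D) \<and> (s \<in> S \<longrightarrow> s - B.comb m b' ps \<in> M' (t + 1))" for s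
    proof (cases "s \<in> S")
      case True
      then obtain z where "z \<in> B.combs m b'" "s - z \<in> M' (t + 1)" using no SM by blast
      then show ?thesis unfolding B.combs_def by blast
    qed (auto intro: exI[of _ "\<lambda>_. 0"])
    then obtain ps where ps: "\<And>s j. ps s j \<in> lowdeg D"
      "\<And>s. s \<in> S \<Longrightarrow> s - B.comb m b' (ps s) \<in> M' (t + 1)" by metis
    define f where "f s = A.comb m b (ps s)" for s
    have f_combs: "f s \<in> A.combs m b" for s using ps unfolding f_def A.combs_def by blast
    have transfer: "(\<Sum>s\<in>S. sc (c s) (f s)) \<in> M u \<longleftrightarrow> (\<Sum>s\<in>S. sc (c s) (B.comb m b' (ps s))) \<in> M' u" for c u
    proof -
      let ?q = "\<lambda>j. \<Sum>s\<in>S. smult (c s) (ps s j)"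
      have q: "\<forall>j. ?q j \<in> lowdeg D" using ps by (blast intro: lowdeg_sum lowdeg_smult)
      have "A.comb m b ?q = (\<Sum>s\<in>S. sc (c s) (f s))"
        using A.comb_sum[OF s(1), of "\<lambda>s j. smult (c s) (ps s j)" S] by (simp add: A.comb_smult[OF s(1)] f_def)
      moreover have "B.comb m b' ?q = (\<Sum>s\<in>S. sc (c s) (B.comb m b' (ps s)))"
        using B.comb_sum[OF s(2), of "\<lambda>s j. smult (c s) (ps s j)" S] by (simp add: B.comb_smult[OF s(2)])
      ultimately show ?thesis using aligned_comb_iff[OF al q, of u] by simp
    qed
    have lift: "c s \<in> pF v" if c: "\<And>s. s \<in> S \<Longrightarrow> c s \<in> oF v" "(\<Sum>s\<in>S. sc (c s) (f s)) \<in> M (t + 1)" "s \<in> S" for c s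
    proof -
      have "(\<Sum>s\<in>S. sc (c s) (B.comb m b' (ps s))) \<in> M' (t + 1)" using transfer c by blast
      moreover have "(\<Sum>s\<in>S. sc (c s) (s - B.comb m b' (ps s))) \<in> M' (t + 1)"
        using c ps(2) by (intro B.M_sum B.M_oF) auto
      ultimately have "(\<Sum>s\<in>S. sc (c s) (B.comb m b' (ps s))) + (\<Sum>s\<in>S. sc (c s) (s - B.comb m b' (ps s))) \<in> M' (t + 1)"
        by (rule B.M_add)
      then have "(\<Sum>s\<in>S. sc (c s) s) \<in> M' (t + 1)"
        by (simp add: A.scale_right_diff_distrib flip: sum.distrib)
      then show ?thesis using ind c by blast
    qed
    have delta: "(\<Sum>s\<in>S. sc (if s = a then k else 0) (f s)) = sc k (f a)" if "a \<in> S" for a k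
      using that fin by (simp add: if_distrib[of "\<lambda>c. sc c _"] sum.delta cong: if_cong)
    have inj: "inj_on f S"
    proof (rule inj_onI, rule ccontr)
      fix x y assume xy: "x \<in> S" "y \<in> S" "f x = f y" "x \<noteq> y"
      let ?c = "\<lambda>s. (if s = x then 1 else 0) + (if s = y then - 1 else 0)"
      have "(\<Sum>s\<in>S. sc (?c s) (f s)) = 0"
        unfolding A.scale_left_distrib sum.distrib delta[OF xy(1)] delta[OF xy(2)] using xy by simp
      moreover have "\<And>s. ?c s \<in> oF v" using xy by (simp add: A.oF_0 A.oF_1 A.oF_minus_1)
      ultimately have "?c x \<in> pF v" using lift[of ?c x] A.M_0 xy by simp
      then show False using xy by (simp add: pF_def)
    qed
    have f_M: "f s \<in> M t" if "s \<in> S" for s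
    proof -
      have "B.comb m b' (ps s) = s - (s - B.comb m b' (ps s))" by simp
      also have "\<dots> \<in> M' t" using SM that ps(2)[OF that] B.M_Suc[of t] by (blast intro: B.M_diff)
      finally show ?thesis unfolding f_def using aligned_comb_iff[OF al] ps by blast
    qed
    have w_notin: "w \<notin> f ` S" 
    proof
      assume "w \<in> f ` S"
      then have "w - w \<notin> M (t + 1)" using w(2) f_combs by blast
      then show False using A.M_0 by simp
    qed
    have "kindep v sc (M t) (M (t + 1)) (insert w (f ` S))"
      unfolding kindep_def
    proof (intro conjI allI impI ballI)
      show "finite (insert w (f ` S))" "insert w (f ` S) \<subseteq> M t" using fin w f_M by auto
      fix c y
      assume c: "(\<forall>s\<in>insert w (f ` S). c s \<in> oF v) \<and> (\<Sum>s\<in>insert w (f ` S). sc (c s) s) \<in> M (t + 1)"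
        and y: "y \<in> insert w (f ` S)"
      have sum: "sc (c w) w + (\<Sum>s\<in>S. sc (c (f s)) (f s)) \<in> M (t + 1)"
        using c w_notin fin by (simp add: sum.reindex[OF inj])
      let ?z = "\<Sum>s\<in>S. sc (c (f s)) (f s)"
      \<comment> \<open>Were the coefficient of \<open>w\<close> a unit, dividing by it would make
        \<open>w\<close> congruent to a member of \<open>A.combs m b\<close> modulo
        \<open>M (t + 1)\<close>.\<close>
      have cw: "c w \<in> pF v"
      proof (rule ccontr)
        assume n: "c w \<notin> pF v"
        then have u: "c w \<noteq> 0" "v (c w) = 0" using c by (auto simp: pF_def oF_def)
        let ?i = "inverse (c w)"
        have "sc ?i (sc (c w) w + ?z) \<in> M (t + 1)"
          using A.M_oF[OF _ sum, of ?i] u by (simp add: oF_def A.v_inverse)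
        then have "w - (- sc ?i ?z) \<in> M (t + 1)" using u by (simp add: A.scale_right_distrib)
        moreover have "- sc ?i ?z \<in> A.combs m b"
          using A.subspace_combs[OF s(1)] f_combs
          by (intro A.subspace_neg A.subspace_scale A.subspace_sum) auto
        ultimately show False using w by blast
      qed
      have "(sc (c w) w + ?z) - sc (c w) w \<in> M (t + 1)"
        by (intro A.M_diff sum A.M_pF cw w)
      then have "?z \<in> M (t + 1)" by simp
      then have "c (f s) \<in> pF v" if "s \<in> S" for s using lift[of "\<lambda>s. c (f s)"] c that by blast
      then show "c y \<in> pF v" using cw y by blast
    qed
    from A.kindep_le_kdim[OF this] show False
      using card_image[OF inj] card_S kdim[of t] w_notin fin by simp
  qed
  then obtain w' where w': "w' \<in> M' t" "\<And>z. z \<in> B.combs m b' \<Longrightarrow> w' - z \<notin> M' (t + 1)" by blast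
  have "w \<notin> M (t + 1)" "w' \<notin> M' (t + 1)"
    using w(2)[of 0] w'(2)[of 0] A.subspace_0[OF A.subspace_combs[OF s(1)]]
      A.subspace_0[OF B.subspace_combs[OF s(2)]] by auto
  then have "w \<in> M u \<longleftrightarrow> u \<le> t" "w' \<in> M' u \<longleftrightarrow> u \<le> t" for u
    using w(1) w'(1) A.M_antimono[of "t + 1" u w] B.M_antimono[of "t + 1" u w']
      A.M_antimono[of u t w] B.M_antimono[of u t w'] by linarith+
  then have "aligned (Suc m) (b(m := w)) (b'(m := w'))"
    using A.split_extend[OF s(1) w] B.split_extend[OF s(2) w'] al
    by (auto simp: aligned_def less_Suc_eq)
  then show ?thesis by blast
qed

end

text \<open>Extension requires only one of the two families to fall short of its space, and the
  roles of the sides can be exchanged. A longest aligned pair therefore exhausts both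
  spaces.\<close>

lemma (in almost_action_pair) exists_aligned_basis:
  assumes kdim: "\<And>t. kdim v sc (M t) (M (t + 1)) = kdim v sc (M' t) (M' (t + 1))"
  shows "\<exists>m b b'. aligned m b b' \<and> A.combs m b = V \<and> B.combs m b' = V'"
proof -
  interpret swap: almost_action_pair sc v e V' M' V M D \<rho>' \<rho> N
    by (rule almost_action_pair.intro[OF B.almost_action_axioms A.almost_action_axioms])
  have swap: "swap.aligned m b' b \<longleftrightarrow> aligned m b b'" for m b b'
    unfolding aligned_def swap.aligned_def by blast
  obtain K where K: "\<And>m b. A.split m b \<Longrightarrow> m \<le> K" using A.split_length_bounded by blast
  define m where "m = (GREATEST m. \<exists>b b'. aligned m b b')"
  have "aligned 0 b b'" for b b' by (simp add: aligned_def A.split_empty B.split_empty)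
  moreover have "k \<le> K" if "\<exists>b b'. aligned k b b'" for k
    using that K by (auto simp: aligned_def)
  ultimately have "\<exists>b b'. aligned m b b'" unfolding m_def
    by (intro GreatestI_nat[where P = "\<lambda>m. \<exists>b b'. aligned m b b'" and k = 0 and b = K]) blast+
  then obtain b b' where al: "aligned m b b'" by blast
  have no: "\<not> aligned (Suc m) c c'" for c c'
  proof
    assume "aligned (Suc m) c c'"
    moreover have "k \<le> K" if "\<exists>b b'. aligned k b b'" for k
      using that K by (auto simp: aligned_def)
    ultimately have "Suc m \<le> m" unfolding m_def
      by (intro Greatest_le_nat[where P = "\<lambda>m. \<exists>b b'. aligned m b b'" and b = K]) blast+
    then show False by simp
  qed
  have "A.combs m b = V" 
  proof (rule ccontr)
    assume "A.combs m b \<noteq> V"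
    from exists_aligned_extension[OF al this kdim] show False using no by blast
  qed
  moreover have "B.combs m b' = V'"
  proof (rule ccontr)
    assume "B.combs m b' \<noteq> V'"
    from swap.exists_aligned_extension[OF al[folded swap] this kdim[symmetric]]
    show False unfolding swap using no by blast
  qed
  ultimately show ?thesis using al by blast
qed

text \<open>The map keeps the coefficients and exchanges one aligned basis for the other. As one and
  the same \<open>q\<close> approximates \<open>\<beta>\<close> and \<open>\<beta>'\<close> on
  vectors with coefficient \<open>p\<close>, it intertwines them to depth \<open>r\<close>;
  alignment makes it isometric.\<close>

lemma (in almost_action_pair) exists_approximate_intertwiner:
  assumes kdim: "\<And>t. kdim v sc (M t) (M (t + 1)) = kdim v sc (M' t) (M' (t + 1))"
    and add: "\<And>x y. x \<in> V \<Longrightarrow> y \<in> V \<Longrightarrow> \<beta> (x + y) = \<beta> x + \<beta> y"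
      "\<And>x y. x \<in> V' \<Longrightarrow> y \<in> V' \<Longrightarrow> \<beta>' (x + y) = \<beta>' x + \<beta>' y"
    and closed: "\<And>x. x \<in> V \<Longrightarrow> \<beta> x \<in> V"
    and approx: "\<And>p. p \<in> lowdeg D \<Longrightarrow> \<exists>q\<in>lowdeg D.
      (\<forall>w\<in>V. \<forall>t. \<rho> p w \<in> M t \<longrightarrow> \<beta> (\<rho> p w) - \<rho> q w \<in> M (t - r)) \<and>
      (\<forall>w\<in>V'. \<forall>t. \<rho>' p w \<in> M' t \<longrightarrow> \<beta>' (\<rho>' p w) - \<rho>' q w \<in> M' (t - r))"
  shows "\<exists>h. (\<forall>x\<in>V. h x \<in> V') \<and> (\<forall>x\<in>V. \<forall>y\<in>V. h (x + y) = h x + h y)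
    \<and> (\<forall>c. \<forall>x\<in>V. h (sc c x) = sc c (h x)) \<and> h ` V = V'
    \<and> (\<forall>x\<in>V. \<forall>t. h x \<in> M' t \<longleftrightarrow> x \<in> M t)
    \<and> (\<forall>t. \<forall>x\<in>M t. h (\<beta> x) - \<beta>' (h x) \<in> M' (t - r))"
proof -
  obtain m b b' where al: "aligned m b b'" and span: "A.combs m b = V" "B.combs m b' = V'"
    using exists_aligned_basis[OF kdim] by blast
  have s: "A.split m b" "B.split m b'" using al by (auto simp: aligned_def)
  \<comment> \<open>Coefficients at indices from \<open>m\<close> on are undetermined, hence the
    choice; \<open>comb\<close> ignores them and those below \<open>m\<close> are unique.\<close>
  define co where "co x = (SOME ps. (\<forall>j. ps j \<in> lowdeg D) \<and> x = A.comb m b ps)" for x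
  define h where "h x = B.comb m b' (co x)" for x
  have co: "\<forall>j. co x j \<in> lowdeg D" "A.comb m b (co x) = x" if "x \<in> V" for x
  proof -
    have "\<exists>ps. (\<forall>j. ps j \<in> lowdeg D) \<and> x = A.comb m b ps"
      using that span unfolding A.combs_def by blast
    then have "(\<forall>j. co x j \<in> lowdeg D) \<and> x = A.comb m b (co x)" unfolding co_def by (rule someI_ex)
    then show "\<forall>j. co x j \<in> lowdeg D" "A.comb m b (co x) = x" by auto
  qed
  have h: "h (A.comb m b ps) = B.comb m b' ps" if ps: "\<forall>j. ps j \<in> lowdeg D" for ps
  proof -
    have "co (A.comb m b ps) j = ps j" if "j < m" for j
      using A.comb_inj[OF s(1) _ ps _ that] co A.comb_closed[OF s(1)] by blast
    then show ?thesis by (simp add: h_def B.comb_def)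
  qed
  have h_V: "h x \<in> V'" for x unfolding h_def by (rule B.comb_closed[OF s(2)])
  have h_add: "h (x + y) = h x + h y" if "x \<in> V" "y \<in> V" for x y
    using h[of "\<lambda>j. co x j + co y j"] co[OF that(1)] co[OF that(2)]
    by (simp add: lowdeg_add A.comb_add[OF s(1)] B.comb_add[OF s(2)] h_def)
  have h_scale: "h (sc c x) = sc c (h x)" if "x \<in> V" for x c
    using h[of "\<lambda>j. smult c (co x j)"] co[OF that]
    by (simp add: lowdeg_smult A.comb_smult[OF s(1)] B.comb_smult[OF s(2)] h_def)
  have h_diff: "h (x - y) = h x - h y" if "x \<in> V" "y \<in> V" for x y
    using h_add[of "x - y" y] that A.W_diff by simp
  have h_M: "h x \<in> M' t \<longleftrightarrow> x \<in> M t" if "x \<in> V" for x t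
    using aligned_comb_iff[OF al co(1)[OF that], of t] co(2)[OF that] by (simp add: h_def)
  have h_surj: "h ` V = V'"
  proof
    show "V' \<subseteq> h ` V"
    proof
      fix y assume "y \<in> V'"
      then obtain ps where "\<forall>j. ps j \<in> lowdeg D" "y = B.comb m b' ps"
        using span unfolding B.combs_def by blast
      then show "y \<in> h ` V" using h A.comb_closed[OF s(1)] by (metis imageI)
    qed
  qed (use h_V in blast)
  have "h (\<beta> x) - \<beta>' (h x) \<in> M' (t - r)" if x: "x \<in> M t" for x t
  proof -
    have xV: "x \<in> V" using x A.M_sub by blast
    let ?p = "co x"
    obtain q where q: "\<And>j. q j \<in> lowdeg D"
      and qA: "\<And>j w t. w \<in> V \<Longrightarrow> \<rho> (?p j) w \<in> M t \<Longrightarrow> \<beta> (\<rho> (?p j) w) - \<rho> (q j) w \<in> M (t - r)"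
      and qB: "\<And>j w t. w \<in> V' \<Longrightarrow> \<rho>' (?p j) w \<in> M' t \<Longrightarrow> \<beta>' (\<rho>' (?p j) w) - \<rho>' (q j) w \<in> M' (t - r)"
      using approx[OF co(1)[OF xV, rule_format]] by metis
    have zero: "\<beta> 0 = 0" "\<beta>' 0 = 0" using add(1)[of 0 0] add(2)[of 0 0] A.W_0 B.W_0 by auto
    have b_sum: "(\<And>i. i \<in> J \<Longrightarrow> f i \<in> V) \<Longrightarrow> \<beta> (sum f J) = (\<Sum>i\<in>J. \<beta> (f i))" for f and J :: "nat set"
      by (induction J rule: infinite_finite_induct) (auto simp: zero add A.W_sum)
    have "\<beta> (A.comb m b ?p) = (\<Sum>j<m. \<beta> (\<rho> (?p j) (b j)))"
      unfolding A.comb_def by (rule b_sum) (use A.rho_closed A.split_V[OF s(1)] in auto)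
    then have "\<beta> x - A.comb m b q = (\<Sum>j<m. \<beta> (\<rho> (?p j) (b j)) - \<rho> (q j) (b j))"
      unfolding co(2)[OF xV] by (simp add: A.comb_def sum_subtractf)
    also have "\<dots> \<in> M (t - r)"
      using A.split_comb_iff[OF s(1) co(1)[OF xV], of t] co(2)[OF xV] x qA A.split_V[OF s(1)]
      by (intro A.M_sum) auto
    finally have "h (\<beta> x - A.comb m b q) \<in> M' (t - r)"
      using h_M A.M_sub by blast
    then have 1: "h (\<beta> x) - B.comb m b' q \<in> M' (t - r)"
      using h_diff[OF closed[OF xV] A.comb_closed[OF s(1)]] h q by simp
    have b'_sum: "(\<And>i. i \<in> J \<Longrightarrow> f i \<in> V') \<Longrightarrow> \<beta>' (sum f J) = (\<Sum>i\<in>J. \<beta>' (f i))" for f and J :: "nat set"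
      by (induction J rule: infinite_finite_induct) (auto simp: zero add B.W_sum)
    have "\<beta>' (h x) = (\<Sum>j<m. \<beta>' (\<rho>' (?p j) (b' j)))"
      unfolding h_def B.comb_def by (rule b'_sum) (use B.rho_closed B.split_V[OF s(2)] in auto)
    then have "\<beta>' (h x) - B.comb m b' q = (\<Sum>j<m. \<beta>' (\<rho>' (?p j) (b' j)) - \<rho>' (q j) (b' j))"
      by (simp add: B.comb_def sum_subtractf)
    also have "\<dots> \<in> M' (t - r)"
      using B.split_comb_iff[OF s(2) co(1)[OF xV], of t] h_M[OF xV, of t] x qB B.split_V[OF s(2)]
      unfolding h_def by (intro B.M_sum) auto
    finally have "(h (\<beta> x) - B.comb m b' q) - (\<beta>' (h x) - B.comb m b' q) \<in> M' (t - r)"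
      using 1 B.M_diff by blast
    then show ?thesis by simp
  qed
  then show ?thesis using h_V h_add h_scale h_M h_surj by blast
qed

section \<open>Polynomials in an endomorphism\<close>

definition poly_act :: "('f::field \<Rightarrow> 'v::ab_group_add \<Rightarrow> 'v) \<Rightarrow> ('v \<Rightarrow> 'v) \<Rightarrow> 'f poly \<Rightarrow> 'v \<Rightarrow> 'v" where
  "poly_act sc g p w = (\<Sum>i\<le>degree p. sc (coeff p i) ((g ^^ i) w))"

locale endo_action = vector_space sc
  for sc :: "'f::field \<Rightarrow> 'v::ab_group_add \<Rightarrow> 'v" +
  fixes W :: "'v set" and g :: "'v \<Rightarrow> 'v"
  assumes subspace: "subspace W" and endo: "endo sc W g"
begin

abbreviation P :: "'f poly \<Rightarrow> 'v \<Rightarrow> 'v" where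
  "P \<equiv> poly_act sc g"

lemma g_closed: "w \<in> W \<Longrightarrow> g w \<in> W"
  and g_add: "w \<in> W \<Longrightarrow> w' \<in> W \<Longrightarrow> g (w + w') = g w + g w'"
  and g_scale: "w \<in> W \<Longrightarrow> g (sc c w) = sc c (g w)"
  using endo unfolding endo_def by blast+

lemma g_0: "g 0 = 0"
  using g_add[of 0 0] subspace_0[OF subspace] by simp

lemma g_sum: "(\<And>i. i \<in> A \<Longrightarrow> f i \<in> W) \<Longrightarrow> g (sum f A) = (\<Sum>i\<in>A. g (f i))"
  by (induction A rule: infinite_finite_induct) (auto simp: g_0 g_add subspace_sum[OF subspace])

lemma pow_closed: "w \<in> W \<Longrightarrow> (g ^^ i) w \<in> W"
  by (induction i) (auto simp: g_closed)

lemma P_eq_sum: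
  assumes "\<And>i. m \<le> i \<Longrightarrow> coeff p i = 0"
  shows "P p w = (\<Sum>i<m. sc (coeff p i) ((g ^^ i) w))"
  unfolding poly_act_def
proof (rule sum.mono_neutral_cong)
  fix i assume "i \<in> {..degree p} - {..<m}"
  then show "sc (coeff p i) ((g ^^ i) w) = 0" using assms by simp
next
  fix i assume "i \<in> {..<m} - {..degree p}"
  then show "sc (coeff p i) ((g ^^ i) w) = 0" by (simp add: coeff_eq_0)
qed auto

lemma P_0 [simp]: "P 0 w = 0"
  by (simp add: poly_act_def)

lemma P_add_left: "P (p + q) w = P p w + P q w"
proof -
  let ?m = "Suc (max (degree p) (degree q))"
  have "P (p + q) w = (\<Sum>i<?m. sc (coeff (p + q) i) ((g ^^ i) w))"
    by (rule P_eq_sum) (simp add: coeff_eq_0)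
  also have "\<dots> = (\<Sum>i<?m. sc (coeff p i) ((g ^^ i) w)) + (\<Sum>i<?m. sc (coeff q i) ((g ^^ i) w))"
    by (simp add: scale_left_distrib sum.distrib)
  also have "\<dots> = P p w + P q w"
    by (subst (1 2) P_eq_sum[symmetric]) (simp_all add: coeff_eq_0)
  finally show ?thesis .
qed

lemma P_smult: "P (smult c p) w = sc c (P p w)"
proof -
  have "P (smult c p) w = (\<Sum>i<Suc (degree p). sc (coeff (smult c p) i) ((g ^^ i) w))"
    by (rule P_eq_sum) (simp add: coeff_eq_0)
  also have "\<dots> = sc c (P p w)"
    by (simp add: poly_act_def scale_sum_right lessThan_Suc_atMost)
  finally show ?thesis .
qed

lemma P_diff_left: "P (p - q) w = P p w - P q w"
  using P_add_left[of "p - q" q w] by simp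

lemma P_sum_left: "P (sum f A) w = (\<Sum>i\<in>A. P (f i) w)"
  by (induction A rule: infinite_finite_induct) (auto simp: P_add_left)

lemma P_closed: "w \<in> W \<Longrightarrow> P p w \<in> W"
  unfolding poly_act_def
  by (intro subspace_sum[OF subspace] subspace_scale[OF subspace] pow_closed)

lemma P_pCons:
  assumes "w \<in> W" shows "P (pCons a p) w = sc a w + g (P p w)"
proof -
  have "P (pCons a p) w = (\<Sum>i<Suc (Suc (degree p)). sc (coeff (pCons a p) i) ((g ^^ i) w))"
    by (rule P_eq_sum) (auto simp: coeff_pCons coeff_eq_0 split: nat.splits)
  also have "\<dots> = sc a w + (\<Sum>i<Suc (degree p). sc (coeff p i) (g ((g ^^ i) w)))"
    by (simp only: sum.lessThan_Suc_shift[of _ "Suc (degree p)"]) simp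
  also have "(\<Sum>i<Suc (degree p). sc (coeff p i) (g ((g ^^ i) w))) = g (P p w)"
    unfolding poly_act_def lessThan_Suc_atMost
    using assms by (subst g_sum) (auto simp: g_scale pow_closed subspace_scale[OF subspace])
  finally show ?thesis .
qed

lemma P_1: "w \<in> W \<Longrightarrow> P 1 w = w"
  by (simp add: poly_act_def)

lemma P_X: "w \<in> W \<Longrightarrow> P [:0, 1:] w = g w"
  by (simp add: P_pCons g_0)

lemma P_add: "w \<in> W \<Longrightarrow> w' \<in> W \<Longrightarrow> P p (w + w') = P p w + P p w'"
proof (induction p)
  case (pCons a p)
  then show ?case
    using P_closed subspace_add[OF subspace]
    by (simp add: P_pCons scale_right_distrib g_add)
qed simp

lemma P_scale: "w \<in> W \<Longrightarrow> P p (sc c w) = sc c (P p w)"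
proof (induction p)
  case (pCons a p)
  then show ?case
    using P_closed subspace_scale[OF subspace]
    by (simp add: P_pCons scale_right_distrib g_scale mult.commute)
qed simp

lemma P_zero: "P p 0 = 0"
  using P_add[of 0 0 p] subspace_0[OF subspace] by simp

lemma P_diff: "w \<in> W \<Longrightarrow> w' \<in> W \<Longrightarrow> P p (w - w') = P p w - P p w'"
  using P_add[of "w - w'" w' p] subspace_diff[OF subspace] by simp

lemma P_sum: "(\<And>i. i \<in> A \<Longrightarrow> f i \<in> W) \<Longrightarrow> P p (sum f A) = (\<Sum>i\<in>A. P p (f i))"
  by (induction A rule: infinite_finite_induct) (auto simp: P_zero P_add subspace_sum[OF subspace])

lemma P_mult: "w \<in> W \<Longrightarrow> P (p * q) w = P p (P q w)"
proof (induction p)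
  case (pCons a p)
  then show ?case using P_closed by (simp add: P_add_left P_smult P_pCons)
qed simp

end

text \<open>Says that F[g] is a field normalizing the filtration. Polynomials rather than elements
  of \<open>Falg\<close> carry the statement because their degrees drive the later
  induction.\<close>

locale pure_action = lattice_space sc v e W M + endo_action sc W g
  for sc :: "'f::field \<Rightarrow> 'v::ab_group_add \<Rightarrow> 'v" and v :: "'f \<Rightarrow> int" and e :: int
    and W :: "'v set" and M :: "int \<Rightarrow> 'v set" and g :: "'v \<Rightarrow> 'v" +
  assumes nontrivial: "\<exists>w\<in>W. w \<noteq> 0"
    and act_cases: "(\<forall>w\<in>W. poly_act sc g p w = 0) \<or>
      (\<exists>k. \<forall>w\<in>W. \<forall>t. poly_act sc g p w \<in> M (t + k) \<longleftrightarrow> w \<in> M t)"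
    and act_inverse: "(\<forall>w\<in>W. poly_act sc g p w = 0) \<or>
      (\<exists>q. \<forall>w\<in>W. poly_act sc g q (poly_act sc g p w) = w)"
begin

definition ann :: "'f poly \<Rightarrow> bool" where
  "ann p \<longleftrightarrow> (\<forall>w\<in>W. P p w = 0)"

definition mdeg :: nat where
  "mdeg = (LEAST n. \<exists>p. p \<noteq> 0 \<and> degree p = n \<and> ann p)"

text \<open>Unless g acts as zero, its inverse is some q(g), and q X - 1 annihilates; its constant
  term is -1, so it is nonzero.\<close>

lemma exists_ann: "\<exists>p. p \<noteq> 0 \<and> degree p = mdeg \<and> ann p"
proof -
  have "\<exists>p. p \<noteq> 0 \<and> ann p"
  proof (cases "ann [:0, 1:]")
    case False
    then obtain q where q: "\<And>w. w \<in> W \<Longrightarrow> P q (P [:0, 1:] w) = w"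
      using act_inverse[of "[:0, 1:]"] unfolding ann_def by blast
    have "ann (q * [:0, 1:] - 1)"
      unfolding ann_def using q by (simp add: P_diff_left P_mult P_1 del: mult_pCons_right)
    moreover have "q * [:0, 1:] - 1 \<noteq> 0"
    proof
      assume "q * [:0, 1:] - 1 = 0"
      then have "coeff (q * [:0, 1:]) 0 = 1" by simp
      then show False by (simp add: coeff_mult)
    qed
    ultimately show ?thesis by blast
  qed (auto intro!: exI[of _ "[:0, 1:]"])
  then have "\<exists>n p. p \<noteq> 0 \<and> degree p = n \<and> ann p" by blast
  then show ?thesis unfolding mdeg_def by (rule LeastI_ex)
qed

lemma low_not_ann: "p \<in> lowdeg mdeg \<Longrightarrow> p \<noteq> 0 \<Longrightarrow> \<not> ann p"
  unfolding lowdeg_iff mdeg_def by (metis (mono_tags, lifting) not_less_Least)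

definition w0 :: 'v where "w0 = (SOME w. w \<in> W \<and> w \<noteq> 0)"

lemma w0: "w0 \<in> W" "w0 \<noteq> 0"
proof -
  have "w0 \<in> W \<and> w0 \<noteq> 0" unfolding w0_def by (rule someI_ex) (use nontrivial in blast)
  then show "w0 \<in> W" "w0 \<noteq> 0" by auto
qed

text \<open>The valuation of p(g), measured at one vector; \<open>act_val_aux\<close> shows that the
  vector does not matter. For annihilating polynomials the value is unspecified, which is why the
  rules for \<open>N\<close> are guarded by \<open>\<not> ann\<close>.\<close>

definition N :: "'f poly \<Rightarrow> int" where "N p = ord (P p w0) - ord w0"

lemma act_val_aux:
  assumes "\<not> ann p"
  shows "(\<forall>w\<in>W. w \<noteq> 0 \<longrightarrow> P p w \<noteq> 0) \<and> (\<forall>w\<in>W. \<forall>t. P p w \<in> M (t + N p) \<longleftrightarrow> w \<in> M t)"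
proof -
  obtain k where k: "\<And>w t. w \<in> W \<Longrightarrow> P p w \<in> M (t + k) \<longleftrightarrow> w \<in> M t"
    using assms act_cases[of p] unfolding ann_def by blast
  have nz: "P p w \<noteq> 0" if "w \<in> W" "w \<noteq> 0" for w
  proof
    assume "P p w = 0"
    then have "w \<in> M t" for t using k[OF that(1), of t] M_0 by simp
    then show False using M_eq_0 that by blast
  qed
  have "ord (P p w0) = ord w0 + k"
  proof (rule ord_eqI)
    show "P p w0 \<in> M t \<longleftrightarrow> t \<le> ord w0 + k" for t
      using k[OF w0(1), of "t - k"] ord_iff[OF w0, of "t - k"] by auto
  qed (use P_closed w0 nz in auto)
  then have "N p = k" by (simp add: N_def)
  then show ?thesis using k nz by blast
qed

lemma act_nz: "\<not> ann p \<Longrightarrow> w \<in> W \<Longrightarrow> w \<noteq> 0 \<Longrightarrow> P p w \<noteq> 0"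
  and act_val: "\<not> ann p \<Longrightarrow> w \<in> W \<Longrightarrow> P p w \<in> M (t + N p) \<longleftrightarrow> w \<in> M t"
  using act_val_aux by blast+

lemma act_M: "\<not> ann p \<Longrightarrow> w \<in> M t \<Longrightarrow> P p w \<in> M (t + N p)"
  using act_val M_sub by blast

lemma ann_iff: "ann p \<longleftrightarrow> P p w0 = 0"
  using act_nz[OF _ w0] w0 unfolding ann_def by blast

lemma N_ge_iff: "\<not> ann p \<Longrightarrow> k \<le> N p \<longleftrightarrow> P p w0 \<in> M (ord w0 + k)"
  using ord_iff[of "P p w0"] P_closed[OF w0(1)] unfolding ann_iff N_def by auto

lemma mdeg_pos: "0 < mdeg"
proof (rule ccontr)
  assume "\<not> 0 < mdeg"
  then obtain p where p: "p \<noteq> 0" "degree p = 0" "ann p" using exists_ann by auto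
  then obtain c where "p = [:c:]" "c \<noteq> 0" by (metis degree_eq_zeroE pCons_0_0)
  then show False using p w0 by (simp add: ann_iff P_pCons g_0)
qed

lemma not_ann_mult: "\<not> ann p \<Longrightarrow> \<not> ann q \<Longrightarrow> \<not> ann (p * q)"
  using act_nz P_closed w0 by (metis ann_iff P_mult)

lemma not_ann_smult: "\<not> ann p \<Longrightarrow> c \<noteq> 0 \<Longrightarrow> \<not> ann (smult c p)"
  by (simp add: ann_iff P_smult)

lemma N_mult:
  assumes "\<not> ann p" "\<not> ann q" shows "N (p * q) = N p + N q"
proof -
  have "ord (P p (P q w0)) = ord (P q w0) + N p"
  proof (rule ord_eqI)
    show "P p (P q w0) \<in> M t \<longleftrightarrow> t \<le> ord (P q w0) + N p" for t
      using act_val[OF assms(1), of "P q w0" "t - N p"] ord_iff[of "P q w0" "t - N p"]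
        P_closed[OF w0(1)] act_nz[OF assms(2) w0] by auto
  qed (use assms act_nz P_closed w0 in auto)
  then show ?thesis unfolding N_def[of "p * q"] N_def[of q] using w0 by (simp add: P_mult)
qed

lemma N_smult: "\<not> ann p \<Longrightarrow> c \<noteq> 0 \<Longrightarrow> N (smult c p) = e * v c + N p"
  using ord_scale[of "P p w0" c] P_closed[OF w0(1)] by (simp add: N_def P_smult ann_iff)

lemma N_1: "N 1 = 0"
  using w0 by (simp add: N_def P_1)

lemma N_add:
  assumes "\<not> ann (p + q)" "\<not> ann p \<Longrightarrow> k \<le> N p" "\<not> ann q \<Longrightarrow> k \<le> N q"
  shows "k \<le> N (p + q)"
proof -
  have "P p w0 \<in> M (ord w0 + k)" "P q w0 \<in> M (ord w0 + k)"
    using assms N_ge_iff M_0 by (metis ann_iff)+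
  then show ?thesis using N_ge_iff[OF assms(1)] by (simp add: P_add_left M_add)
qed

lemma N_diff:
  assumes "\<not> ann (p - q)" "\<not> ann p \<Longrightarrow> k \<le> N p" "\<not> ann q \<Longrightarrow> k \<le> N q"
  shows "k \<le> N (p - q)"
proof -
  have "P p w0 \<in> M (ord w0 + k)" "P q w0 \<in> M (ord w0 + k)"
    using assms N_ge_iff M_0 by (metis ann_iff)+
  then show ?thesis using N_ge_iff[OF assms(1)] by (simp add: P_diff_left M_diff)
qed

section \<open>Monic polynomials of largest valuation at g\<close>

definition is_best :: "nat \<Rightarrow> 'f poly \<Rightarrow> bool" where
  "is_best i \<phi> \<longleftrightarrow> lead_coeff \<phi> = 1 \<and> degree \<phi> = i \<and>
    (\<forall>\<psi>. lead_coeff \<psi> = 1 \<longrightarrow> degree \<psi> = i \<longrightarrow> N \<psi> \<le> N \<phi>)"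

text \<open>The vectors p(g) w0 with p of degree below \<open>i\<close> form a closed subspace that
  misses the i-th power of g applied to w0, so the valuations of the monic polynomials of degree
  \<open>i\<close> are bounded above.\<close>

lemma exists_best:
  assumes "i < mdeg" shows "\<exists>\<phi>. is_best i \<phi>"
proof -
  let ?U = "(\<lambda>p. P p w0) ` lowdeg i"
  let ?m = "monom 1 i :: 'f poly"
  have U: "subspace ?U"
  proof (rule subspaceI)
    show "0 \<in> ?U" by (force intro: image_eqI[of _ _ 0])
    show "x + y \<in> ?U" if "x \<in> ?U" "y \<in> ?U" for x y
      using that lowdeg_add by (fastforce simp: P_add_left[symmetric])
    show "sc c x \<in> ?U" if "x \<in> ?U" for x c
      using that lowdeg_smult by (fastforce simp: P_smult[symmetric])
  qed
  have mon: "lead_coeff \<psi> = 1 \<and> degree \<psi> = i \<Longrightarrow> ?m - \<psi> \<in> lowdeg i" for \<psi>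
    by (auto simp: lowdeg_def coeff_eq_0)
  have mon': "lead_coeff (?m - p) = 1 \<and> degree (?m - p) = i" if p: "p \<in> lowdeg i" for p
  proof -
    have "coeff (?m - p) i = 1" using p by (simp add: lowdeg_def)
    moreover have "degree (?m - p) \<le> i"
      using p by (intro degree_le) (auto simp: lowdeg_def)
    ultimately show ?thesis using le_degree[of "?m - p" i] by auto
  qed
  have low: "\<not> ann \<psi>" if "lead_coeff \<psi> = 1 \<and> degree \<psi> = i" for \<psi>
    using low_not_ann[of \<psi>] that assms by (force simp: lowdeg_iff)
  have notin: "P ?m w0 \<notin> ?U"
  proof
    assume "P ?m w0 \<in> ?U"
    then obtain p where p: "p \<in> lowdeg i" "P ?m w0 = P p w0" by blast
    then show False using low[OF mon'[OF p(1)]] by (simp add: ann_iff P_diff_left)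
  qed
  have "?U \<subseteq> W" using P_closed w0 by blast
  then obtain t where t: "\<And>z. z \<in> ?U \<Longrightarrow> P ?m w0 - z \<notin> M t"
    using M_closed[OF U _ _ notin] P_closed w0 by blast
  have "\<exists>\<phi>\<in>{\<psi>. lead_coeff \<psi> = 1 \<and> degree \<psi> = i}. \<forall>\<psi>\<in>{\<psi>. lead_coeff \<psi> = 1 \<and> degree \<psi> = i}. N \<psi> \<le> N \<phi>"
  proof (rule int_bounded_max)
    show "?m \<in> {\<psi>. lead_coeff \<psi> = 1 \<and> degree \<psi> = i}"
      by (simp add: degree_monom_eq)
    fix \<psi> :: "'f poly" assume "\<psi> \<in> {\<psi>. lead_coeff \<psi> = 1 \<and> degree \<psi> = i}"
    then have psi: "lead_coeff \<psi> = 1 \<and> degree \<psi> = i" by blast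
    have "P ?m w0 - P (?m - \<psi>) w0 \<notin> M t" using t mon[OF psi] by blast
    then have "P \<psi> w0 \<notin> M t" by (simp add: P_diff_left)
    then have "\<not> t - ord w0 \<le> N \<psi>" using N_ge_iff[OF low[OF psi], of "t - ord w0"] by simp
    then show "N \<psi> \<le> t - ord w0" by simp
  qed
  then show ?thesis unfolding is_best_def by blast
qed

definition best :: "nat \<Rightarrow> 'f poly" where "best i = (SOME \<phi>. is_best i \<phi>)"

lemma best: "i < mdeg \<Longrightarrow> is_best i (best i)"
  unfolding best_def using exists_best by (metis someI_ex)

lemma best_coeff: "i < mdeg \<Longrightarrow> coeff (best i) i = 1"
  and best_degree: "i < mdeg \<Longrightarrow> degree (best i) = i"
  using best[of i] unfolding is_best_def by auto

lemma best_nz: "i < mdeg \<Longrightarrow> best i \<noteq> 0"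
  using best_coeff by force

lemma best_not_ann: "i < mdeg \<Longrightarrow> \<not> ann (best i)"
  using low_not_ann best_nz best_degree by (auto simp: lowdeg_iff)

lemma N_le_top:
  assumes i: "i < mdeg" and p: "p \<in> lowdeg (Suc i)" and c: "coeff p i \<noteq> 0"
  shows "N p \<le> e * v (coeff p i) + N (best i)"
proof -
  have deg: "degree p = i"
    using p c le_degree[OF c] by (auto simp: lowdeg_iff)
  have na: "\<not> ann p" using low_not_ann[of p] p i c by (force simp: lowdeg_iff)
  let ?c = "inverse (coeff p i)"
  have "N (smult ?c p) \<le> N (best i)"
    using best[OF i] c deg unfolding is_best_def by auto
  then show ?thesis using N_smult[OF na, of ?c] c by (simp add: v_inverse algebra_simps)
qed

lemma N_le_rest:
  assumes i: "i < mdeg" and p: "p \<in> lowdeg (Suc i)" "p \<noteq> 0"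
    and h: "h = p - smult (coeff p i) (best i)" "h \<noteq> 0"
  shows "h \<in> lowdeg i \<and> N p \<le> N h"
proof
  show low: "h \<in> lowdeg i"
    unfolding lowdeg_def
  proof (intro CollectI allI impI)
    fix j assume "i \<le> j"
    then show "coeff h j = 0"
      using p i by (cases "j = i") (auto simp: h(1) best_coeff best_degree lowdeg_def coeff_eq_0)
  qed
  have na: "\<not> ann h" using low_not_ann[of h] low h i by (auto simp: lowdeg_iff)
  show "N p \<le> N h"
  proof (cases "coeff p i = 0")
    case False
    show ?thesis
      unfolding h(1)
    proof (rule N_diff)
      show "N p \<le> N (smult (coeff p i) (best i))"
        using N_le_top[OF i p(1) False] N_smult[OF best_not_ann[OF i] False] by simp
    qed (use na h in auto)
  qed (simp add: h)
qed

text \<open>The best polynomials form a splitting basis over F. Maximality among monic polynomials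
  bounds the top term from below by \<open>N p\<close>, so removing that term does not lower the
  valuation of the remainder.\<close>

lemma best_expansion:
  assumes "d \<le> mdeg" "p \<in> lowdeg d" "p \<noteq> 0"
  shows "\<exists>c. p = (\<Sum>i<d. smult (c i) (best i)) \<and>
    (\<forall>i<d. c i \<noteq> 0 \<longrightarrow> N p \<le> e * v (c i) + N (best i))"
  using assms
proof (induction d arbitrary: p)
  case 0
  then show ?case by (auto simp: lowdeg_iff)
next
  case (Suc d)
  define h where "h = p - smult (coeff p d) (best d)"
  have d: "d < mdeg" using Suc.prems by simp
  have top: "coeff p d \<noteq> 0 \<Longrightarrow> N p \<le> e * v (coeff p d) + N (best d)"
    using N_le_top[OF d Suc.prems(2)] .
  show ?case
  proof (cases "h = 0")
    case True
    then have "p = (\<Sum>i<Suc d. smult (if i = d then coeff p d else 0) (best i))"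
      by (simp add: h_def)
    then show ?thesis using top by (intro exI[of _ "\<lambda>i. if i = d then coeff p d else 0"]) auto
  next
    case False
    then have h: "h \<in> lowdeg d" "N p \<le> N h" using N_le_rest[OF d Suc.prems(2,3) h_def] by auto
    obtain c where c: "h = (\<Sum>i<d. smult (c i) (best i))"
      "\<And>i. i < d \<Longrightarrow> c i \<noteq> 0 \<Longrightarrow> N h \<le> e * v (c i) + N (best i)"
      using Suc.IH[OF _ h(1) False] Suc.prems(1) by auto
    have "p = (\<Sum>i<Suc d. smult ((c(d := coeff p d)) i) (best i))"
      using c(1) by (simp add: h_def algebra_simps)
    moreover have "N p \<le> e * v ((c(d := coeff p d)) i) + N (best i)"
      if "i < Suc d" "(c(d := coeff p d)) i \<noteq> 0" for i
    proof (cases "i = d")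
      case True
      then show ?thesis using that top by simp
    next
      case False
      then show ?thesis using that c(2)[of i] h(2) by simp
    qed
    ultimately show ?thesis by blast
  qed
qed

end

section \<open>Elements almost commuting with a simple one\<close>

text \<open>\<open>degree_minimal\<close> is the minimality in a simple stratum, phrased by
  annihilating polynomials so that a competing operator can be presented by the equation it
  satisfies.\<close>

locale near_commuting = pure_action +
  fixes x :: "'b \<Rightarrow> 'b" and r :: int
  assumes endo_x: "endo sc W x"
    and x_M: "w \<in> M t \<Longrightarrow> x w \<in> M t"
    and comm: "w \<in> M t \<Longrightarrow> g (x w) - x (g w) \<in> M (t - r)"
    and degree_minimal: "pure_action sc v e W M a \<Longrightarrow> \<phi> \<noteq> 0 \<Longrightarrow> degree \<phi> < mdeg \<Longrightarrow>
      \<forall>w\<in>W. poly_act sc a \<phi> w = 0 \<Longrightarrow> \<exists>t. \<exists>w\<in>M t. g w - a w \<notin> M (t - r)"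
begin

lemma x_closed: "w \<in> W \<Longrightarrow> x w \<in> W"
  and x_add: "w \<in> W \<Longrightarrow> w' \<in> W \<Longrightarrow> x (w + w') = x w + x w'"
  and x_scale: "w \<in> W \<Longrightarrow> x (sc c w) = sc c (x w)"
  using endo_x unfolding endo_def by blast+

lemma x_0: "x 0 = 0"
  using x_add[of 0 0] W_0 by simp

lemma x_diff: "w \<in> W \<Longrightarrow> w' \<in> W \<Longrightarrow> x (w - w') = x w - x w'"
  using x_add[of "w - w'" w'] W_diff by simp

lemma x_sum: "(\<And>i. i \<in> A \<Longrightarrow> f i \<in> W) \<Longrightarrow> x (sum f A) = (\<Sum>i\<in>A. x (f i))"
  by (induction A rule: infinite_finite_induct) (auto simp: x_0 x_add W_sum)

definition C :: "'a poly \<Rightarrow> 'b \<Rightarrow> 'b" where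
  "C p w = P p (x w) - x (P p w)"

text \<open>\<open>x\<close> commutes with the leading term of p(g), that is, with its class in the
  associated graded ring.\<close>

definition good :: "'a poly \<Rightarrow> bool" where
  "good p \<longleftrightarrow> (\<forall>t. \<forall>w\<in>M t. C p w \<in> M (t + N p + 1))"

lemma C_closed: "w \<in> W \<Longrightarrow> C p w \<in> W"
  by (simp add: C_def W_diff P_closed x_closed)

lemma C_diff: "w \<in> W \<Longrightarrow> C (p - q) w = C p w - C q w"
  by (simp add: C_def P_diff_left x_diff P_closed)

lemma C_smult: "w \<in> W \<Longrightarrow> C (smult c p) w = sc c (C p w)"
  by (simp add: C_def P_smult x_scale P_closed scale_right_diff_distrib)

lemma C_mult: "w \<in> W \<Longrightarrow> C (p * q) w = P p (C q w) + C p (P q w)"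
  by (simp add: C_def P_mult P_diff P_closed x_closed)

lemma good_mult:
  assumes "\<not> ann p" "\<not> ann q" "good p" "good q" shows "good (p * q)"
  unfolding good_def
proof (intro allI ballI)
  fix t w assume w: "w \<in> M t"
  have "P p (C q w) \<in> M (t + N q + 1 + N p)"
    using act_M[OF assms(1)] assms(4) w unfolding good_def by blast
  moreover have "C p (P q w) \<in> M (t + N q + N p + 1)"
    using act_M[OF assms(2) w] assms(3) unfolding good_def by blast
  ultimately show "C (p * q) w \<in> M (t + N (p * q) + 1)"
    using M_sub[OF w] by (simp add: C_mult N_mult[OF assms(1,2)] M_add algebra_simps)
qed

text \<open>The Leibniz rule \<open>C_mult\<close> isolates \<open>P p (C q w)\<close>, and
  \<open>P p\<close> can be divided out because it shifts the filtration exactly.\<close>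

lemma good_cancel:
  assumes "\<not> ann p" "\<not> ann q" "good p" "good (p * q)" shows "good q"
  unfolding good_def
proof (intro allI ballI)
  fix t w assume w: "w \<in> M t"
  have wW: "w \<in> W" using w M_sub by blast
  have "t + N (p * q) + 1 = t + N q + N p + 1" using N_mult[OF assms(1,2)] by simp
  then have "C (p * q) w \<in> M (t + N q + N p + 1)"
    using assms(4) w unfolding good_def by metis
  moreover have "C p (P q w) \<in> M (t + N q + N p + 1)"
    using act_M[OF assms(2) w] assms(3) unfolding good_def by blast
  ultimately have "C (p * q) w - C p (P q w) \<in> M (t + N q + N p + 1)" by (rule M_diff)
  then have "P p (C q w) \<in> M (t + N q + 1 + N p)"
    using wW by (simp add: C_mult algebra_simps)
  then show "C q w \<in> M (t + N q + 1)"
    using act_val[OF assms(1) C_closed[OF wW]] by blast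
qed

end

section \<open>The residue ring modulo a hypothetical first failure\<close>

locale critical = near_commuting +
  fixes d :: nat and \<phi> :: "'a poly"
  assumes d: "0 < d" "d < mdeg"
    and low_good: "p \<in> lowdeg d \<Longrightarrow> p \<noteq> 0 \<Longrightarrow> good p"
    and phi: "is_best d \<phi>" and not_good: "\<not> good \<phi>"
begin

lemma phi_lead: "coeff \<phi> d = 1" and phi_degree: "degree \<phi> = d"
  using phi unfolding is_best_def by auto

lemma phi_nz: "\<phi> \<noteq> 0"
  using phi_degree d by auto

lemma phi_not_ann: "\<not> ann \<phi>"
  using low_not_ann[of \<phi>] phi_nz phi_degree d by (auto simp: lowdeg_iff)

lemma low_na: "p \<in> lowdeg d \<Longrightarrow> p \<noteq> 0 \<Longrightarrow> \<not> ann p"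
  using low_not_ann[of p] d by (auto simp: lowdeg_iff)

lemma mod_low: "p mod \<phi> \<in> lowdeg d"
  using degree_mod_less[OF phi_nz, of p] phi_degree by (auto simp: lowdeg_iff)

lemma low_mod: "p \<in> lowdeg d \<Longrightarrow> p mod \<phi> = p"
  using mod_poly_less[of p \<phi>] phi_degree by (auto simp: lowdeg_iff)

text \<open>Write f k = a \<phi> + h. If a \<phi> had valuation at most that of f k, then h would
  not have smaller valuation than a \<phi> either, and a \<phi> = f k - h would be good because f k
  and h are; cancelling the good factor a would make \<phi> good. So a \<phi> is negligible against
  f k, and h carries the whole leading term.\<close>

lemma mult_mod:
  assumes f: "f \<in> lowdeg d" "f \<noteq> 0" and k: "k \<in> lowdeg d" "k \<noteq> 0"
  shows "(f * k) mod \<phi> \<noteq> 0" "N ((f * k) mod \<phi>) = N f + N k"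
    "w \<in> M t \<Longrightarrow> P f (P k w) - P ((f * k) mod \<phi>) w \<in> M (t + N f + N k + 1)"
proof -
  define a where "a = (f * k) div \<phi>"
  define h where "h = (f * k) mod \<phi>"
  have eq: "f * k = a * \<phi> + h" by (simp add: a_def h_def)
  have h_low: "h \<in> lowdeg d" unfolding h_def by (rule mod_low)
  have fk: "\<not> ann (f * k)" "N (f * k) = N f + N k" "good (f * k)"
    using not_ann_mult N_mult good_mult low_na low_good f k by auto
  have "h \<noteq> 0 \<and> N h = N f + N k \<and> (\<forall>t. \<forall>w\<in>M t. P (f * k) w - P h w \<in> M (t + N f + N k + 1))"
  proof (cases "a = 0")
    case True
    then show ?thesis using eq fk f k by (auto simp: M_0)
  next
    case False
    \<comment> \<open>The product has degree at most 2 d - 2 and \<phi> has degree d, so the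
      quotient \<open>a\<close> falls within the range where goodness is known.\<close>
    have "degree (a * \<phi>) < 2 * d - 1"
    proof -
      have "degree (f * k) < 2 * d - 1" "degree h < 2 * d - 1"
        using f k h_low d by (auto simp: degree_mult_eq lowdeg_iff)
      moreover have "a * \<phi> = f * k - h" using eq by simp
      ultimately show ?thesis using degree_diff_less by metis
    qed
    then have a: "a \<in> lowdeg d"
      using False phi_nz phi_degree by (auto simp: degree_mult_eq lowdeg_iff)
    have a_na: "\<not> ann a" using low_na a False by blast
    have aphi: "\<not> ann (a * \<phi>)" using not_ann_mult a_na phi_not_ann by blast
    have less: "N (f * k) < N (a * \<phi>)"
    proof (rule ccontr)
      assume "\<not> N (f * k) < N (a * \<phi>)"
      then have le: "N (a * \<phi>) \<le> N (f * k)" by simp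
      have h_eq: "h = f * k - a * \<phi>" using eq by simp
      have "good (a * \<phi>)"
        unfolding good_def
      proof (intro allI ballI)
        fix t w assume w: "w \<in> M t"
        have 1: "C (f * k) w \<in> M (t + N (a * \<phi>) + 1)"
          using fk(3) w le M_antimono[of "t + N (a * \<phi>) + 1" "t + N (f * k) + 1"]
          unfolding good_def by auto
        have 2: "C h w \<in> M (t + N (a * \<phi>) + 1)"
        proof (cases "h = 0")
          case True
          then show ?thesis using C_smult[OF M_sub[OF w], of 0 h] M_0 by simp
        next
          case False
          then have "N (a * \<phi>) \<le> N h"
            unfolding h_eq using low_na[OF h_low] le by (intro N_diff) (auto simp: h_eq)
          then show ?thesis
            using low_good[OF h_low False] w M_antimono[of "t + N (a * \<phi>) + 1" "t + N h + 1"]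
            unfolding good_def by auto
        qed
        have "a * \<phi> = f * k - h" using eq by simp
        then show "C (a * \<phi>) w \<in> M (t + N (a * \<phi>) + 1)"
          using C_diff[OF M_sub[OF w], of "f * k" h] M_diff[OF 1 2] by simp
      qed
      then show False
        using good_cancel[OF a_na phi_not_ann low_good[OF a False]] not_good by blast
    qed
    have h_nz: "h \<noteq> 0" using less eq by auto
    have h_na: "\<not> ann h" using low_na h_low h_nz by blast
    have "N (f * k) \<le> N (f * k - a * \<phi>)"
      using less h_na eq by (intro N_diff) auto
    moreover have "N h \<le> N (f * k)"
    proof (rule ccontr)
      assume "\<not> ?thesis"
      then have "N (f * k) + 1 \<le> N (a * \<phi> + h)"
        using less fk(1) eq by (intro N_add) auto
      then show False using eq by simp
    qed
    ultimately have "N h = N f + N k" using eq fk by simp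
    moreover have "P (f * k) w - P h w \<in> M (t + N f + N k + 1)" if w: "w \<in> M t" for w t
    proof -
      have "P (f * k) w - P h w = P (a * \<phi>) w" unfolding eq by (simp add: P_add_left)
      then show ?thesis
        using act_M[OF aphi w] less fk M_antimono[of "t + N f + N k + 1" "t + N (a * \<phi>)"] by simp
    qed
    ultimately show ?thesis using h_nz by blast
  qed
  then show "(f * k) mod \<phi> \<noteq> 0" "N ((f * k) mod \<phi>) = N f + N k"
    "w \<in> M t \<Longrightarrow> P f (P k w) - P ((f * k) mod \<phi>) w \<in> M (t + N f + N k + 1)"
    unfolding h_def using P_mult[OF M_sub] by auto
qed

text \<open>Take a nonzero multiple h of f modulo \<phi> of least degree. The remainder of \<phi> by
  h is again such a multiple, hence zero. If h were not constant, \<phi> would be a product of two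
  factors of degree below d, whereas \<open>mult_mod\<close> says such a product is nonzero modulo
  \<phi>.\<close>

lemma inverse_mod:
  assumes f: "f \<in> lowdeg d" "f \<noteq> 0"
  shows "\<exists>q\<in>lowdeg d. q \<noteq> 0 \<and> (q * f) mod \<phi> = 1"
proof -
  obtain k where k: "(k * f) mod \<phi> \<noteq> 0"
    and least: "\<And>k'. (k' * f) mod \<phi> \<noteq> 0 \<Longrightarrow> degree ((k * f) mod \<phi>) \<le> degree ((k' * f) mod \<phi>)"
    using ex_has_least_nat[of "\<lambda>k. (k * f) mod \<phi> \<noteq> 0" 1 "\<lambda>k. degree ((k * f) mod \<phi>)"] f low_mod by auto
  define h where "h = (k * f) mod \<phi>"
  have h: "h \<in> lowdeg d" "h \<noteq> 0" using mod_low k by (auto simp: h_def)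
  have "degree h = 0"
  proof (rule ccontr)
    assume deg: "degree h \<noteq> 0"
    let ?s = "\<phi> mod h" and ?c = "\<phi> div h"
    have eq: "\<phi> = ?c * h + ?s" by simp
    have s: "?s = 0 \<or> degree ?s < degree h" using degree_mod_less[OF h(2)] by blast
    have "?s \<in> lowdeg d" using s h by (auto simp: lowdeg_iff)
    then have "?s = ?s mod \<phi>" by (simp add: low_mod)
    also have "\<dots> = (\<phi> - ?c * h) mod \<phi>" using eq by (metis add_diff_cancel_left')
    also have "\<dots> = ((- ?c) * h) mod \<phi>" by (simp add: poly_mod_diff_left)
    also have "\<dots> = ((- ?c) * k * f) mod \<phi>"
      unfolding h_def by (metis mod_mult_right_eq mult.assoc)
    finally have s_eq: "?s = ((- ?c) * k * f) mod \<phi>" .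
    have "?s = 0"
    proof (rule ccontr)
      assume "?s \<noteq> 0"
      then have "degree h \<le> degree ?s" using least[of "(- ?c) * k"] s_eq by (simp add: h_def)
      then show False using s \<open>?s \<noteq> 0\<close> by simp
    qed
    then have c: "?c * h = \<phi>" using eq by simp
    then have "?c \<noteq> 0" using phi_nz by auto
    then have "degree ?c + degree h = d" using degree_mult_eq[of ?c h] h c phi_degree by simp
    then have "?c \<in> lowdeg d" using deg by (auto simp: lowdeg_iff)
    then have "(?c * h) mod \<phi> \<noteq> 0" using mult_mod(1)[OF _ \<open>?c \<noteq> 0\<close> h] by simp
    then show False using c by simp
  qed
  then obtain c where c: "h = [:c:]" "c \<noteq> 0" using h by (metis degree_eq_zeroE pCons_0_0)
  let ?q = "smult (inverse c) k mod \<phi>"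
  have "(?q * f) mod \<phi> = (smult (inverse c) k * f) mod \<phi>" by (simp add: mod_mult_left_eq)
  also have "\<dots> = smult (inverse c) h" by (simp add: h_def mod_smult_left)
  also have "\<dots> = 1" using c by (simp add: one_pCons)
  finally have q: "(?q * f) mod \<phi> = 1" .
  then have "?q \<noteq> 0" by (metis mult_zero_left mod_0 zero_neq_one)
  then show ?thesis using q mod_low by blast
qed

sublocale low: almost_action sc v e W M d P N
proof
  fix p q :: "'a poly" assume p: "p \<in> lowdeg d" "p \<noteq> 0"
  {
    assume q: "q \<in> lowdeg d" "q \<noteq> 0"
    show "\<exists>h\<in>lowdeg d. \<forall>t. \<forall>w\<in>M t. P p (P q w) - P h w \<in> M (t + N p + N q + 1)"
      using mult_mod(3)[OF p q] mod_low by blast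
  }
  obtain q where q: "q \<in> lowdeg d" "q \<noteq> 0" "(q * p) mod \<phi> = 1" using inverse_mod[OF p] by blast
  have "N q = - N p" using mult_mod(2)[OF q(1,2) p] q(3) N_1 by simp
  moreover have "P q (P p w) - w \<in> M (t + 1)" if "w \<in> M t" for t w
    using mult_mod(3)[OF q(1,2) p that] q(3) \<open>N q = - N p\<close> P_1[OF M_sub[OF that]] by simp
  ultimately show "\<exists>q\<in>lowdeg d. q \<noteq> 0 \<and> N q = - N p \<and> (\<forall>t. \<forall>w\<in>M t. P q (P p w) - w \<in> M (t + 1))"
    using q by blast
qed (use d P_closed P_add_left P_smult P_add P_1 act_val low_na in auto)

lemma pCons_mod:
  assumes "p \<in> lowdeg d"
  shows "pCons 0 p mod \<phi> = pCons 0 p - smult (coeff p (d - 1)) \<phi>"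
proof -
  let ?h = "pCons 0 p - smult (coeff p (d - 1)) \<phi>"
  have "?h \<in> lowdeg d"
    unfolding lowdeg_def
  proof (intro CollectI allI impI)
    fix j assume j: "d \<le> j"
    then obtain i where i: "j = Suc i" using d by (cases j) auto
    show "coeff ?h j = 0"
      using assms j phi_lead phi_degree i
      by (cases "j = d") (auto simp: lowdeg_def coeff_eq_0)
  qed
  then have "?h = ?h mod \<phi>" by (simp add: low_mod)
  also have "\<dots> = pCons 0 p mod \<phi>" by (simp add: poly_mod_diff_left mod_smult_left)
  finally show ?thesis by simp
qed

end

section \<open>A generator of F[X]/\<phi> as an approximation of g, and the commutator of
  \<phi>(g)\<close>

context critical
begin

text \<open>The split basis over the polynomials of degree less than \<open>d\<close> carries an action of the field
  \<open>F[X]/\<phi>\<close>, whose generator agrees with \<open>g\<close> except where the degree overflows.\<close>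

lemma N_phi_less: "N \<phi> - N (best (d - 1)) < - r"
proof (rule ccontr)
  assume n: "\<not> ?thesis"
  obtain m b where s: "low.split m b" and span: "low.combs m b = W"
    using low.exists_split_basis by blast
  define co where "co w = (SOME ps. (\<forall>j. ps j \<in> lowdeg d) \<and> w = low.comb m b ps)" for w
  have co: "\<forall>j. co w j \<in> lowdeg d" "low.comb m b (co w) = w" if "w \<in> W" for w
  proof -
    have "\<exists>ps. (\<forall>j. ps j \<in> lowdeg d) \<and> w = low.comb m b ps"
      using that span unfolding low.combs_def by blast
    then have "(\<forall>j. co w j \<in> lowdeg d) \<and> w = low.comb m b (co w)" unfolding co_def by (rule someI_ex)
    then show "\<forall>j. co w j \<in> lowdeg d" "low.comb m b (co w) = w" by auto
  qed
  define a where "a w = (if w \<in> W then low.comb m b (\<lambda>j. pCons 0 (co w j) mod \<phi>) else 0)" for w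
  have comb_W: "low.comb m b ps \<in> W" for ps by (rule low.comb_closed[OF s])
  have low_modl: "\<forall>j. (f j) mod \<phi> \<in> lowdeg d" for f :: "nat \<Rightarrow> 'a poly" using mod_low by blast
  have a_comb: "a (low.comb m b ps) = low.comb m b (\<lambda>j. pCons 0 (ps j) mod \<phi>)"
    if ps: "\<forall>j. ps j \<in> lowdeg d" for ps
  proof -
    have "co (low.comb m b ps) j = ps j" if "j < m" for j
      using low.comb_inj[OF s _ ps _ that] co comb_W by blast
    then show ?thesis using comb_W by (simp add: a_def low.comb_def)
  qed
  have endo_a: "endo sc W a"
    unfolding endo_def
  proof (intro conjI ballI allI impI)
    fix w w' c
    assume w: "w \<in> W"
    show "a w \<in> W" unfolding a_def using comb_W w by simp
    have "sc c w = low.comb m b (\<lambda>j. smult c (co w j))"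
      using co[OF w] by (simp add: low.comb_smult[OF s])
    then have "a (sc c w) = low.comb m b (\<lambda>j. pCons 0 (smult c (co w j)) mod \<phi>)"
      using a_comb[of "\<lambda>j. smult c (co w j)"] co[OF w] lowdeg_smult by metis
    also have "(\<lambda>j. pCons 0 (smult c (co w j)) mod \<phi>) = (\<lambda>j. smult c (pCons 0 (co w j) mod \<phi>))"
      by (simp flip: mod_smult_left)
    finally show "a (sc c w) = sc c (a w)" using w by (simp add: low.comb_smult[OF s] a_def)
    assume w': "w' \<in> W"
    have "w + w' = low.comb m b (\<lambda>j. co w j + co w' j)"
      using co[OF w] co[OF w'] by (simp add: low.comb_add[OF s])
    then have "a (w + w') = low.comb m b (\<lambda>j. pCons 0 (co w j + co w' j) mod \<phi>)"
      using a_comb[of "\<lambda>j. co w j + co w' j"] co[OF w] co[OF w'] lowdeg_add by metis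
    also have "(\<lambda>j. pCons 0 (co w j + co w' j) mod \<phi>) = (\<lambda>j. pCons 0 (co w j) mod \<phi> + pCons 0 (co w' j) mod \<phi>)"
      by (simp flip: poly_mod_add_left)
    finally show "a (w + w') = a w + a w'" using w w' by (simp add: low.comb_add[OF s] a_def)
  qed (simp add: a_def)
  interpret a: endo_action sc W a
    by (intro endo_action.intro vector_space_axioms endo_action_axioms.intro subspace_W endo_a)
  have Pa: "a.P f (low.comb m b ps) = low.comb m b (\<lambda>j. (f * ps j) mod \<phi>)"
    if ps: "\<forall>j. ps j \<in> lowdeg d" for f ps
  proof (induction f)
    case 0
    then show ?case by (simp add: low.comb_zero[OF s])
  next
    case (pCons c f)
    have "a.P (pCons c f) (low.comb m b ps) =
        sc c (low.comb m b ps) + a (low.comb m b (\<lambda>j. (f * ps j) mod \<phi>))"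
      by (simp add: a.P_pCons comb_W pCons.IH)
    also have "\<dots> = low.comb m b (\<lambda>j. smult c (ps j) + pCons 0 ((f * ps j) mod \<phi>) mod \<phi>)"
      by (simp add: a_comb[OF low_modl] low.comb_smult[OF s] low.comb_add[OF s])
    also have "(\<lambda>j. smult c (ps j) + pCons 0 ((f * ps j) mod \<phi>) mod \<phi>) = (\<lambda>j. (pCons c f * ps j) mod \<phi>)"
    proof
      fix j
      have "pCons 0 ((f * ps j) mod \<phi>) mod \<phi> = ([:0, 1:] * ((f * ps j) mod \<phi>)) mod \<phi>" by simp
      also have "\<dots> = ([:0, 1:] * (f * ps j)) mod \<phi>" by (rule mod_mult_right_eq)
      finally have "pCons 0 ((f * ps j) mod \<phi>) mod \<phi> = pCons 0 (f * ps j) mod \<phi>" by simp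
      moreover have "smult c (ps j) = smult c (ps j) mod \<phi>"
        using low_mod ps lowdeg_smult by metis
      ultimately show "smult c (ps j) + pCons 0 ((f * ps j) mod \<phi>) mod \<phi> = (pCons c f * ps j) mod \<phi>"
        by (simp add: poly_mod_add_left)
    qed
    finally show ?case .
  qed
  have Pa': "a.P f w = low.comb m b (\<lambda>j. (f * co w j) mod \<phi>)" if "w \<in> W" for f w
    using Pa[OF co(1)[OF that], of f] co(2)[OF that] by simp
  have mod_zero: "\<forall>w\<in>W. a.P f w = 0" if "f mod \<phi> = 0" for f
  proof
    fix w assume "w \<in> W"
    have "(f * co w j) mod \<phi> = 0" for j using that by (simp add: mod_eq_0_iff_dvd)
    then show "a.P f w = 0" using Pa'[OF \<open>w \<in> W\<close>] by (simp add: low.comb_zero[OF s])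
  qed
  have "pure_action sc v e W M a"
  proof
    show "\<exists>w\<in>W. w \<noteq> 0" by (rule nontrivial)
    show "(\<forall>w\<in>W. a.P f w = 0) \<or> (\<exists>k. \<forall>w\<in>W. \<forall>t. a.P f w \<in> M (t + k) \<longleftrightarrow> w \<in> M t)" for f
    proof (cases "f mod \<phi> = 0")
      case False
      let ?f = "f mod \<phi>"
      have "a.P f w \<in> M (t + N ?f) \<longleftrightarrow> w \<in> M t" if w: "w \<in> W" for w t
      proof -
        have "P ((f * co w j) mod \<phi>) (b j) \<in> M (t + N ?f) \<longleftrightarrow> P (co w j) (b j) \<in> M t" if j: "j < m" for j
        proof (cases "co w j = 0")
          case True
          then show ?thesis by (simp add: M_0)
        next
          case nz: False
          have bW: "b j \<in> W" using low.split_V[OF s j] .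
          have c: "co w j \<in> lowdeg d" using co(1)[OF w] by blast
          have eq: "(f * co w j) mod \<phi> = (?f * co w j) mod \<phi>" by (simp add: mod_mult_left_eq)
          have "(f * co w j) mod \<phi> \<noteq> 0" "N ((f * co w j) mod \<phi>) = N ?f + N (co w j)"
            unfolding eq using mult_mod(1,2)[OF mod_low False c nz] by auto
          then show ?thesis
            using low.rho_in_M_iff[OF mod_low bW, of "f * co w j" "t + N ?f"]
              low.rho_in_M_iff[OF c bW, of t] nz by (simp add: algebra_simps)
        qed
        then show ?thesis
          using low.split_comb_iff[OF s low_modl, of "\<lambda>j. f * co w j" "t + N ?f"]
            low.split_comb_iff[OF s co(1)[OF w], of t] Pa'[OF w] co(2)[OF w] by simp
      qed
      then show ?thesis by blast
    qed (intro disjI1 mod_zero)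
    show "(\<forall>w\<in>W. a.P f w = 0) \<or> (\<exists>q. \<forall>w\<in>W. a.P q (a.P f w) = w)" for f
    proof (cases "f mod \<phi> = 0")
      case False
      then obtain q where q: "(q * (f mod \<phi>)) mod \<phi> = 1" using inverse_mod[OF mod_low False] by blast
      have "a.P q (a.P f w) = w" if w: "w \<in> W" for w
      proof -
        have "((q * f) * co w j) mod \<phi> = co w j" for j
        proof -
          have "((q * f) * co w j) mod \<phi> = (((q * f) mod \<phi>) * co w j) mod \<phi>"
            by (rule mod_mult_left_eq[symmetric])
          also have "(q * f) mod \<phi> = 1" using q by (simp add: mod_mult_right_eq)
          finally show ?thesis using low_mod co(1)[OF w] by simp
        qed
        then have "a.P (q * f) w = w" using Pa'[OF w, of "q * f"] co(2)[OF w] by simp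
        then show ?thesis by (simp add: a.P_mult w)
      qed
      then show ?thesis by blast
    qed (intro disjI1 mod_zero)
  qed
  moreover have "\<forall>w\<in>W. poly_act sc a \<phi> w = 0" using mod_zero by simp
  \<comment> \<open>Only the overflow, a top coefficient times \<phi>, survives. By
    \<open>N_le_top\<close> that coefficient contributes at least
    \<open>N (co w j) - N (best (d - 1))\<close>, so g - a has valuation at least
    \<open>N \<phi> - N (best (d - 1))\<close>.\<close>
  moreover have "g w - a w \<in> M (t - r)" if w: "w \<in> M t" for w t
  proof -
    have wW: "w \<in> W" using w M_sub by blast
    let ?c = "\<lambda>j. coeff (co w j) (d - 1)"
    have bW: "b j \<in> W" if "j < m" for j using low.split_V[OF s that] .
    have "g w = g (low.comb m b (co w))" using co(2)[OF wW] by simp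
    also have "\<dots> = (\<Sum>j<m. P (pCons 0 (co w j)) (b j))"
      unfolding low.comb_def by (subst g_sum) (auto simp: P_closed bW P_pCons)
    finally have "g w - a w = (\<Sum>j<m. P (pCons 0 (co w j)) (b j) - P (pCons 0 (co w j) mod \<phi>) (b j))"
      using wW by (simp add: a_def low.comb_def sum_subtractf)
    also have "\<dots> = (\<Sum>j<m. P (smult (?c j) \<phi>) (b j))"
      using co(1)[OF wW] by (intro sum.cong) (simp_all add: pCons_mod flip: P_diff_left)
    also have "\<dots> \<in> M (t - r)"
    proof (rule M_sum)
      fix j assume "j \<in> {..<m}"
      then have j: "j < m" by simp
      show "P (smult (?c j) \<phi>) (b j) \<in> M (t - r)"
      proof (cases "?c j = 0")
        case False
        then have nz: "co w j \<noteq> 0" by auto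
        have low: "co w j \<in> lowdeg d" using co(1)[OF wW] by blast
        have "P (co w j) (b j) \<in> M t"
          using low.split_comb_iff[OF s co(1)[OF wW], of t] co(2)[OF wW] w j by simp
        then have bM: "b j \<in> M (t - N (co w j))"
          using low.rho_in_M_iff[OF low bW[OF j]] nz by simp
        have "co w j \<in> lowdeg (Suc (d - 1))" using low d by simp
        then have "N (co w j) \<le> e * v (?c j) + N (best (d - 1))"
          using N_le_top[of "d - 1"] False d by simp
        moreover have "P (smult (?c j) \<phi>) (b j) \<in> M (t - N (co w j) + N (smult (?c j) \<phi>))"
          using act_M[OF not_ann_smult[OF phi_not_ann False] bM] .
        moreover have "N (smult (?c j) \<phi>) = e * v (?c j) + N \<phi>" using N_smult[OF phi_not_ann False] .
        ultimately show ?thesis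
          using M_antimono[of "t - r" "t - N (co w j) + N (smult (?c j) \<phi>)"] n by simp
      qed (simp add: M_0)
    qed
    finally show ?thesis .
  qed
  ultimately show False using degree_minimal[of a \<phi>] phi_nz phi_degree d by blast
qed

text \<open>The functional whose bilinear form T(f k) makes F[X]/\<phi> a Frobenius algebra; unlike
  the trace form it is nondegenerate for every monic \<phi>.\<close>

definition T :: "'a poly \<Rightarrow> 'a" where
  "T f = coeff (f mod \<phi>) (d - 1)"

lemma T_add: "T (f + k) = T f + T k"
  by (simp add: T_def poly_mod_add_left)

lemma T_diff: "T (f - k) = T f - T k"
  by (simp add: T_def poly_mod_diff_left)

lemma T_smult: "T (smult c f) = c * T f"
  by (simp add: T_def mod_smult_left)

lemma T_sum: "T (sum f A) = (\<Sum>i\<in>A. T (f i))"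
  by (induction A rule: infinite_finite_induct) (auto simp: T_add, simp_all add: T_def)

lemma T_low: "f \<in> lowdeg d \<Longrightarrow> T f = coeff f (d - 1)"
  by (simp add: T_def low_mod)

text \<open>No reduction modulo \<phi> takes place below degree d. Pairing polynomials by degree
  thus gives an antitriangular matrix with leading coefficients at degree sum d - 1, the source of
  nondegeneracy.\<close>

lemma T_monic_mult:
  assumes "degree f + i \<le> d - 1" "i < d"
  shows "T (f * best i) = (if degree f + i = d - 1 then lead_coeff f else 0)"
proof (cases "f = 0")
  case False
  have i: "i < mdeg" using assms d by simp
  have deg: "degree (f * best i) = degree f + i"
    using False best_nz[OF i] best_degree[OF i] by (simp add: degree_mult_eq)
  then have "f * best i \<in> lowdeg d" using assms d by (auto simp: lowdeg_iff)
  then have "T (f * best i) = coeff (f * best i) (d - 1)" by (rule T_low)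
  moreover have "lead_coeff (f * best i) = lead_coeff f"
    using best_coeff[OF i] best_degree[OF i] by (simp add: lead_coeff_mult)
  ultimately show ?thesis using deg assms by (auto simp: coeff_eq_0)
qed (simp add: T_def)

text \<open>The power of X with exponent d - 1 - m pairs to 1 with \<open>best m\<close> and to 0
  with the earlier ones, so the m-th value is corrected without disturbing the others.\<close>

lemma exists_dual: "m \<le> d \<Longrightarrow> \<exists>f\<in>lowdeg d. \<forall>i<m. T (f * best i) = l i"
proof (induction m)
  case 0
  then show ?case using lowdeg_0 by blast
next
  case (Suc m)
  then obtain f where f: "f \<in> lowdeg d" "\<And>i. i < m \<Longrightarrow> T (f * best i) = l i" by auto
  let ?x = "monom 1 (d - 1 - m) :: 'a poly"
  let ?c = "l m - T (f * best m)"
  have x: "degree ?x = d - 1 - m" by (simp add: degree_monom_eq)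
  have "smult ?c ?x \<in> lowdeg d" using x d by (intro lowdeg_smult) (auto simp: lowdeg_iff)
  then have "f + smult ?c ?x \<in> lowdeg d" using f lowdeg_add by blast
  moreover have "T ((f + smult ?c ?x) * best i) = l i" if "i < Suc m" for i
  proof -
    have "T (?x * best i) = (if i = m then 1 else 0)"
      using T_monic_mult[of ?x i] x that Suc.prems by (auto simp: degree_monom_eq)
    then show ?thesis
      using f(2)[of i] that by (auto simp: distrib_right T_add T_smult less_Suc_eq)
  qed
  ultimately show ?case by blast
qed

definition dual :: "nat \<Rightarrow> 'a poly" where
  "dual k = (SOME f. f \<in> lowdeg d \<and> (\<forall>i<d. T (f * best i) = (if i = k then 1 else 0)))"

lemma dual: "dual k \<in> lowdeg d" "i < d \<Longrightarrow> T (dual k * best i) = (if i = k then 1 else 0)"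
proof -
  have "\<exists>f. f \<in> lowdeg d \<and> (\<forall>i<d. T (f * best i) = (if i = k then 1 else 0))"
    using exists_dual[of d "\<lambda>i. if i = k then 1 else 0"] by blast
  then have "dual k \<in> lowdeg d \<and> (\<forall>i<d. T (dual k * best i) = (if i = k then 1 else 0))"
    unfolding dual_def by (rule someI_ex)
  then show "dual k \<in> lowdeg d" "i < d \<Longrightarrow> T (dual k * best i) = (if i = k then 1 else 0)" by auto
qed

lemma dual_nz: "k < d \<Longrightarrow> dual k \<noteq> 0"
  using dual(2)[of k k] by (auto simp: T_def)

lemma T_expansion:
  assumes f: "f = (\<Sum>i<d. smult (c i) (best i))" and k: "k < d"
  shows "T (dual k * f) = c k"
proof -
  have "T (dual k * f) = (\<Sum>i<d. c i * (if i = k then 1 else 0))"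
    unfolding f by (simp add: sum_distrib_left T_sum T_smult dual)
  then show ?thesis using k by (simp add: if_distrib cong: if_cong)
qed

lemma expand_best:
  assumes "f \<in> lowdeg d"
  shows "f = (\<Sum>i<d. smult (T (dual i * f)) (best i))"
proof (cases "f = 0")
  case False
  obtain c where c: "f = (\<Sum>i<d. smult (c i) (best i))"
    using best_expansion[of d f] assms False d by auto
  then have "(\<Sum>i<d. smult (T (dual i * f)) (best i)) = (\<Sum>i<d. smult (c i) (best i))"
    using T_expansion[OF c] by (intro sum.cong) auto
  then show ?thesis using c by simp
qed (simp add: T_def)

lemma N_le_coordinate:
  assumes "f \<in> lowdeg d" "f \<noteq> 0" "k < d" "T (dual k * f) \<noteq> 0"
  shows "N f \<le> e * v (T (dual k * f)) + N (best k)"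
proof -
  obtain c where c: "f = (\<Sum>i<d. smult (c i) (best i))"
    "\<And>i. i < d \<Longrightarrow> c i \<noteq> 0 \<Longrightarrow> N f \<le> e * v (c i) + N (best i)"
    using best_expansion[of d f] assms d by auto
  show ?thesis using T_expansion[OF c(1) assms(3)] c(2)[OF assms(3)] assms(4) by simp
qed

text \<open>The difference of the two sides is orthogonal to every \<open>best j\<close>; if it were
  nonzero of degree i, it would pair with \<open>best (d - 1 - i)\<close> to its leading
  coefficient.\<close>

lemma expand_dual:
  assumes f: "f \<in> lowdeg d"
  shows "f = (\<Sum>i<d. smult (T (best i * f)) (dual i))"
proof -
  define h where "h = f - (\<Sum>i<d. smult (T (best i * f)) (dual i))"
  have low: "h \<in> lowdeg d"
    unfolding h_def using f dual(1) by (intro lowdeg_diff lowdeg_sum lowdeg_smult) auto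
  have T0: "T (h * best j) = 0" if j: "j < d" for j
  proof -
    have "T (h * best j) = T (f * best j) - (\<Sum>i<d. T (best i * f) * T (dual i * best j))"
      by (simp add: h_def left_diff_distrib T_diff sum_distrib_right T_sum T_smult)
    also have "(\<Sum>i<d. T (best i * f) * T (dual i * best j)) = T (best j * f)"
      using j by (simp add: dual if_distrib cong: if_cong)
    finally show ?thesis by (simp add: mult.commute)
  qed
  have "h = 0"
  proof (rule ccontr)
    assume "h \<noteq> 0"
    then have "degree h \<le> d - 1" using low d by (auto simp: lowdeg_iff)
    then have "T (h * best (d - 1 - degree h)) = lead_coeff h"
      using T_monic_mult[of h "d - 1 - degree h"] d by auto
    then show False using T0[of "d - 1 - degree h"] d \<open>h \<noteq> 0\<close> by simp
  qed
  then show ?thesis by (simp add: h_def)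
qed

text \<open>Let f be \<open>best (d - 1)\<close> divided by \<open>dual k\<close> in F[X]/\<phi>.
  Then T(dual k f) = 1, so the k-th coordinate of f is 1 and the splitting property gives
  \<open>N f \<le> N (best k)\<close>; valuations add along the product dual k f.\<close>

lemma N_dual:
  assumes k: "k < d"
  shows "N (best (d - 1)) \<le> N (best k) + N (dual k)"
proof -
  have nz: "dual k \<noteq> 0" using dual_nz[OF k] .
  obtain q where q: "(q * dual k) mod \<phi> = 1" using inverse_mod[OF dual(1) nz] by blast
  let ?t = "best (d - 1)"
  have t: "?t \<in> lowdeg d" "coeff ?t (d - 1) = 1" "?t \<noteq> 0"
    using best_degree[of "d - 1"] best_coeff[of "d - 1"] best_nz[of "d - 1"] d by (auto simp: lowdeg_iff)
  define f where "f = (q * ?t) mod \<phi>"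
  have "(dual k * f) mod \<phi> = (dual k * (q * ?t)) mod \<phi>" unfolding f_def by (rule mod_mult_right_eq)
  also have "dual k * (q * ?t) = (q * dual k) * ?t" by (simp add: ac_simps)
  also have "\<dots> mod \<phi> = (((q * dual k) mod \<phi>) * ?t) mod \<phi>" by (rule mod_mult_left_eq[symmetric])
  finally have f: "(dual k * f) mod \<phi> = ?t" using q low_mod[OF t(1)] by simp
  have f_low: "f \<in> lowdeg d" unfolding f_def by (rule mod_low)
  have f_nz: "f \<noteq> 0" using f t(3) by auto
  have "N ?t = N (dual k) + N f" using mult_mod(2)[OF dual(1) nz f_low f_nz] f by simp
  moreover have "T (dual k * f) = 1" using f t by (simp add: T_def)
  then have "N f \<le> N (best k)" using N_le_coordinate[OF f_low f_nz k] by simp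
  ultimately show ?thesis by simp
qed

text \<open>The operator sending \<open>y\<close> to \<open>\<Sum>k<d. best k (g) y dual k (g)\<close> is, up to normalisation, the tame
  corestriction of Bushnell and Kutzko for \<open>F[X]/\<phi>\<close>.\<close>

lemma commutator_phi:
  assumes w: "w \<in> W"
  shows "C \<phi> w = (\<Sum>k<d. P (best k) (g (x (P (dual k) w)) - x (g (P (dual k) w))))"
proof -
  \<comment> \<open>\<open>B p q\<close> plays the role of p(X) q(Y). The sum over k of best k (X)
    dual k (Y) is the Bezoutian of \<phi>, the quotient of \<phi>(X) - \<phi>(Y) by X - Y; the
    identity proved is this factorization applied to \<open>x\<close>.\<close>
  define B where "B p q = P p (x (P q w))" for p q
  have B_left: "B (\<Sum>i\<in>A. smult (c i) (f i)) q = (\<Sum>i\<in>A. sc (c i) (B (f i) q))"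
    for c f q and A :: "nat set"
    by (simp add: B_def P_sum_left P_smult)
  have B_right: "B p (\<Sum>i\<in>A. smult (c i) (f i)) = (\<Sum>i\<in>A. sc (c i) (B p (f i)))"
    for c f p and A :: "nat set"
  proof -
    have "x (P (\<Sum>i\<in>A. smult (c i) (f i)) w) = (\<Sum>i\<in>A. sc (c i) (x (P (f i) w)))"
      using w by (simp add: P_sum_left P_smult x_sum x_scale P_closed W_scale)
    then show ?thesis unfolding B_def
      using w by (simp add: P_sum P_scale x_closed P_closed W_scale)
  qed
  have B_add: "B (p + p') q = B p q + B p' q" "B p (q + q') = B p q + B p q'" for p p' q q'
    using w by (simp_all add: B_def P_add_left x_add P_add x_closed P_closed)
  have B_smult: "B (smult c p) q = sc c (B p q)" "B p (smult c q) = sc c (B p q)" for c p q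
    using w by (simp_all add: B_def P_smult x_scale P_scale x_closed P_closed)
  \<comment> \<open>Multiplication by X has mutually transposed matrices in the two dual bases, so
    the double sums obtained below cancel. What remains is the overflow, with coefficient
    \<open>T f\<close> at \<phi>.\<close>
  have X: "pCons 0 f = (\<Sum>j<d. smult (T (dual j * pCons 0 f)) (best j)) + smult (T f) \<phi>"
    "pCons 0 f = (\<Sum>j<d. smult (T (best j * pCons 0 f)) (dual j)) + smult (T f) \<phi>" if f: "f \<in> lowdeg d" for f
  proof -
    have T: "T (k * (pCons 0 f mod \<phi>)) = T (k * pCons 0 f)" for k
      by (simp only: T_def mod_mult_right_eq)
    have eq: "pCons 0 f = pCons 0 f mod \<phi> + smult (T f) \<phi>"
      using pCons_mod[OF f] T_low[OF f] by simp
    have best: "pCons 0 f mod \<phi> = (\<Sum>j<d. smult (T (dual j * pCons 0 f)) (best j))"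
      using expand_best[OF mod_low, of "pCons 0 f"] by (simp only: T)
    have dual: "pCons 0 f mod \<phi> = (\<Sum>j<d. smult (T (best j * pCons 0 f)) (dual j))"
      using expand_dual[OF mod_low, of "pCons 0 f"] by (simp only: T)
    show "pCons 0 f = (\<Sum>j<d. smult (T (dual j * pCons 0 f)) (best j)) + smult (T f) \<phi>"
      by (rule trans[OF eq]) (simp only: best)
    show "pCons 0 f = (\<Sum>j<d. smult (T (best j * pCons 0 f)) (dual j)) + smult (T f) \<phi>"
      by (rule trans[OF eq]) (simp only: dual)
  qed
  have best_low: "best k \<in> lowdeg d" if "k < d" for k
    using that best_degree[of k] d by (auto simp: lowdeg_iff)
  have one: "1 \<in> lowdeg d" using d lowdeg_1 by blast
  have 1: "(\<Sum>k<d. B (pCons 0 (best k)) (dual k)) =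
      (\<Sum>k<d. \<Sum>j<d. sc (T (dual j * pCons 0 (best k))) (B (best j) (dual k))) + B \<phi> 1"
  proof -
    have "(\<Sum>k<d. B (pCons 0 (best k)) (dual k)) =
        (\<Sum>k<d. (\<Sum>j<d. sc (T (dual j * pCons 0 (best k))) (B (best j) (dual k))) + sc (T (best k)) (B \<phi> (dual k)))"
    proof (rule sum.cong)
      fix k assume "k \<in> {..<d}"
      then have k: "k < d" by simp
      show "B (pCons 0 (best k)) (dual k) = (\<Sum>j<d. sc (T (dual j * pCons 0 (best k))) (B (best j) (dual k))) + sc (T (best k)) (B \<phi> (dual k))"
        by (subst X(1)[OF best_low[OF k]]) (simp only: B_add B_left B_smult)
    qed simp
    also have "\<dots> = (\<Sum>k<d. \<Sum>j<d. sc (T (dual j * pCons 0 (best k))) (B (best j) (dual k)))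
        + (\<Sum>k<d. sc (T (best k)) (B \<phi> (dual k)))" by (rule sum.distrib)
    \<comment> \<open>The overflow terms collapse because the coordinates of 1 in the dual basis are
      the values \<open>T (best k)\<close>.\<close>
    also have "(\<Sum>k<d. sc (T (best k)) (B \<phi> (dual k))) = B \<phi> 1"
      using expand_dual[OF one] by (simp flip: B_right)
    finally show ?thesis .
  qed
  have 2: "(\<Sum>k<d. B (best k) (pCons 0 (dual k))) =
      (\<Sum>k<d. \<Sum>j<d. sc (T (best j * pCons 0 (dual k))) (B (best k) (dual j))) + B 1 \<phi>"
  proof -
    have "(\<Sum>k<d. B (best k) (pCons 0 (dual k))) =
        (\<Sum>k<d. (\<Sum>j<d. sc (T (best j * pCons 0 (dual k))) (B (best k) (dual j))) + sc (T (dual k)) (B (best k) \<phi>))"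
    proof (rule sum.cong)
      fix k assume "k \<in> {..<d}"
      show "B (best k) (pCons 0 (dual k)) = (\<Sum>j<d. sc (T (best j * pCons 0 (dual k))) (B (best k) (dual j))) + sc (T (dual k)) (B (best k) \<phi>)"
        by (subst X(2)[OF dual(1)]) (simp only: B_add B_right B_smult)
    qed simp
    also have "\<dots> = (\<Sum>k<d. \<Sum>j<d. sc (T (best j * pCons 0 (dual k))) (B (best k) (dual j)))
        + (\<Sum>k<d. sc (T (dual k)) (B (best k) \<phi>))" by (rule sum.distrib)
    also have "(\<Sum>k<d. sc (T (dual k)) (B (best k) \<phi>)) = B 1 \<phi>"
      using expand_best[OF one] by (simp flip: B_left)
    finally show ?thesis .
  qed
  have swap: "(\<Sum>k<d. \<Sum>j<d. sc (T (best j * pCons 0 (dual k))) (B (best k) (dual j))) =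
      (\<Sum>k<d. \<Sum>j<d. sc (T (dual j * pCons 0 (best k))) (B (best j) (dual k)))"
    by (subst sum.swap) (simp add: mult.commute)
  have "P (best k) (g (x (P (dual k) w)) - x (g (P (dual k) w))) =
      B (pCons 0 (best k)) (dual k) - B (best k) (pCons 0 (dual k))" for k
  proof -
    have "B (pCons 0 (best k)) (dual k) = P (best k * [:0, 1:]) (x (P (dual k) w))"
      by (simp add: B_def)
    also have "\<dots> = P (best k) (g (x (P (dual k) w)))"
      using w by (simp only: P_mult P_X x_closed P_closed)
    finally show ?thesis
      using w by (simp add: B_def P_pCons P_diff x_closed P_closed g_closed)
  qed
  then have "(\<Sum>k<d. P (best k) (g (x (P (dual k) w)) - x (g (P (dual k) w)))) = B \<phi> 1 - B 1 \<phi>"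
    using 1 2 swap by (simp add: sum_subtractf)
  also have "\<dots> = C \<phi> w" using w by (simp add: B_def C_def P_1 x_closed P_closed)
  finally show ?thesis by simp
qed

text \<open>Each term of \<open>commutator_phi\<close> has valuation at least
  \<open>N (best k) + N (dual k) - r\<close>. By \<open>N_dual\<close> this is at least
  \<open>N (best (d - 1)) - r\<close>, which exceeds \<open>N \<phi>\<close> by
  \<open>N_phi_less\<close>; so \<phi> would be good.\<close>

lemma critical_impossible: False
proof -
  have "good \<phi>"
    unfolding good_def
  proof (intro allI ballI)
    fix t w assume w: "w \<in> M t"
    have "P (best k) (g (x (P (dual k) w)) - x (g (P (dual k) w))) \<in> M (t + N \<phi> + 1)" if k: "k < d" for k
    proof -
      have na: "\<not> ann (best k)" "\<not> ann (dual k)"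
        using best_not_ann[of k] low_na[OF dual(1) dual_nz[OF k]] k d by auto
      have "P (best k) (g (x (P (dual k) w)) - x (g (P (dual k) w))) \<in> M (t + N (dual k) - r + N (best k))"
        using act_M[OF na(1)] comm act_M[OF na(2) w] by blast
      then show ?thesis
        using M_antimono[of "t + N \<phi> + 1" "t + N (dual k) - r + N (best k)"] N_dual[OF k] N_phi_less by simp
    qed
    then show "C \<phi> w \<in> M (t + N \<phi> + 1)"
      unfolding commutator_phi[OF M_sub[OF w]] by (intro M_sum) auto
  qed
  then show False using not_good by blast
qed

end

context near_commuting
begin

text \<open>Goodness spreads from degree below d to degree d through p = c best d + h, since neither
  term has valuation below \<open>N p\<close>. Only \<open>best d\<close> itself requires the
  critical argument.\<close>

theorem low_degree_good: "p \<in> lowdeg mdeg \<Longrightarrow> p \<noteq> 0 \<Longrightarrow> good p"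
proof -
  have "\<forall>p\<in>lowdeg d. p \<noteq> 0 \<longrightarrow> good p" if "d \<le> mdeg" for d
    using that
  proof (induction d)
    case 0
    then show ?case by (auto simp: lowdeg_iff)
  next
    case (Suc d)
    then have IH: "\<And>p. p \<in> lowdeg d \<Longrightarrow> p \<noteq> 0 \<Longrightarrow> good p" and d: "d < mdeg" by auto
    have phi: "good (best d)"
    proof (cases "d = 0")
      case True
      then have "best d = 1"
        using best_degree[OF d] best_coeff[OF d] by (metis degree_eq_zeroE coeff_pCons_0 one_pCons)
      then show ?thesis unfolding good_def C_def by (auto simp: P_1 M_sub x_closed M_0)
    next
      case False
      show ?thesis
      proof (rule ccontr)
        assume "\<not> good (best d)"
        then interpret critical sc v e W M g x r d "best d"
          by unfold_locales (use False d IH best[OF d] in auto)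
        show False by (rule critical_impossible)
      qed
    qed
    show ?case
    proof (intro ballI impI)
      fix p :: "'a poly" assume p: "p \<in> lowdeg (Suc d)" "p \<noteq> 0"
      let ?c = "coeff p d"
      define h where "h = p - smult ?c (best d)"
      show "good p"
        unfolding good_def
      proof (intro allI ballI)
        fix t w assume w: "w \<in> M t"
        then have wW: "w \<in> W" using M_sub by blast
        have "sc ?c (C (best d) w) \<in> M (t + N p + 1)"
        proof (cases "?c = 0")
          case False
          have "C (best d) w \<in> M (t + N (best d) + 1)" using phi w unfolding good_def by blast
          then have "sc ?c (C (best d) w) \<in> M (t + N (best d) + 1 + e * v ?c)"
            using M_scale[OF False C_closed[OF wW]] by blast
          then show ?thesis using N_le_top[OF d p(1) False]
            M_antimono[of "t + N p + 1" "t + N (best d) + 1 + e * v ?c"] by simp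
        qed (simp add: M_0)
        moreover have "C h w \<in> M (t + N p + 1)"
        proof (cases "h = 0")
          case True
          then show ?thesis using C_smult[OF wW, of 0 h] M_0 by simp
        next
          case False
          then have "h \<in> lowdeg d" "N p \<le> N h" using N_le_rest[OF d p h_def] by auto
          then show ?thesis using IH[of h] False w M_antimono[of "t + N p + 1" "t + N h + 1"]
            unfolding good_def by auto
        qed
        moreover have "C p w = sc ?c (C (best d) w) + C h w"
          by (simp add: h_def C_diff C_smult wW)
        ultimately show "C p w \<in> M (t + N p + 1)" by (simp add: M_add)
      qed
    qed
  qed
  then show "p \<in> lowdeg mdeg \<Longrightarrow> p \<noteq> 0 \<Longrightarrow> good p" by blast
qed

end

section \<open>Pure strata and compressions\<close>

context endo_action
begin

text \<open>Elements of \<open>Falg\<close> vanish outside \<open>W\<close>, while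
  \<open>P p\<close> is given by its formula everywhere; \<open>El\<close> bridges the two
  conventions.\<close>

definition El :: "'f poly \<Rightarrow> 'v \<Rightarrow> 'v" where
  "El p = (\<lambda>x. if x \<in> W then P p x else 0)"

lemma Falg_eq: "Falg sc W g = range El"
proof (intro set_eqI iffI)
  fix a assume "a \<in> Falg sc W g"
  then obtain c m where a: "a = (\<lambda>x. if x \<in> W then (\<Sum>k<m. sc (c k) ((g ^^ k) x)) else 0)"
    unfolding Falg_def by blast
  define p where "p = (\<Sum>k<m. monom (c k) k)"
  have coeff: "coeff p k = (if k < m then c k else 0)" for k
    by (simp add: p_def coeff_sum)
  have "P p x = (\<Sum>k<m. sc (c k) ((g ^^ k) x))" for x
    by (subst P_eq_sum[of m]) (auto simp: coeff)
  then show "a \<in> range El" unfolding a El_def by (intro image_eqI[of _ _ p]) auto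
next
  fix a assume "a \<in> range El"
  then obtain p where "a = El p" by blast
  moreover have "P p x = (\<Sum>k<Suc (degree p). sc (coeff p k) ((g ^^ k) x))" for x
    by (simp add: poly_act_def lessThan_Suc_atMost)
  ultimately show "a \<in> Falg sc W g" unfolding Falg_def El_def
    by (intro CollectI exI[of _ "coeff p"] exI[of _ "Suc (degree p)"]) auto
qed

lemma El_eq_zero_iff: "El p = zeroE \<longleftrightarrow> (\<forall>w\<in>W. P p w = 0)"
  by (auto simp: El_def zeroE_def fun_eq_iff)

lemma El_comp: "El p \<circ> El q = El (p * q)"
  using subspace_0[OF subspace] by (auto simp: El_def fun_eq_iff P_mult P_closed P_zero)

lemma El_comp_eq_id_iff: "El q \<circ> El p = idW W \<longleftrightarrow> (\<forall>w\<in>W. P q (P p w) = w)"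
proof -
  have "El (q * p) = idW W \<longleftrightarrow> (\<forall>w\<in>W. P (q * p) w = w)"
    unfolding El_def idW_def fun_eq_iff by metis
  then show ?thesis by (simp add: El_comp P_mult)
qed

lemma vector_space_endo: "vector_space (\<lambda>c (a :: 'v \<Rightarrow> 'v) x. sc c (a x))"
  by unfold_locales (auto simp: fun_eq_iff scale_left_distrib scale_right_distrib)

lemma El_low:
  assumes "p \<in> lowdeg m"
  shows "El p = (\<Sum>i<m. (\<lambda>x. sc (coeff p i) (El (monom 1 i) x)))"
proof
  fix x
  have "P p x = (\<Sum>i<m. sc (coeff p i) ((g ^^ i) x))"
    using assms by (intro P_eq_sum) (simp add: lowdeg_def)
  moreover have "P (monom 1 i) x = (g ^^ i) x" for i
  proof -
    have "P (monom 1 i) x = (\<Sum>k<Suc i. sc (coeff (monom 1 i) k) ((g ^^ k) x))"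
      by (rule P_eq_sum) simp
    then show ?thesis by (simp add: if_distrib[of "\<lambda>c. sc c _"] cong: if_cong)
  qed
  moreover have "(\<Sum>i<m. (\<lambda>x. sc (coeff p i) (El (monom 1 i) x))) x
      = (\<Sum>i<m. sc (coeff p i) (El (monom 1 i) x))"
    by (induction m) auto
  ultimately show "El p x = (\<Sum>i<m. (\<lambda>x. sc (coeff p i) (El (monom 1 i) x))) x"
    by (simp add: El_def)
qed

lemma Falg_subset_span:
  assumes \<phi>: "\<phi> \<noteq> 0" "\<forall>w\<in>W. P \<phi> w = 0"
  shows "Falg sc W g \<subseteq> module.span (\<lambda>c a x. sc c (a x)) ((\<lambda>i. El (monom 1 i)) ` {..<degree \<phi>})"
proof -
  interpret E: vector_space "\<lambda>c (a :: 'v \<Rightarrow> 'v) x. sc c (a x)" by (rule vector_space_endo)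
  have "El p \<in> E.span ((\<lambda>i. El (monom 1 i)) ` {..<degree \<phi>})" for p
  proof -
    have "P p w = P (p mod \<phi>) w" if "w \<in> W" for w
    proof -
      have "P p w = P (p div \<phi> * \<phi> + p mod \<phi>) w" by simp
      also have "\<dots> = P (p mod \<phi>) w"
        using \<phi>(2) that by (simp only: P_add_left P_mult) (simp add: P_zero)
      finally show ?thesis .
    qed
    then have "El p = El (p mod \<phi>)" by (auto simp: El_def fun_eq_iff)
    also have "p mod \<phi> \<in> lowdeg (degree \<phi>)"
      using degree_mod_less[OF \<phi>(1), of p] by (auto simp: lowdeg_iff)
    then have "El (p mod \<phi>) = (\<Sum>i<degree \<phi>. (\<lambda>x. sc (coeff (p mod \<phi>) i) (El (monom 1 i) x)))"
      by (rule El_low)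
    also have "\<dots> \<in> E.span ((\<lambda>i. El (monom 1 i)) ` {..<degree \<phi>})"
      by (intro E.span_sum E.span_scale E.span_base) auto
    finally show ?thesis .
  qed
  then show ?thesis unfolding Falg_eq by blast
qed

lemma deg_le:
  assumes \<phi>: "\<phi> \<noteq> 0" "\<forall>w\<in>W. P \<phi> w = 0"
  shows "deg sc W g \<le> degree \<phi>"
proof -
  interpret E: vector_space "\<lambda>c (a :: 'v \<Rightarrow> 'v) x. sc c (a x)" by (rule vector_space_endo)
  have "deg sc W g \<le> card ((\<lambda>i. El (monom 1 i)) ` {..<degree \<phi>})"
    unfolding deg_def by (intro E.dim_le_card Falg_subset_span[OF \<phi>]) auto
  also have "\<dots> \<le> degree \<phi>" using card_image_le[of "{..<degree \<phi>}"] by simp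
  finally show ?thesis .
qed

end

context pure_action
begin

text \<open>A linear relation among the powers of g below \<open>mdeg\<close> is a polynomial of too
  small a degree to annihilate, so these powers are independent in \<open>Falg\<close>.\<close>

lemma mdeg_le_deg: "mdeg \<le> deg sc W g"
proof -
  interpret E: vector_space "\<lambda>c (a :: 'v \<Rightarrow> 'v) x. sc c (a x)" by (rule vector_space_endo)
  let ?b = "\<lambda>i. El (monom 1 i)"
  let ?B = "?b ` {..<mdeg}"
  have zero: "p = 0" if "p \<in> lowdeg mdeg" "El p = 0" for p
    using low_not_ann[OF that(1)] that(2) by (auto simp: ann_def El_def fun_eq_iff split: if_splits)
  have mon: "monom 1 i \<in> lowdeg mdeg" if "i < mdeg" for i
    using that by (auto simp: lowdeg_def)
  have inj: "inj_on ?b {..<mdeg}"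
  proof (rule inj_onI)
    fix i j assume ij: "i \<in> {..<mdeg}" "j \<in> {..<mdeg}" "?b i = ?b j"
    have "El (monom 1 i - monom 1 j) = 0"
      using ij(3) by (auto simp: El_def fun_eq_iff P_diff_left split: if_splits)
    then have eq: "monom 1 i - monom 1 j = (0 :: 'f poly)" using zero mon lowdeg_diff ij by blast
    have "coeff (monom 1 i - monom 1 j :: 'f poly) i = 0" by (simp only: eq coeff_0)
    then show "i = j" by (simp split: if_splits)
  qed
  have ind: "E.independent ?B"
  proof
    assume "E.dependent ?B"
    then obtain u y where y: "y \<in> ?B" "u y \<noteq> 0" and sum: "(\<Sum>b\<in>?B. (\<lambda>x. sc (u b) (b x))) = 0"
      by (auto simp: E.dependent_finite)
    define p where "p = (\<Sum>k<mdeg. monom (u (?b k)) k)"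
    have coeff: "coeff p k = (if k < mdeg then u (?b k) else 0)" for k
      by (simp add: p_def coeff_sum)
    have low: "p \<in> lowdeg mdeg" by (simp add: lowdeg_def coeff)
    have "El p = (\<Sum>i<mdeg. (\<lambda>x. sc (coeff p i) (?b i x)))" by (rule El_low[OF low])
    also have "\<dots> = (\<Sum>i<mdeg. (\<lambda>x. sc (u (?b i)) (?b i x)))" by (intro sum.cong) (auto simp: coeff)
    also have "\<dots> = 0" using sum by (simp add: sum.reindex[OF inj])
    finally have "p = 0" using zero low by blast
    then show False using y coeff by (metis (no_types, lifting) coeff_0 imageE lessThan_iff)
  qed
  obtain \<mu> where \<mu>: "\<mu> \<noteq> 0" "degree \<mu> = mdeg" "ann \<mu>" using exists_ann by blast
  have "Falg sc W g \<subseteq> E.span ?B" using Falg_subset_span[of \<mu>] \<mu> unfolding ann_def by simp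
  moreover have "?B \<subseteq> Falg sc W g" unfolding Falg_eq by blast
  ultimately have "E.span ?B = E.span (Falg sc W g)"
    by (metis E.span_mono E.span_minimal E.subspace_span subset_antisym)
  then have "E.dim (Falg sc W g) = card ?B" using E.dim_eq_card ind by blast
  then show ?thesis unfolding deg_def using card_image[OF inj] by simp
qed

text \<open>With \<open>Falg_normalizes\<close> this leads back from polynomials to the conditions
  in \<open>pure\<close>, which is how an approximating operator is confronted with the minimality
  in \<open>simple\<close>.\<close>

lemma Falg_field: "Falg_is_field sc W g"
  unfolding Falg_is_field_def Falg_eq
proof (intro conjI ballI impI)
  show "idW W \<noteq> zeroE" using nontrivial by (auto simp: idW_def zeroE_def fun_eq_iff)
  fix a assume a: "a \<in> range El" "a \<noteq> zeroE"
  then obtain p where p: "a = El p" by blast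
  then obtain q where "El q \<circ> El p = idW W"
    using a act_inverse[of p] El_eq_zero_iff El_comp_eq_id_iff by metis
  then have "El p \<circ> El q = idW W" "El q \<circ> El p = idW W" by (simp_all add: El_comp mult.commute)
  then show "\<exists>b\<in>range El. a \<circ> b = idW W \<and> b \<circ> a = idW W" using p by blast
qed

lemma Falg_normalizes:
  assumes "a \<in> Falg sc W g" "a \<noteq> zeroE"
  shows "\<exists>k. \<forall>s. a ` M s = M (s + k)"
proof -
  obtain p where p: "a = El p" using assms unfolding Falg_eq by blast
  have na: "\<not> (\<forall>w\<in>W. P p w = 0)" using assms p El_eq_zero_iff by blast
  obtain k where k: "\<And>w t. w \<in> W \<Longrightarrow> P p w \<in> M (t + k) \<longleftrightarrow> w \<in> M t"
    using na act_cases[of p] by blast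
  obtain q where q: "\<And>w. w \<in> W \<Longrightarrow> P q (P p w) = w" using na act_inverse[of p] by blast
  have "a ` M s = M (s + k)" for s
  proof
    show "a ` M s \<subseteq> M (s + k)" using k M_sub by (auto simp: p El_def)
    show "M (s + k) \<subseteq> a ` M s"
    proof
      fix y assume y: "y \<in> M (s + k)"
      then have yW: "y \<in> W" using M_sub by blast
      have eq: "P p (P q y) = y" using q[OF yW] P_mult[OF yW] by (metis mult.commute)
      then have "P q y \<in> M s" using k[of "P q y" s] y P_closed[OF yW] by simp
      moreover have "y = a (P q y)" using eq P_closed[OF yW] by (simp add: p El_def)
      ultimately show "y \<in> a ` M s" by blast
    qed
  qed
  then show ?thesis by blast
qed

end

section \<open>The filtration on endomorphisms and what it determines\<close>

context lattice_space
begin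

lemma endo_closed: "endo sc W a \<Longrightarrow> w \<in> W \<Longrightarrow> a w \<in> W"
  by (simp add: endo_def)

lemma afil_iff: "a \<in> afil sc W M n \<longleftrightarrow> endo sc W a \<and> (\<forall>t. \<forall>w\<in>M t. a w \<in> M (t + n))"
  unfolding afil_def by blast

lemma afil_antimono: "n \<le> k \<Longrightarrow> a \<in> afil sc W M k \<Longrightarrow> a \<in> afil sc W M n"
  unfolding afil_iff using M_antimono by (meson add_left_mono)

lemma afil_zero: "(\<lambda>x. 0) \<in> afil sc W M n"
  unfolding afil_iff endo_def using M_0 W_0 by simp

lemma afil_add: "a \<in> afil sc W M n \<Longrightarrow> b \<in> afil sc W M n \<Longrightarrow> (\<lambda>x. a x + b x) \<in> afil sc W M n"
  unfolding afil_iff endo_def using M_add W_add by (simp add: scale_right_distrib)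

lemma afil_diff: "a \<in> afil sc W M n \<Longrightarrow> b \<in> afil sc W M n \<Longrightarrow> (\<lambda>x. a x - b x) \<in> afil sc W M n"
  unfolding afil_iff endo_def using M_diff W_diff by (simp add: scale_right_diff_distrib)

lemma endo_scaled:
  assumes "endo sc W a" shows "endo sc W (\<lambda>x. sc c (a x))"
  using assms unfolding endo_def by (auto simp: W_scale scale_right_distrib mult.commute)

lemma afil_scale:
  assumes "c \<noteq> 0" "endo sc W a"
  shows "(\<lambda>x. sc c (a x)) \<in> afil sc W M (n + e * v c) \<longleftrightarrow> a \<in> afil sc W M n"
proof -
  have "sc c (a w) \<in> M (t + (n + e * v c)) \<longleftrightarrow> a w \<in> M (t + n)" if "w \<in> W" for t w
    using M_scale[OF assms(1) endo_closed[OF assms(2) that], of "t + n"] by (simp add: add.assoc)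
  then show ?thesis unfolding afil_iff using endo_scaled[OF assms(2)] assms(2) M_sub by blast
qed

lemma endo_idW: "endo sc W (idW W)"
  using W_add W_scale by (auto simp: endo_def idW_def)

text \<open>Scalars make the period visible in the filtration on endomorphisms.\<close>

lemma scaled_id_afil_iff:
  assumes "\<exists>w\<in>W. w \<noteq> 0" "c \<noteq> 0"
  shows "(\<lambda>x. sc c (idW W x)) \<in> afil sc W M n \<longleftrightarrow> n \<le> e * v c"
proof -
  obtain w where w: "w \<in> W" "w \<noteq> 0" using assms by blast
  have "idW W \<in> afil sc W M k \<longleftrightarrow> k \<le> 0" for k
  proof
    assume "idW W \<in> afil sc W M k"
    then have "w \<in> M (ord w + k)"
      using ord_in_M[OF w] w unfolding afil_iff by (force simp: idW_def)
    then show "k \<le> 0" using ord_iff[OF w] by simp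
  next
    assume "k \<le> 0"
    then have "w \<in> M t \<Longrightarrow> w \<in> M (t + k)" for w t using M_antimono[of "t + k" t] by simp
    then show "idW W \<in> afil sc W M k"
      unfolding afil_iff using endo_idW M_sub by (auto simp: idW_def)
  qed
  then show ?thesis using afil_scale[OF assms(2) endo_idW, of "n - e * v c"] by simp
qed

end

text \<open>Equivalence of strata equates only tails of two filtrations, with periods and levels
  that may differ at the outset. The scalar \<open>?u k\<close> has exact levels - e k and - e' k;
  comparing two consecutive large k forces e = e' and r = r'. Any remaining level is carried into
  the tail by a scalar.\<close>

lemma afil_eq_of_cofinal:
  assumes A: "lattice_space sc v e W M" and B: "lattice_space sc v e' W M'"
    and nt: "\<exists>w\<in>W. w \<noteq> 0"
    and eq: "\<And>j. 0 \<le> j \<Longrightarrow> afil sc W M (- r - j) = afil sc W M' (- r' - j)"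
  shows "r = r'" and "afil sc W M n = afil sc W M' n"
proof -
  interpret A: lattice_space sc v e W M by (rule A)
  interpret B: lattice_space sc v e' W M' by (rule B)
  let ?u = "\<lambda>k::nat. inverse (unif v ^ k)"
  have u: "?u k \<noteq> 0" "v (?u k) = - int k" for k
    using A.unif by (simp_all add: A.v_inverse A.v_power)
  have iff: "- r - j \<le> - (e * int k) \<longleftrightarrow> - r' - j \<le> - (e' * int k)" if "0 \<le> j" for j k
    using A.scaled_id_afil_iff[OF nt u(1), of k "- r - j"]
      B.scaled_id_afil_iff[OF nt u(1), of k "- r' - j"] eq[OF that] u(2)[of k] by simp
  \<comment> \<open>For \<open>j = e * int k - r\<close> the level - r - j is the last one
    containing \<open>?u k\<close>; the bound on k makes this j and its counterpart
    nonnegative.\<close>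
  have lin: "e * int k - r = e' * int k - r'" if k: "\<bar>r\<bar> + \<bar>r'\<bar> \<le> int k" for k
  proof -
    have "int k \<le> e * int k" "int k \<le> e' * int k"
      using A.e_pos B.e_pos by (simp_all add: mult_le_cancel_right1)
    then have "0 \<le> e * int k - r" "0 \<le> e' * int k - r'" using k by linarith+
    then show ?thesis
      using iff[of "e * int k - r" k] iff[of "e' * int k - r'" k] by simp
  qed
  let ?k = "nat (\<bar>r\<bar> + \<bar>r'\<bar>)"
  have "e * int ?k - r = e' * int ?k - r'" "e * int (Suc ?k) - r = e' * int (Suc ?k) - r'"
    using lin[of ?k] lin[of "Suc ?k"] by auto
  then have e: "e = e'" and r: "r = r'" by (auto simp: algebra_simps)
  show "r = r'" by (rule r)
  define k where "k = nat (\<bar>n\<bar> + \<bar>r\<bar>)"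
  have "int k \<le> e * int k" using A.e_pos by (simp add: mult_le_cancel_right1)
  then have j: "0 \<le> e * int k - n - r" unfolding k_def by linarith
  have iff_endo: "a \<in> afil sc W M n \<longleftrightarrow> a \<in> afil sc W M' n" if a: "endo sc W a" for a
    using A.afil_scale[OF u(1) a, of k n] B.afil_scale[OF u(1) a, of k n] eq[OF j] u(2)[of k] e r
    by (simp add: algebra_simps)
  have "a \<in> afil sc W M n \<longleftrightarrow> a \<in> afil sc W M' n" for a
    using iff_endo[of a] A.afil_iff B.afil_iff by blast
  then show "afil sc W M n = afil sc W M' n" by blast
qed

text \<open>Purity refers to the lattices \<open>M'\<close>, which need not be those of
  \<open>M\<close>. An exact shift by k amounts to membership of the operator in level k and of its
  inverse in level -k, and such memberships transfer.\<close>

lemma pure_imp_pure_action: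
  assumes A: "lattice_space sc v e W M"
    and afil: "\<And>n. afil sc W M n = afil sc W M' n"
    and pure: "pure v sc W M' q r g"
  shows "pure_action sc v e W M g"
proof -
  interpret A: lattice_space sc v e W M by (rule A)
  have endo: "endo sc W g" using pure unfolding pure_def afil_def by blast
  interpret endo_action sc W g
    by (intro endo_action.intro A.vector_space_axioms endo_action_axioms.intro A.subspace_W endo)
  have field: "Falg_is_field sc W g"
    and norm: "\<And>a. a \<in> Falg sc W g \<Longrightarrow> a \<noteq> zeroE \<Longrightarrow> \<exists>k. \<forall>s. a ` M' s = M' (s + k)"
    using pure unfolding pure_def by blast+
  have endo_El: "endo sc W (El p)" for p
    using A.W_add A.W_scale by (auto simp: endo_def El_def P_closed P_add P_scale)
  have main: "(\<forall>w\<in>W. P p w = 0) \<or> (\<exists>q. (\<forall>w\<in>W. P q (P p w) = w) \<and>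
      (\<exists>k. \<forall>w\<in>W. \<forall>t. P p w \<in> M (t + k) \<longleftrightarrow> w \<in> M t))" for p
  proof (cases "El p = zeroE")
    case False
    then obtain q where q: "El p \<circ> El q = idW W" "El q \<circ> El p = idW W"
      using field unfolding Falg_is_field_def Falg_eq by blast
    have qp: "\<And>w. w \<in> W \<Longrightarrow> P q (P p w) = w" using q(2) El_comp_eq_id_iff by blast
    obtain k where k: "\<And>s. El p ` M' s = M' (s + k)"
      using norm[of "El p"] False unfolding Falg_eq by blast
    have M'_W: "w \<in> W" if w: "w \<in> M' s" for w s
    proof -
      have "lattice v sc W (M' s)"
        using pure unfolding pure_def stratum_def lattice_seq_def by blast
      then obtain B c where "module.span sc B = W" "w = (\<Sum>b\<in>B. sc (c b) b)"
        unfolding lattice_def using w by blast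
      moreover have "(\<Sum>b\<in>B. sc (c b) b) \<in> A.span B"
        by (intro A.span_sum A.span_scale A.span_base)
      ultimately show ?thesis by simp
    qed
    have "El p \<in> afil sc W M' k" unfolding afil_def using endo_El k by blast
    moreover have "El q \<in> afil sc W M' (- k)"
      unfolding afil_def
    proof (intro CollectI conjI allI endo_El)
      fix s
      have "El q ` M' s = El q ` El p ` M' (s - k)" using k[of "s - k"] by simp
      also have "\<dots> = (El q \<circ> El p) ` M' (s - k)" by (rule image_comp)
      also have "\<dots> = M' (s - k)" unfolding q(2) using M'_W by (force simp: idW_def)
      finally show "El q ` M' s \<subseteq> M' (s + - k)" by simp
    qed
    ultimately have *: "El p \<in> afil sc W M k" "El q \<in> afil sc W M (- k)" using afil by auto
    have "P p w \<in> M (t + k) \<longleftrightarrow> w \<in> M t" if w: "w \<in> W" for w t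
    proof
      assume "w \<in> M t"
      then show "P p w \<in> M (t + k)" using *(1) w unfolding A.afil_iff by (force simp: El_def)
    next
      assume "P p w \<in> M (t + k)"
      then have "El q (P p w) \<in> M (t + k + - k)" using *(2) unfolding A.afil_iff by blast
      then show "w \<in> M t" using qp[OF w] P_closed[OF w] by (simp add: El_def)
    qed
    then show ?thesis using qp by blast
  qed (use El_eq_zero_iff in blast)
  show ?thesis
  proof
    have "idW W \<noteq> zeroE" using field unfolding Falg_is_field_def by blast
    then show "\<exists>w\<in>W. w \<noteq> 0" by (auto simp: idW_def zeroE_def fun_eq_iff split: if_splits)
    show "(\<forall>w\<in>W. P p w = 0) \<or> (\<exists>k. \<forall>w\<in>W. \<forall>t. P p w \<in> M (t + k) \<longleftrightarrow> w \<in> M t)" for p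
      using main[of p] by blast
    show "(\<forall>w\<in>W. P p w = 0) \<or> (\<exists>q. \<forall>w\<in>W. P q (P p w) = w)" for p
      using main[of p] by blast
  qed
qed

text \<open>\<open>\<iota>\<close> and \<open>\<pi>\<close> present \<open>V\<close> as the image of
  the projector \<open>x\<close>, with \<open>L\<close> the filtration induced by \<open>M\<close>.
  Separate types for \<open>V\<close> and \<open>W\<close> are needed because the ambient space will
  be a product containing the block as a factor.\<close>

locale compression = near_commuting sc v e W M g x r + L: lattice_space sc1 v e V L
  for sc :: "'f::field \<Rightarrow> 'w::ab_group_add \<Rightarrow> 'w" and v e W M g x r
    and sc1 :: "'f \<Rightarrow> 'v::ab_group_add \<Rightarrow> 'v" and V L +
  fixes \<iota> :: "'v \<Rightarrow> 'w" and \<pi> :: "'w \<Rightarrow> 'v"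
  assumes iota_closed: "u \<in> V \<Longrightarrow> \<iota> u \<in> W"
    and iota_add: "u \<in> V \<Longrightarrow> u' \<in> V \<Longrightarrow> \<iota> (u + u') = \<iota> u + \<iota> u'"
    and pi_closed: "w \<in> W \<Longrightarrow> \<pi> w \<in> V"
    and pi_add: "w \<in> W \<Longrightarrow> w' \<in> W \<Longrightarrow> \<pi> (w + w') = \<pi> w + \<pi> w'"
    and pi_scale: "w \<in> W \<Longrightarrow> \<pi> (sc c w) = sc1 c (\<pi> w)"
    and pi_iota: "u \<in> V \<Longrightarrow> \<pi> (\<iota> u) = u"
    and x_eq: "w \<in> W \<Longrightarrow> x w = \<iota> (\<pi> w)"
    and iota_M: "u \<in> V \<Longrightarrow> \<iota> u \<in> M t \<longleftrightarrow> u \<in> L t"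
begin

definition \<rho> :: "'f poly \<Rightarrow> 'v \<Rightarrow> 'v" where
  "\<rho> p u = \<pi> (P p (\<iota> u))"

lemma pi_diff: "w \<in> W \<Longrightarrow> w' \<in> W \<Longrightarrow> \<pi> (w - w') = \<pi> w - \<pi> w'"
  using pi_add[of "w - w'" w'] W_diff by simp

lemma pi_M: "w \<in> M t \<Longrightarrow> \<pi> w \<in> L t"
  using iota_M[OF pi_closed[OF M_sub], of w t t] x_M[of w t] x_eq[OF M_sub, of w t] by simp

lemma pi_x: "w \<in> W \<Longrightarrow> \<pi> (x w) = \<pi> w"
  by (simp add: x_eq pi_iota pi_closed)

lemma x_iota: "u \<in> V \<Longrightarrow> x (\<iota> u) = \<iota> u"
  by (simp add: x_eq iota_closed pi_iota)

lemma iota_rho: "u \<in> V \<Longrightarrow> \<iota> (\<rho> p u) = x (P p (\<iota> u))"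
  by (simp add: \<rho>_def x_eq P_closed iota_closed)

text \<open>As \<open>x\<close> fixes \<open>\<iota> u\<close>, the defect is exactly the commutator
  \<open>C p (\<iota> u)\<close>, small by \<open>low_degree_good\<close>.\<close>

lemma rho_defect:
  assumes "p \<in> lowdeg mdeg" "p \<noteq> 0" "u \<in> L t"
  shows "P p (\<iota> u) - \<iota> (\<rho> p u) \<in> M (t + N p + 1)"
proof -
  have uV: "u \<in> V" using assms L.M_sub by blast
  have "C p (\<iota> u) \<in> M (t + N p + 1)"
    using low_degree_good[OF assms(1,2)] iota_M[OF uV] assms(3) unfolding good_def by blast
  then show ?thesis using uV by (simp add: C_def x_iota iota_rho)
qed

text \<open>If compression lost the leading term, \<open>P p (\<iota> u)\<close> would agree with
  its own defect up to higher valuation and lie deeper than its exact shift allows.\<close>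

lemma rho_val:
  assumes p: "p \<in> lowdeg mdeg" "p \<noteq> 0" and u: "u \<in> V"
  shows "\<rho> p u \<in> L (t + N p) \<longleftrightarrow> u \<in> L t"
proof
  have na: "\<not> ann p" using low_not_ann p by blast
  show "\<rho> p u \<in> L (t + N p)" if "u \<in> L t"
    unfolding \<rho>_def using act_M[OF na] iota_M[OF u] that pi_M by blast
  assume rho: "\<rho> p u \<in> L (t + N p)"
  show "u \<in> L t"
  proof (rule ccontr)
    assume n: "u \<notin> L t"
    then have nz: "u \<noteq> 0" using L.M_0 by auto
    have less: "L.ord u < t" using n L.ord_iff[OF u nz] by simp
    have "P p (\<iota> u) - \<iota> (\<rho> p u) \<in> M (L.ord u + N p + 1)"
      using rho_defect[OF p L.ord_in_M[OF u nz]] .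
    moreover have "\<rho> p u \<in> L (L.ord u + N p + 1)"
      using L.M_antimono[OF _ rho] less by simp
    then have "\<iota> (\<rho> p u) \<in> M (L.ord u + N p + 1)"
      using iota_M u by (simp add: \<rho>_def pi_closed P_closed iota_closed)
    ultimately have "P p (\<iota> u) - \<iota> (\<rho> p u) + \<iota> (\<rho> p u) \<in> M (L.ord u + N p + 1)" by (rule M_add)
    then have "P p (\<iota> u) \<in> M (L.ord u + 1 + N p)" by (simp add: algebra_simps)
    then have "\<iota> u \<in> M (L.ord u + 1)" using act_val[OF na iota_closed[OF u]] by blast
    then show False using iota_M[OF u] L.ord_iff[OF u nz] by simp
  qed
qed

lemma rho_closed: "u \<in> V \<Longrightarrow> \<rho> p u \<in> V"
  by (simp add: \<rho>_def pi_closed P_closed iota_closed)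

lemma rho_comp:
  assumes p: "p \<in> lowdeg mdeg" "p \<noteq> 0" and q: "q \<in> lowdeg mdeg" "q \<noteq> 0"
    and h: "\<And>w. w \<in> W \<Longrightarrow> P h w = P p (P q w)" and u: "u \<in> L t"
  shows "\<rho> p (\<rho> q u) - \<rho> h u \<in> L (t + N p + N q + 1)"
proof -
  have uV: "u \<in> V" using u L.M_sub by blast
  let ?w = "P q (\<iota> u)"
  have w: "?w \<in> W" "\<iota> (\<rho> q u) \<in> W" using uV by (simp_all add: P_closed iota_closed rho_closed)
  have "?w - \<iota> (\<rho> q u) \<in> M (t + N q + 1)" using rho_defect[OF q u] .
  then have "P p (?w - \<iota> (\<rho> q u)) \<in> M (t + N q + 1 + N p)"
    using act_M low_not_ann p by blast
  then have "\<pi> (P p (?w - \<iota> (\<rho> q u))) \<in> L (t + N p + N q + 1)" using pi_M by (simp add: algebra_simps)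
  moreover have "\<pi> (P p (?w - \<iota> (\<rho> q u))) = \<rho> h u - \<rho> p (\<rho> q u)"
    unfolding \<rho>_def[of h] \<rho>_def[of p]
    using w uV by (simp add: P_diff pi_diff P_closed h iota_closed)
  ultimately show ?thesis using L.M_neg by fastforce
qed

sublocale A: almost_action sc1 v e V L mdeg \<rho> N
proof
  fix p q :: "'f poly" and c :: 'f and w w' :: 'v
  obtain \<mu> where \<mu>: "\<mu> \<noteq> 0" "degree \<mu> = mdeg" "ann \<mu>" using exists_ann by blast
  have low: "f mod \<mu> \<in> lowdeg mdeg" for f
    using degree_mod_less[OF \<mu>(1), of f] \<mu>(2) by (auto simp: lowdeg_iff)
  have mod: "P (f mod \<mu>) w = P f w" if "w \<in> W" for f w
  proof -
    have "P f w = P (f div \<mu> * \<mu> + f mod \<mu>) w" by simp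
    also have "\<dots> = P (f mod \<mu>) w"
      using \<mu>(3) that unfolding ann_def by (simp only: P_add_left P_mult) (simp add: P_zero)
    finally show ?thesis by simp
  qed
  show "0 < mdeg" by (rule mdeg_pos)
  show "w \<in> V \<Longrightarrow> \<rho> p w \<in> V" by (rule rho_closed)
  show "w \<in> V \<Longrightarrow> \<rho> (p + q) w = \<rho> p w + \<rho> q w"
    by (simp add: \<rho>_def P_add_left pi_add P_closed iota_closed)
  show "w \<in> V \<Longrightarrow> \<rho> (smult c p) w = sc1 c (\<rho> p w)"
    by (simp add: \<rho>_def P_smult pi_scale P_closed iota_closed)
  show "w \<in> V \<Longrightarrow> w' \<in> V \<Longrightarrow> \<rho> p (w + w') = \<rho> p w + \<rho> p w'"
    by (simp add: \<rho>_def iota_add P_add pi_add P_closed iota_closed)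
  show "w \<in> V \<Longrightarrow> \<rho> 1 w = w" by (simp add: \<rho>_def P_1 iota_closed pi_iota)
  show "p \<in> lowdeg mdeg \<Longrightarrow> p \<noteq> 0 \<Longrightarrow> w \<in> V \<Longrightarrow> \<rho> p w \<in> L (t + N p) \<longleftrightarrow> w \<in> L t" for t
    by (rule rho_val)
  assume p: "p \<in> lowdeg mdeg" "p \<noteq> 0"
  {
    assume q: "q \<in> lowdeg mdeg" "q \<noteq> 0"
    have "\<rho> p (\<rho> q w) - \<rho> ((p * q) mod \<mu>) w \<in> L (t + N p + N q + 1)" if "w \<in> L t" for t w
      by (rule rho_comp[OF p q _ that]) (simp add: mod P_mult)
    then show "\<exists>h\<in>lowdeg mdeg. \<forall>t. \<forall>w\<in>L t. \<rho> p (\<rho> q w) - \<rho> h w \<in> L (t + N p + N q + 1)"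
      using low by blast
  }
  have na: "\<not> ann p" using low_not_ann p by blast
  obtain k where k: "\<And>w. w \<in> W \<Longrightarrow> P k (P p w) = w"
    using act_inverse[of p] na unfolding ann_def by blast
  let ?k = "k mod \<mu>"
  have inv: "P ?k (P p w) = w" if "w \<in> W" for w using k that by (simp add: mod P_closed)
  have k_nz: "?k \<noteq> 0" using inv[OF w0(1)] w0(2) by auto
  have "N (?k * p) = N ?k + N p" using N_mult low_not_ann[OF low k_nz] na by blast
  moreover have "N (?k * p) = N 1"
    unfolding N_def using inv[OF w0(1)] w0 by (simp add: P_mult P_1)
  ultimately have Nk: "N ?k = - N p" using N_1 by simp
  have comp: "\<rho> ?k (\<rho> p w) - \<rho> 1 w \<in> L (t + N ?k + N p + 1)" if "w \<in> L t" for t w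
    by (rule rho_comp[OF low k_nz p _ that]) (simp add: inv P_1)
  have "\<rho> ?k (\<rho> p w) - w \<in> L (t + 1)" if "w \<in> L t" for t w
    using comp[OF that] L.M_sub[OF that] Nk by (simp add: \<rho>_def P_1 iota_closed pi_iota)
  then show "\<exists>q\<in>lowdeg mdeg. q \<noteq> 0 \<and> N q = - N p \<and> (\<forall>t. \<forall>w\<in>L t. \<rho> q (\<rho> p w) - w \<in> L (t + 1))"
    using low k_nz Nk by blast
qed

text \<open>Two errors of depth \<open>r\<close> add up: that of \<open>\<beta>\<close> against the
  compression of g, and the commutator of g with \<open>x\<close> at \<open>P p (\<iota> u)\<close>.
  The exact valuation \<open>rho_val\<close> places this vector in \<open>M t\<close>.\<close>

lemma rho_X:
  assumes near: "\<And>u t. u \<in> L t \<Longrightarrow> \<beta> u - \<pi> (g (\<iota> u)) \<in> L (t - r)"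
    and p: "p \<in> lowdeg mdeg" and \<mu>: "ann \<mu>"
    and u: "u \<in> V" "\<rho> p u \<in> L t"
  shows "\<beta> (\<rho> p u) - \<rho> (pCons 0 p mod \<mu>) u \<in> L (t - r)"
proof -
  let ?w = "P p (\<iota> u)"
  have wW: "?w \<in> W" using u by (simp add: P_closed iota_closed)
  have w: "?w \<in> M t"
  proof (cases "p = 0")
    case False
    then have "u \<in> L (t - N p)" using rho_val[OF p False u(1), of "t - N p"] u(2) by simp
    then have "\<iota> u \<in> M (t - N p)" using iota_M u by blast
    then show ?thesis using act_M[OF low_not_ann[OF p False], of "\<iota> u" "t - N p"] by simp
  qed (simp add: M_0)
  have "\<pi> (g (x ?w) - x (g ?w)) \<in> L (t - r)" using comm[OF w] pi_M by blast
  then have 1: "\<pi> (g (x ?w)) - \<pi> (g ?w) \<in> L (t - r)"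
    using wW by (simp add: pi_diff pi_x g_closed x_closed)
  have "\<beta> (\<rho> p u) - \<pi> (g (x ?w)) \<in> L (t - r)" using near[OF u(2)] iota_rho[OF u(1)] by simp
  from L.M_add[OF this 1] have "\<beta> (\<rho> p u) - \<pi> (g ?w) \<in> L (t - r)" by simp
  moreover have "\<pi> (g ?w) = \<rho> (pCons 0 p mod \<mu>) u"
  proof -
    have "g ?w = P (pCons 0 p) (\<iota> u)" using u by (simp add: P_pCons iota_closed)
    also have "\<dots> = P (pCons 0 p div \<mu> * \<mu> + pCons 0 p mod \<mu>) (\<iota> u)" by simp
    also have "\<dots> = P (pCons 0 p mod \<mu>) (\<iota> u)"
      using \<mu> iota_closed[OF u(1)] unfolding ann_def by (simp only: P_add_left P_mult) (simp add: P_zero)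
    finally show ?thesis by (simp add: \<rho>_def)
  qed
  ultimately show ?thesis by simp
qed

end

section \<open>Matched components\<close>

lemma coset_memI: "a \<in> S \<Longrightarrow> (\<lambda>x. b x + a x) \<in> coset b S"
  unfolding coset_def by blast

text \<open>Two subgroups occur because the cosets come from two lattice sequences; equal cosets
  have the same group of differences.\<close>

lemma coset_eq_imp:
  fixes S T :: "('v \<Rightarrow> 'v::ab_group_add) set"
  assumes S: "(\<lambda>x. 0) \<in> S" "\<And>a b. a \<in> S \<Longrightarrow> b \<in> S \<Longrightarrow> (\<lambda>x. a x - b x) \<in> S"
    and T: "(\<lambda>x. 0) \<in> T" "\<And>a b. a \<in> T \<Longrightarrow> b \<in> T \<Longrightarrow> (\<lambda>x. a x - b x) \<in> T"
    and eq: "coset b S = coset g T"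
  shows "S = T" "(\<lambda>x. g x - b x) \<in> S"
proof -
  have "g \<in> coset g T" unfolding coset_def using T(1) by force
  then have "g \<in> coset b S" by (simp add: eq)
  then obtain s where s: "s \<in> S" "g = (\<lambda>x. b x + s x)" unfolding coset_def by blast
  then show "(\<lambda>x. g x - b x) \<in> S" by simp
  have "b \<in> coset b S" unfolding coset_def using S(1) by force
  then have "b \<in> coset g T" by (simp add: eq)
  then obtain t where t: "t \<in> T" "b = (\<lambda>x. g x + t x)" unfolding coset_def by blast
  have st: "s x = - t x" for x
  proof -
    have "b x = b x + s x + t x" using fun_cong[OF t(2), of x] s(2) by simp
    then show ?thesis by (simp add: eq_neg_iff_add_eq_0 add.assoc)
  qed
  have "a \<in> T" if "a \<in> S" for a
  proof -
    have "(\<lambda>x. b x + a x) \<in> coset g T" using coset_memI[OF that, of b] eq by simp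
    then obtain u where u: "u \<in> T" "(\<lambda>x. b x + a x) = (\<lambda>x. g x + u x)" unfolding coset_def by blast
    have "a = (\<lambda>x. u x - t x)"
    proof
      fix x
      show "a x = u x - t x" using fun_cong[OF u(2), of x] s(2) st[of x] by simp
    qed
    then show ?thesis using T(2)[OF u(1) t(1)] by simp
  qed
  moreover have "a \<in> S" if "a \<in> T" for a
  proof -
    have "(\<lambda>x. g x + a x) \<in> coset b S" using coset_memI[OF that, of g] eq by simp
    then obtain u where u: "u \<in> S" "(\<lambda>x. g x + a x) = (\<lambda>x. b x + u x)" unfolding coset_def by blast
    have "a = (\<lambda>x. u x - s x)"
    proof
      fix x
      show "a x = u x - s x" using fun_cong[OF u(2), of x] s(2) by (simp add: algebra_simps)
    qed
    then show ?thesis using S(2)[OF u(1) s(1)] by simp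
  qed
  ultimately show "S = T" by blast
qed

lemma coset_eqI:
  fixes S :: "('v \<Rightarrow> 'v::ab_group_add) set"
  assumes "\<And>a b. a \<in> S \<Longrightarrow> b \<in> S \<Longrightarrow> (\<lambda>x. a x - b x) \<in> S"
    and "\<And>a b. a \<in> S \<Longrightarrow> b \<in> S \<Longrightarrow> (\<lambda>x. a x + b x) \<in> S"
    and "(\<lambda>x. g x - b x) \<in> S"
  shows "coset b S = coset g S"
proof (intro set_eqI iffI)
  fix y assume "y \<in> coset b S"
  then obtain a where a: "a \<in> S" "y = (\<lambda>x. b x + a x)" unfolding coset_def by blast
  have "y = (\<lambda>x. g x + (a x - (g x - b x)))" using a by (auto simp: algebra_simps)
  then show "y \<in> coset g S" using coset_memI[OF assms(1)[OF a(1) assms(3)], of g] by simp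
next
  fix y assume "y \<in> coset g S"
  then obtain a where a: "a \<in> S" "y = (\<lambda>x. g x + a x)" unfolding coset_def by blast
  have "y = (\<lambda>x. b x + (a x + (g x - b x)))" using a by (auto simp: algebra_simps)
  then show "y \<in> coset b S" using coset_memI[OF assms(2)[OF a(1) assms(3)], of b] by simp
qed

lemma vector_space_sc2: "vector_space sc \<Longrightarrow> vector_space (sc2 sc)"
  unfolding vector_space_def sc2_def by (auto simp: prod_eq_iff)

lemma (in lattice_space) endo_diff:
  "endo sc W a \<Longrightarrow> endo sc W b \<Longrightarrow> endo sc W (\<lambda>x. a x - b x)"
  unfolding endo_def using W_diff by (simp add: scale_right_diff_distrib)

text \<open>The case D = 1, used for matched blocks whose simple stratum is zero: only the scalars
  of F are left to act.\<close>

lemma scalar_almost_action: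
  assumes "lattice_space sc v e V L"
  shows "almost_action sc v e V L 1 (\<lambda>p. sc (coeff p 0)) (\<lambda>p. e * v (coeff p 0))"
proof -
  interpret lattice_space sc v e V L by (rule assms)
  have nz: "coeff p 0 \<noteq> 0" if "p \<in> lowdeg 1" "p \<noteq> 0" for p :: "'a poly"
    using that by (auto simp: lowdeg_iff elim!: degree_eq_zeroE)
  have const: "[:c:] \<in> lowdeg 1" for c :: 'a by (simp add: lowdeg_iff)
  show ?thesis
  proof
    fix p q :: "'a poly" and t w w'
    show "p \<in> lowdeg 1 \<Longrightarrow> p \<noteq> 0 \<Longrightarrow> w \<in> V \<Longrightarrow>
        sc (coeff p 0) w \<in> L (t + e * v (coeff p 0)) \<longleftrightarrow> w \<in> L t"
      using M_scale[OF nz] by blast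
    show "\<exists>h\<in>lowdeg 1. \<forall>t. \<forall>w\<in>L t. sc (coeff p 0) (sc (coeff q 0) w) - sc (coeff h 0) w
        \<in> L (t + e * v (coeff p 0) + e * v (coeff q 0) + 1)"
      by (intro bexI[of _ "[:coeff p 0 * coeff q 0:]"] const) (simp add: M_0)
    assume p: "p \<in> lowdeg 1" "p \<noteq> 0"
    show "\<exists>q\<in>lowdeg 1. q \<noteq> 0 \<and> e * v (coeff q 0) = - (e * v (coeff p 0)) \<and>
        (\<forall>t. \<forall>w\<in>L t. sc (coeff q 0) (sc (coeff p 0) w) - w \<in> L (t + 1))"
      using nz[OF p] by (intro bexI[of _ "[:inverse (coeff p 0):]"] const) (simp add: M_0 v_inverse)
  qed (auto simp: W_scale scale_left_distrib scale_right_distrib)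
qed

text \<open>The projection onto the first factor commutes with \<open>\<gamma>\<close> up to \<open>\<aa>\<^sub>-\<^sub>r\<close>, so it commutes with the
  graded field of \<open>F[\<gamma>]\<close>; hence both factors are almost modules over \<open>F[\<gamma>]\<close>.\<close>

lemma exists_component_isometry:
  fixes sc :: "'f::field \<Rightarrow> 'v::ab_group_add \<Rightarrow> 'v"
  assumes vs: "vector_space sc" and F: "nonarch_local_field v"
    and A: "lattice_space sc v e V L" and B: "lattice_space sc v e V' L'"
    and perA: "\<And>s. L (s + e) = sc (unif v) ` L s" and perB: "\<And>s. L' (s + e) = sc (unif v) ` L' s"
    and simple: "simple v (sc2 sc) (V \<times> V') \<Lambda> q' r' \<gamma>"
    and equiv: "strata_equiv v (sc2 sc) (V \<times> V') (\<lambda>s. L s \<times> L' s) q r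
      (\<lambda>p. if p \<in> V \<times> V' then (\<beta> (fst p), \<beta>' (snd p)) else 0) \<Lambda> q' r' \<gamma>"
    and closed: "\<And>x. x \<in> V \<Longrightarrow> \<beta> x \<in> V"
    and add: "\<And>x y. x \<in> V \<Longrightarrow> y \<in> V \<Longrightarrow> \<beta> (x + y) = \<beta> x + \<beta> y"
      "\<And>x y. x \<in> V' \<Longrightarrow> y \<in> V' \<Longrightarrow> \<beta>' (x + y) = \<beta>' x + \<beta>' y"
    and kdim: "\<And>t. kdim v sc (L t) (L (t + 1)) = kdim v sc (L' t) (L' (t + 1))"
  shows "\<exists>h. (\<forall>x\<in>V. h x \<in> V') \<and> (\<forall>x\<in>V. \<forall>y\<in>V. h (x + y) = h x + h y)
    \<and> (\<forall>c. \<forall>x\<in>V. h (sc c x) = sc c (h x)) \<and> h ` V = V'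
    \<and> (\<forall>x\<in>V. \<forall>t. h x \<in> L' t \<longleftrightarrow> x \<in> L t)
    \<and> (\<forall>t. \<forall>x\<in>L t. h (\<beta> x) - \<beta>' (h x) \<in> L' (t - r))"
proof -
  interpret A: lattice_space sc v e V L by (rule A)
  interpret B: lattice_space sc v e V' L' by (rule B)
  let ?W = "V \<times> V'" and ?M = "\<lambda>s. L s \<times> L' s" and ?sc = "sc2 sc"
  let ?b = "\<lambda>p. if p \<in> ?W then (\<beta> (fst p), \<beta>' (snd p)) else 0"
  have strM: "stratum v ?sc ?W ?M q r ?b" and str\<Lambda>: "stratum v ?sc ?W \<Lambda> q' r' \<gamma>"
    and cos: "\<And>j. 0 \<le> j \<Longrightarrow> coset ?b (afil ?sc ?W ?M (- r - j)) = coset \<gamma> (afil ?sc ?W \<Lambda> (- r' - j))"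
    using equiv unfolding strata_equiv_def by blast+
  have lsM: "lattice_seq v ?sc ?W ?M" using strM unfolding stratum_def by blast
  have vs2: "vector_space ?sc" by (rule vector_space_sc2[OF vs])
  have perM: "?M (s + e) = ?sc (unif v) ` ?M s" for s
    unfolding perA perB by (auto simp: sc2_def image_iff)
  have M: "lattice_space ?sc v e ?W ?M"
    by (rule lattice_seq_lattice_space[OF vs2 F lsM A.e_pos perM])
  interpret M: lattice_space ?sc v e ?W ?M by (rule M)
  obtain e' where e': "0 < e'" "\<And>s. \<Lambda> (s + e') = ?sc (unif v) ` \<Lambda> s"
    using str\<Lambda> unfolding stratum_def lattice_seq_def by blast
  have ls\<Lambda>: "lattice_seq v ?sc ?W \<Lambda>" using str\<Lambda> unfolding stratum_def by blast
  have \<Lambda>: "lattice_space ?sc v e' ?W \<Lambda>"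
    by (rule lattice_seq_lattice_space[OF vs2 F ls\<Lambda> e'])
  interpret \<Lambda>: lattice_space ?sc v e' ?W \<Lambda> by (rule \<Lambda>)
  have afil_cof: "afil ?sc ?W ?M (- r - j) = afil ?sc ?W \<Lambda> (- r' - j)"
    and diff: "(\<lambda>x. \<gamma> x - ?b x) \<in> afil ?sc ?W ?M (- r - j)" if "0 \<le> j" for j
    using coset_eq_imp[OF M.afil_zero M.afil_diff \<Lambda>.afil_zero \<Lambda>.afil_diff cos[OF that]] by blast+
  have near: "\<gamma> w - ?b w \<in> ?M (t - r)" if "w \<in> ?M t" for w t
    using diff[of 0] that unfolding M.afil_iff by force
  show ?thesis
  proof (cases "zero_stratum v ?sc ?W \<Lambda> q' r' \<gamma>")
    case True
    then have \<gamma>: "\<gamma> w = 0" for w by (simp add: zero_stratum_def zeroE_def)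
    interpret almost_action_pair sc v e V L V' L' 1
      "\<lambda>p. sc (coeff p 0)" "\<lambda>p. sc (coeff p 0)" "\<lambda>p. e * v (coeff p 0)"
      by (intro almost_action_pair.intro scalar_almost_action A B)
    have bA: "\<beta> u \<in> L (t - r)" if u: "u \<in> L t" for u t
    proof -
      have uV: "u \<in> V" using u A.M_sub by blast
      have "\<gamma> (u, 0) - ?b (u, 0) \<in> ?M (t - r)" using u B.M_0 by (intro near) simp
      then have "- \<beta> u \<in> L (t - r)" using uV B.W_0 \<gamma> by simp
      then show ?thesis using A.M_neg by fastforce
    qed
    have bB: "\<beta>' u \<in> L' (t - r)" if u: "u \<in> L' t" for u t
    proof -
      have uV: "u \<in> V'" using u B.M_sub by blast
      have "\<gamma> (0, u) - ?b (0, u) \<in> ?M (t - r)" using u A.M_0 by (intro near) simp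
      then have "- \<beta>' u \<in> L' (t - r)" using uV A.W_0 \<gamma> by simp
      then show ?thesis using B.M_neg by fastforce
    qed
    show ?thesis
    proof (rule exists_approximate_intertwiner[OF kdim add closed])
      fix p :: "'f poly"
      show "\<exists>q\<in>lowdeg 1.
        (\<forall>w\<in>V. \<forall>t. sc (coeff p 0) w \<in> L t \<longrightarrow> \<beta> (sc (coeff p 0) w) - sc (coeff q 0) w \<in> L (t - r)) \<and>
        (\<forall>w\<in>V'. \<forall>t. sc (coeff p 0) w \<in> L' t \<longrightarrow> \<beta>' (sc (coeff p 0) w) - sc (coeff q 0) w \<in> L' (t - r))"
        \<comment> \<open>With \<gamma> = 0 both blocks already lie at level -r, so 0 approximates
          them.\<close>
        using bA bB by (intro bexI[of _ 0]) auto
    qed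
  next
    case False
    then have pure: "pure v ?sc ?W \<Lambda> q' r' \<gamma>"
      and min: "\<And>\<Lambda>'' q'' r'' \<delta>. pure v ?sc ?W \<Lambda>'' q'' r'' \<delta> \<Longrightarrow>
        strata_equiv v ?sc ?W \<Lambda> q' r' \<gamma> \<Lambda>'' q'' r'' \<delta> \<Longrightarrow> deg ?sc ?W \<gamma> \<le> deg ?sc ?W \<delta>"
      using simple unfolding simple_def by blast+
    have "idW ?W \<noteq> zeroE" using pure unfolding pure_def Falg_is_field_def by blast
    then have nt: "\<exists>w\<in>?W. w \<noteq> 0" by (auto simp: idW_def zeroE_def fun_eq_iff split: if_splits)
    have r: "r = r'" and afil: "\<And>n. afil ?sc ?W ?M n = afil ?sc ?W \<Lambda> n"
      using afil_eq_of_cofinal[OF M \<Lambda> nt afil_cof] by blast+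
    have pa: "pure_action ?sc v e ?W ?M \<gamma>" by (rule pure_imp_pure_action[OF M afil pure])
    interpret pa: pure_action ?sc v e ?W ?M \<gamma> by (rule pa)
    have \<gamma>_in: "\<gamma> \<in> afil ?sc ?W ?M (- q')" "\<gamma> \<notin> afil ?sc ?W ?M (- q' + 1)" and q': "- q' < - r" "0 \<le> r"
      using pure r unfolding pure_def stratum_def afil by auto
    \<comment> \<open>Because -q' < -r, an operator congruent to \<gamma> at level -r has the same
      exact level -q'. It therefore gives a pure stratum equivalent to that of \<gamma>, whose
      degree is at most that of any polynomial killing it.\<close>
    have minimal: "\<exists>t. \<exists>w\<in>?M t. \<gamma> w - a w \<notin> ?M (t - r)"
      if a: "pure_action ?sc v e ?W ?M a" and \<phi>: "\<phi> \<noteq> 0" "degree \<phi> < pa.mdeg"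
        "\<forall>w\<in>?W. poly_act ?sc a \<phi> w = 0" for a \<phi>
    proof (rule ccontr)
      assume n: "\<not> ?thesis"
      interpret a: pure_action ?sc v e ?W ?M a by (rule a)
      have d: "(\<lambda>x. \<gamma> x - a x) \<in> afil ?sc ?W ?M (- r)"
        unfolding M.afil_iff using n M.endo_diff[OF pa.endo a.endo] by auto
      have eq: "a = (\<lambda>x. \<gamma> x - (\<gamma> x - a x))" "\<gamma> = (\<lambda>x. a x + (\<gamma> x - a x))" by auto
      have "(\<lambda>x. \<gamma> x - (\<gamma> x - a x)) \<in> afil ?sc ?W ?M (- q')"
        using q' by (intro M.afil_diff[OF \<gamma>_in(1)] M.afil_antimono[OF _ d]) simp
      then have a_in: "a \<in> afil ?sc ?W ?M (- q')" by simp
      have a_notin: "a \<notin> afil ?sc ?W ?M (- q' + 1)"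
      proof
        assume "a \<in> afil ?sc ?W ?M (- q' + 1)"
        then have "(\<lambda>x. a x + (\<gamma> x - a x)) \<in> afil ?sc ?W ?M (- q' + 1)"
          using q' by (intro M.afil_add M.afil_antimono[OF _ d]) simp_all
        then show False using \<gamma>_in(2) by simp
      qed
      have str: "stratum v ?sc ?W ?M q' r a"
        unfolding stratum_def using lsM q' a_in by simp
      have "pure v ?sc ?W ?M q' r a"
        unfolding pure_def using str a.Falg_field a.Falg_normalizes a_in a_notin q' by blast
      moreover have "strata_equiv v ?sc ?W \<Lambda> q' r' \<gamma> ?M q' r a"
        unfolding strata_equiv_def
      proof (intro conjI allI impI str\<Lambda> str)
        fix j :: int assume "0 \<le> j"
        then have d': "(\<lambda>x. \<gamma> x - a x) \<in> afil ?sc ?W ?M (- r - j)" using M.afil_antimono[OF _ d] by simp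
        have "coset a (afil ?sc ?W ?M (- r - j)) = coset \<gamma> (afil ?sc ?W ?M (- r - j))"
          by (rule coset_eqI[OF M.afil_diff M.afil_add d'])
        then show "coset \<gamma> (afil ?sc ?W \<Lambda> (- r' - j)) = coset a (afil ?sc ?W ?M (- r - j))"
          using afil r by simp
      qed
      ultimately have "deg ?sc ?W \<gamma> \<le> deg ?sc ?W a" by (rule min)
      moreover have "deg ?sc ?W a \<le> degree \<phi>" using a.deg_le \<phi> by blast
      ultimately show False using pa.mdeg_le_deg \<phi>(2) by simp
    qed
    define x1 :: "'v \<times> 'v \<Rightarrow> 'v \<times> 'v" where "x1 w = (if w \<in> ?W then (fst w, 0) else 0)" for w :: "'v \<times> 'v"
    define x2 :: "'v \<times> 'v \<Rightarrow> 'v \<times> 'v" where "x2 w = (if w \<in> ?W then (0, snd w) else 0)" for w :: "'v \<times> 'v"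
    have zero: "\<beta> 0 = 0" "\<beta>' 0 = 0" using add(1)[of 0 0] add(2)[of 0 0] A.W_0 B.W_0 by auto
    have W_M: "w \<in> ?W" if "w \<in> ?M t" for w t using that A.M_sub B.M_sub by auto
    have near': "\<exists>a1 a2. \<gamma> (u, u') = (\<beta> u + a1, \<beta>' u' + a2) \<and> a1 \<in> L (t - r) \<and> a2 \<in> L' (t - r)"
      if "u \<in> L t" "u' \<in> L' t" for u u' t
      using near[of "(u, u')" t] that W_M[of "(u, u')" t]
      by (intro exI[of _ "fst (\<gamma> (u, u')) - \<beta> u"] exI[of _ "snd (\<gamma> (u, u')) - \<beta>' u'"])
        (auto simp: mem_Times_iff prod_eq_iff)
    have g_W: "\<gamma> w \<in> ?W" if "w \<in> ?W" for w using pa.g_closed that by blast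
    \<comment> \<open>The block-diagonal operator commutes with \<open>x1\<close>, so only the
      errors supplied by \<open>near'\<close> remain.\<close>
    have comm1: "\<gamma> (x1 w) - x1 (\<gamma> w) \<in> ?M (t - r)" if w: "w \<in> ?M t" for w t
    proof -
      obtain u u' where uu: "w = (u, u')" "u \<in> L t" "u' \<in> L' t" using w by auto
      obtain a1 a2 where a: "\<gamma> (u, u') = (\<beta> u + a1, \<beta>' u' + a2)" "a1 \<in> L (t - r)" "a2 \<in> L' (t - r)"
        using near'[OF uu(2,3)] by blast
      obtain c1 c2 where c: "\<gamma> (u, 0) = (\<beta> u + c1, \<beta>' 0 + c2)" "c1 \<in> L (t - r)" "c2 \<in> L' (t - r)"
        using near'[OF uu(2) B.M_0] by blast
      have "\<gamma> (x1 w) - x1 (\<gamma> w) = (c1 - a1, c2)"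
        using W_M[OF w] g_W[OF W_M[OF w]] uu c a by (simp add: x1_def zero)
      then show ?thesis using a c A.M_diff by simp
    qed
    have comm2: "\<gamma> (x2 w) - x2 (\<gamma> w) \<in> ?M (t - r)" if w: "w \<in> ?M t" for w t
    proof -
      obtain u u' where uu: "w = (u, u')" "u \<in> L t" "u' \<in> L' t" using w by auto
      obtain a1 a2 where a: "\<gamma> (u, u') = (\<beta> u + a1, \<beta>' u' + a2)" "a1 \<in> L (t - r)" "a2 \<in> L' (t - r)"
        using near'[OF uu(2,3)] by blast
      obtain c1 c2 where c: "\<gamma> (0, u') = (\<beta> 0 + c1, \<beta>' u' + c2)" "c1 \<in> L (t - r)" "c2 \<in> L' (t - r)"
        using near'[OF A.M_0 uu(3)] by blast
      have "\<gamma> (x2 w) - x2 (\<gamma> w) = (c1, c2 - a2)"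
        using W_M[OF w] g_W[OF W_M[OF w]] uu c a by (simp add: x2_def zero)
      then show ?thesis using a c B.M_diff by simp
    qed
    have endo1: "endo ?sc ?W x1"
      using A.W_0 B.W_0 A.W_add B.W_add A.W_scale B.W_scale
      unfolding endo_def x1_def sc2_def by (auto simp: mem_Times_iff)
    have endo2: "endo ?sc ?W x2"
      using A.W_0 B.W_0 A.W_add B.W_add A.W_scale B.W_scale
      unfolding endo_def x2_def sc2_def by (auto simp: mem_Times_iff)
    have x1_M: "x1 w \<in> ?M t" and x2_M: "x2 w \<in> ?M t" if "w \<in> ?M t" for w t
      using that W_M[OF that] A.M_0 B.M_0 by (auto simp: x1_def x2_def)
    interpret C1: compression ?sc v e ?W ?M \<gamma> x1 r sc V L "\<lambda>u. (u, 0)" fst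
      by unfold_locales
        (use endo1 x1_M comm1 minimal A.W_0 B.W_0 B.M_0 in \<open>auto simp: x1_def sc2_def mem_Times_iff\<close>)
    interpret C2: compression ?sc v e ?W ?M \<gamma> x2 r sc V' L' "\<lambda>u. (0, u)" snd
      by unfold_locales
        (use endo2 x2_M comm2 minimal A.W_0 B.W_0 A.M_0 in \<open>auto simp: x2_def sc2_def mem_Times_iff\<close>)
    interpret almost_action_pair sc v e V L V' L' pa.mdeg C1.\<rho> C2.\<rho> pa.N
      by (intro almost_action_pair.intro C1.A.almost_action_axioms C2.A.almost_action_axioms)
    obtain \<mu> where \<mu>: "\<mu> \<noteq> 0" "degree \<mu> = pa.mdeg" "pa.ann \<mu>" using pa.exists_ann by blast
    have bA: "\<beta> u - fst (\<gamma> (u, 0)) \<in> L (t - r)" if "u \<in> L t" for u t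
      using near'[OF that B.M_0] A.M_neg by auto
    have bB: "\<beta>' u - snd (\<gamma> (0, u)) \<in> L' (t - r)" if "u \<in> L' t" for u t
      using near'[OF A.M_0 that] B.M_neg by auto
    show ?thesis
    proof (rule exists_approximate_intertwiner[OF kdim add closed])
      fix p :: "'f poly" assume p: "p \<in> lowdeg pa.mdeg"
      \<comment> \<open>X p reduced by the minimal polynomial of \<gamma> is the common polynomial
        \<open>q\<close>, serving both blocks at once.\<close>
      have "pCons 0 p mod \<mu> \<in> lowdeg pa.mdeg"
        using degree_mod_less[OF \<mu>(1), of "pCons 0 p"] \<mu>(2) by (auto simp: lowdeg_iff)
      then show "\<exists>q\<in>lowdeg pa.mdeg.
        (\<forall>w\<in>V. \<forall>t. C1.\<rho> p w \<in> L t \<longrightarrow> \<beta> (C1.\<rho> p w) - C1.\<rho> q w \<in> L (t - r)) \<and>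
        (\<forall>w\<in>V'. \<forall>t. C2.\<rho> p w \<in> L' t \<longrightarrow> \<beta>' (C2.\<rho> p w) - C2.\<rho> q w \<in> L' (t - r))"
        using C1.rho_X[OF bA p \<mu>(3)] C2.rho_X[OF bB p \<mu>(3)] by blast
    qed
  qed
qed

section \<open>Direct sums\<close>

locale direct_sum = vector_space sc
  for sc :: "'f::field \<Rightarrow> 'v::ab_group_add \<Rightarrow> 'v" +
  fixes I :: "'i set" and Vs :: "'i \<Rightarrow> 'v set"
  assumes dsum: "dsum sc UNIV I Vs"
begin

abbreviation c :: "'i \<Rightarrow> 'v \<Rightarrow> 'v" where
  "c \<equiv> proj UNIV I Vs"

lemma finite_I: "finite I" and subspace_Vs: "i \<in> I \<Longrightarrow> subspace (Vs i)"
  using dsum unfolding dsum_def by simp_all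

lemma sum_unique:
  assumes f: "\<forall>i\<in>I. f i \<in> Vs i" and f': "\<forall>i\<in>I. f' i \<in> Vs i"
    and eq: "(\<Sum>i\<in>I. f i) = (\<Sum>i\<in>I. f' i)" and i: "i \<in> I"
  shows "f i = f' i"
proof -
  have "\<forall>i\<in>I. f i - f' i \<in> Vs i" using f f' subspace_diff[OF subspace_Vs] by blast
  moreover have "(\<Sum>i\<in>I. f i - f' i) = 0" using eq by (simp add: sum_subtractf)
  ultimately have "\<forall>i\<in>I. f i - f' i = 0"
    using dsum unfolding dsum_def by (elim conjE allE[of _ "\<lambda>i. f i - f' i"]) simp
  then show ?thesis using i by simp
qed

lemma c_unique:
  assumes f: "\<forall>i\<in>I. f i \<in> Vs i" and x: "x = (\<Sum>i\<in>I. f i)" and i: "i \<in> I"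
  shows "c i x = f i"
proof -
  let ?F = "\<lambda>j. if j \<in> I then f j else 0"
  have "(THE F. (\<forall>j\<in>I. F j \<in> Vs j) \<and> (\<forall>j. j \<notin> I \<longrightarrow> F j = 0) \<and> x = (\<Sum>j\<in>I. F j)) = ?F"
  proof (rule the_equality)
    show "(\<forall>j\<in>I. ?F j \<in> Vs j) \<and> (\<forall>j. j \<notin> I \<longrightarrow> ?F j = 0) \<and> x = (\<Sum>j\<in>I. ?F j)"
      using f x by (auto intro: sum.cong)
    fix F assume F: "(\<forall>j\<in>I. F j \<in> Vs j) \<and> (\<forall>j. j \<notin> I \<longrightarrow> F j = 0) \<and> x = (\<Sum>j\<in>I. F j)"
    show "F = ?F"
    proof
      fix j
      show "F j = ?F j" using sum_unique[of F f j] F f x by (cases "j \<in> I") auto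
    qed
  qed
  then show ?thesis unfolding proj_def using i by simp
qed

lemma decomposition: "(\<forall>i\<in>I. c i x \<in> Vs i) \<and> x = (\<Sum>i\<in>I. c i x)"
proof -
  have "x \<in> {(\<Sum>i\<in>I. f i) | f. \<forall>i\<in>I. f i \<in> Vs i}" using dsum unfolding dsum_def by blast
  then obtain f where f: "\<forall>i\<in>I. f i \<in> Vs i" "x = (\<Sum>i\<in>I. f i)" by blast
  then have "c i x = f i" if "i \<in> I" for i using c_unique that by blast
  then show ?thesis using f by simp
qed

lemma c_mem: "i \<in> I \<Longrightarrow> c i x \<in> Vs i"
  using decomposition by blast

lemma c_sum: "(\<Sum>i\<in>I. c i x) = x"
  by (rule sym[OF conjunct2[OF decomposition]])

lemma c_add:
  assumes "i \<in> I" shows "c i (x + y) = c i x + c i y"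
proof (rule c_unique[OF _ _ assms])
  show "\<forall>i\<in>I. c i x + c i y \<in> Vs i" using c_mem subspace_add[OF subspace_Vs] by blast
  show "x + y = (\<Sum>i\<in>I. c i x + c i y)" by (simp add: sum.distrib c_sum)
qed

lemma c_scale:
  assumes "i \<in> I" shows "c i (sc a x) = sc a (c i x)"
proof (rule c_unique[OF _ _ assms])
  show "\<forall>i\<in>I. sc a (c i x) \<in> Vs i" using c_mem subspace_scale[OF subspace_Vs] by blast
  show "sc a x = (\<Sum>i\<in>I. sc a (c i x))" by (simp add: c_sum flip: scale_sum_right)
qed

lemma c_zero: "i \<in> I \<Longrightarrow> c i 0 = 0"
  using c_add[of i 0 0] by simp

lemma c_of_sum: "i \<in> I \<Longrightarrow> c i (sum f A) = (\<Sum>a\<in>A. c i (f a))"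
  by (induction A rule: infinite_finite_induct) (auto simp: c_zero c_add)

lemma c_self: "i \<in> I \<Longrightarrow> y \<in> Vs i \<Longrightarrow> c i y = y"
  using c_unique[of "\<lambda>j. if j = i then y else 0" y i] finite_I subspace_0[OF subspace_Vs]
  by (auto simp: sum.delta)

lemma mem_lattice_iff:
  assumes "\<Lambda> s = {(\<Sum>i\<in>I. f i) | f. \<forall>i\<in>I. f i \<in> \<Lambda> s \<inter> Vs i}"
  shows "x \<in> \<Lambda> s \<longleftrightarrow> (\<forall>i\<in>I. c i x \<in> \<Lambda> s)"
proof
  assume "x \<in> \<Lambda> s"
  then have "x \<in> {(\<Sum>i\<in>I. f i) | f. \<forall>i\<in>I. f i \<in> \<Lambda> s \<inter> Vs i}" by (rule subst[OF assms])
  then obtain f where f: "\<forall>i\<in>I. f i \<in> \<Lambda> s \<inter> Vs i" "x = (\<Sum>i\<in>I. f i)" by blast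
  then show "\<forall>i\<in>I. c i x \<in> \<Lambda> s" using c_unique[of f x] by simp
next
  assume "\<forall>i\<in>I. c i x \<in> \<Lambda> s"
  then have "x \<in> {(\<Sum>i\<in>I. f i) | f. \<forall>i\<in>I. f i \<in> \<Lambda> s \<inter> Vs i}"
    using c_mem c_sum[of x] by (intro CollectI exI[of _ "\<lambda>i. c i x"]) auto
  then show "x \<in> \<Lambda> s" by (rule subst[OF assms[symmetric]])
qed

lemma c_block:
  assumes add: "\<And>x y. \<beta> (x + y) = \<beta> x + \<beta> y"
    and diag: "\<And>i j. i \<in> I \<Longrightarrow> j \<in> I \<Longrightarrow> i \<noteq> j \<Longrightarrow> c i \<circ> \<beta> \<circ> c j = zeroE"
    and i: "i \<in> I"
  shows "c i (\<beta> x) = blk UNIV I Vs \<beta> i (c i x)"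
proof -
  have zero: "\<beta> 0 = 0" using add[of 0 0] by simp
  have sum: "\<beta> (sum f A) = (\<Sum>a\<in>A. \<beta> (f a))" for f and A :: "'i set"
    by (induction A rule: infinite_finite_induct) (auto simp: zero add)
  have "\<beta> x = (\<Sum>j\<in>I. \<beta> (c j x))" using sum[of "\<lambda>j. c j x" I] c_sum[of x] by simp
  then have "c i (\<beta> x) = (\<Sum>j\<in>I. c i (\<beta> (c j x)))" using c_of_sum[OF i] by simp
  also have "\<dots> = (\<Sum>j\<in>I. if j = i then c i (\<beta> (c i x)) else 0)"
    using diag[OF i] by (intro sum.cong) (auto simp: fun_eq_iff zeroE_def)
  also have "\<dots> = c i (\<beta> (c i x))" using finite_I i by simp
  finally show ?thesis using c_self[OF i c_mem[OF i]] by (simp add: blk_def)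
qed

end

lemma simple_stratum: "simple v sc W \<Lambda> q r \<beta> \<Longrightarrow> stratum v sc W \<Lambda> q r \<beta>"
  unfolding simple_def zero_stratum_def pure_def by blast

text \<open>A lattice sequence asserts some period; here every component is given the period
  \<open>e\<close> of \<open>\<Lambda>\<close>, so that valuations on matched components are
  comparable.\<close>

lemma component_lattice_space:
  assumes vs: "vector_space sc" and F: "nonarch_local_field v"
    and e: "0 < e" "\<And>s. \<Lambda> (s + e) = sc (unif v) ` \<Lambda> s"
    and U: "module.subspace sc U" and simple: "simple v sc U (\<lambda>s. \<Lambda> s \<inter> U) q r \<beta>"
  shows "lattice_space sc v e U (\<lambda>s. \<Lambda> s \<inter> U)"
    and "\<Lambda> (s + e) \<inter> U = sc (unif v) ` (\<Lambda> s \<inter> U)"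
proof -
  interpret vector_space sc by (rule vs)
  interpret valued_field v by standard (rule F)
  show per: "\<Lambda> (s + e) \<inter> U = sc (unif v) ` (\<Lambda> s \<inter> U)" for s
  proof (intro set_eqI iffI)
    fix x assume "x \<in> \<Lambda> (s + e) \<inter> U"
    then obtain y where y: "y \<in> \<Lambda> s" "x = sc (unif v) y" "x \<in> U" using e(2) by blast
    have "y = sc (inverse (unif v)) x" using unif y by simp
    then have "y \<in> U" using subspace_scale[OF U y(3)] by simp
    then show "x \<in> sc (unif v) ` (\<Lambda> s \<inter> U)" using y by blast
  next
    fix x assume "x \<in> sc (unif v) ` (\<Lambda> s \<inter> U)"
    then show "x \<in> \<Lambda> (s + e) \<inter> U" using e(2) subspace_scale[OF U] by blast
  qed
  have ls: "lattice_seq v sc U (\<lambda>s. \<Lambda> s \<inter> U)"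
    using simple_stratum[OF simple] unfolding stratum_def by blast
  show "lattice_space sc v e U (\<lambda>s. \<Lambda> s \<inter> U)"
    by (rule lattice_seq_lattice_space[OF vs F ls e(1) per])
qed

lemma ss_splitD:
  assumes "ss_split v sc W \<Lambda> q r \<beta> I Vs"
  shows "stratum v sc W \<Lambda> q r \<beta>" and "dsum sc W I Vs"
    and "\<forall>i\<in>I. \<forall>j\<in>I. i \<noteq> j \<longrightarrow> proj W I Vs i \<circ> \<beta> \<circ> proj W I Vs j = zeroE"
    and "\<forall>s. \<Lambda> s = {(\<Sum>i\<in>I. f i) | f. \<forall>i\<in>I. f i \<in> \<Lambda> s \<inter> Vs i}"
    and "\<forall>i\<in>I. simple v sc (Vs i) (\<lambda>s. \<Lambda> s \<inter> Vs i)
        (qcomp sc W \<Lambda> r (blk W I Vs \<beta> i)) r (restr (Vs i) (blk W I Vs \<beta> i))"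
  unfolding atomize_conj using assms unfolding ss_split_def
  by (elim conjE) (intro conjI; assumption)

section \<open>Assembling the block isometries into a conjugating unit\<close>

theorem theorem8p2:
  fixes v :: "'f::field \<Rightarrow> int"
    and sc :: "'f \<Rightarrow> 'v::ab_group_add \<Rightarrow> 'v"
    and \<Lambda> :: "int \<Rightarrow> 'v set"
    and q r :: int
    and \<beta> \<beta>' :: "'v \<Rightarrow> 'v"
    and I :: "'i set" and Vs :: "'i \<Rightarrow> 'v set"
    and I' :: "'j set" and Vs' :: "'j \<Rightarrow> 'v set"
    and \<zeta> :: "'i \<Rightarrow> 'j"
  assumes F: "nonarch_local_field v" "odd_residual_char v"
    and V: "vector_space sc" "\<exists>B. finite B \<and> module.span sc B = UNIV"
    and ss1: "ss_split v sc UNIV \<Lambda> q r \<beta> I Vs" "\<not> zero_stratum v sc UNIV \<Lambda> q r \<beta>"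
    and ss2: "ss_split v sc UNIV \<Lambda> q r \<beta>' I' Vs'" "\<not> zero_stratum v sc UNIV \<Lambda> q r \<beta>'"
    and inter: "intertwine v sc UNIV \<Lambda> q r \<beta> \<Lambda> q r \<beta>'"
    and match: "matching v sc UNIV \<Lambda> r \<beta> I Vs \<beta>' I' Vs' \<zeta>"
    and dims: "\<forall>i\<in>I. \<forall>j::int. kdim v sc (\<Lambda> j \<inter> Vs i) (\<Lambda> (j + 1) \<inter> Vs i)
                            = kdim v sc (\<Lambda> j \<inter> Vs' (\<zeta> i)) (\<Lambda> (j + 1) \<inter> Vs' (\<zeta> i))"
  shows "\<exists>g\<in>Ut sc UNIV \<Lambda>. strata_equiv v sc UNIV \<Lambda> q r (g \<circ> \<beta> \<circ> invE sc UNIV g) \<Lambda> q r \<beta>'"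
proof -
  note ds = ss_splitD(2)[OF ss1(1)] ss_splitD(2)[OF ss2(1)]
  note str = ss_splitD(1)[OF ss1(1)] ss_splitD(1)[OF ss2(1)]
  note diag = ss_splitD(3)[OF ss1(1), rule_format] ss_splitD(3)[OF ss2(1), rule_format]
  note spl = ss_splitD(4)[OF ss1(1), THEN spec] ss_splitD(4)[OF ss2(1), THEN spec]
  note simp1 = ss_splitD(5)[OF ss1(1), THEN bspec]
  note simp2 = ss_splitD(5)[OF ss2(1), THEN bspec]
  have bij: "bij_betw \<zeta> I I'" using match unfolding matching_def by blast
  have \<zeta>: "\<zeta> i \<in> I'" if "i \<in> I" for i using bij that by (auto simp: bij_betw_def)
  interpret vector_space sc by (rule V(1))
  interpret S: direct_sum sc I Vs by standard (rule ds(1))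
  interpret S': direct_sum sc I' Vs' by standard (rule ds(2))
  have ls: "lattice_seq v sc UNIV \<Lambda>" using str unfolding stratum_def by blast
  then obtain e where e: "0 < e" "\<And>s. \<Lambda> (s + e) = sc (unif v) ` \<Lambda> s"
    unfolding lattice_seq_def by blast
  interpret L: lattice_space sc v e UNIV \<Lambda>
    by (rule lattice_seq_lattice_space[OF V(1) F(1) ls e])
  have endo: "endo sc UNIV \<beta>" "endo sc UNIV \<beta>'" using str unfolding stratum_def afil_def by blast+
  have b_add: "\<beta> (x + y) = \<beta> x + \<beta> y" "\<beta>' (x + y) = \<beta>' x + \<beta>' y" for x y
    using endo unfolding endo_def by blast+
  let ?b = "blk UNIV I Vs \<beta>" and ?b' = "blk UNIV I' Vs' \<beta>'"
  have blk_add: "?b i (x + y) = ?b i x + ?b i y" if "i \<in> I" for i x y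
    by (simp add: blk_def S.c_add that b_add)
  have blk'_add: "?b' i (x + y) = ?b' i x + ?b' i y" if "i \<in> I'" for i x y
    by (simp add: blk_def S'.c_add that b_add)
  let ?Q = "\<lambda>i h. (\<forall>x\<in>Vs i. h x \<in> Vs' (\<zeta> i)) \<and> (\<forall>x\<in>Vs i. \<forall>y\<in>Vs i. h (x + y) = h x + h y)
    \<and> (\<forall>c. \<forall>x\<in>Vs i. h (sc c x) = sc c (h x)) \<and> h ` Vs i = Vs' (\<zeta> i)
    \<and> (\<forall>x\<in>Vs i. \<forall>t. h x \<in> \<Lambda> t \<inter> Vs' (\<zeta> i) \<longleftrightarrow> x \<in> \<Lambda> t \<inter> Vs i)
    \<and> (\<forall>t. \<forall>x\<in>\<Lambda> t \<inter> Vs i. h (?b i x) - ?b' (\<zeta> i) (h x) \<in> \<Lambda> (t - r) \<inter> Vs' (\<zeta> i))"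
  have "\<exists>h. ?Q i h" if i: "i \<in> I" for i
  proof -
    obtain \<Lambda>'' q'' r'' \<gamma> where "simple v (sc2 sc) (Vs i \<times> Vs' (\<zeta> i)) \<Lambda>'' q'' r'' \<gamma>"
      "strata_equiv v (sc2 sc) (Vs i \<times> Vs' (\<zeta> i))
          (\<lambda>s. (\<Lambda> s \<inter> Vs i) \<times> (\<Lambda> s \<inter> Vs' (\<zeta> i)))
          (max (qcomp sc UNIV \<Lambda> r (?b i)) (qcomp sc UNIV \<Lambda> r (?b' (\<zeta> i)))) r
          (\<lambda>p. if p \<in> Vs i \<times> Vs' (\<zeta> i) then (?b i (fst p), ?b' (\<zeta> i) (snd p)) else 0)
          \<Lambda>'' q'' r'' \<gamma>"
      using match i unfolding matching_def by blast
    then show ?thesis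
      by (rule exists_component_isometry[OF V(1) F(1)
            component_lattice_space(1)[OF V(1) F(1) e S.subspace_Vs[OF i] simp1[OF i]]
            component_lattice_space(1)[OF V(1) F(1) e S'.subspace_Vs[OF \<zeta>[OF i]] simp2[OF \<zeta>[OF i]]]
            component_lattice_space(2)[OF V(1) F(1) e S.subspace_Vs[OF i] simp1[OF i]]
            component_lattice_space(2)[OF V(1) F(1) e S'.subspace_Vs[OF \<zeta>[OF i]] simp2[OF \<zeta>[OF i]]]])
        (use i \<zeta> dims S.c_mem blk_add blk'_add in \<open>auto simp: blk_def\<close>)
  qed
  then have "\<forall>i\<in>I. \<exists>h. ?Q i h" by blast
  from bchoice[OF this] obtain h where h: "\<forall>i\<in>I. ?Q i (h i)" ..
  have h_V: "h i x \<in> Vs' (\<zeta> i)" if "i \<in> I" "x \<in> Vs i" for i x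
    using bspec[OF h that(1)] that(2) by blast
  have h_add: "h i (x + y) = h i x + h i y" if "i \<in> I" "x \<in> Vs i" "y \<in> Vs i" for i x y
    using bspec[OF h that(1)] that(2,3) by blast
  have h_scale: "h i (sc c x) = sc c (h i x)" if "i \<in> I" "x \<in> Vs i" for i c x
    using bspec[OF h that(1)] that(2) by blast
  have h_surj: "h i ` Vs i = Vs' (\<zeta> i)" if "i \<in> I" for i
    using bspec[OF h that] by (elim conjE)
  have h_M: "h i x \<in> \<Lambda> t \<inter> Vs' (\<zeta> i) \<longleftrightarrow> x \<in> \<Lambda> t \<inter> Vs i" if "i \<in> I" "x \<in> Vs i" for i x t
    using bspec[OF h that(1)] that(2) by (elim conjE) (drule (1) bspec, erule spec)
  have h_b: "h i (?b i x) - ?b' (\<zeta> i) (h i x) \<in> \<Lambda> (t - r) \<inter> Vs' (\<zeta> i)"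
    if "i \<in> I" "x \<in> \<Lambda> t \<inter> Vs i" for i x t
    using bspec[OF h that(1)] that(2) by blast
  define g where "g x = (\<Sum>i\<in>I. h i (S.c i x))" for x
  have reindex: "(\<Sum>j\<in>I'. f j) = (\<Sum>i\<in>I. f (\<zeta> i))" for f :: "'j \<Rightarrow> 'v"
    using sum.reindex_bij_betw[OF bij, of f] by simp
  define \<xi> where "\<xi> = inv_into I \<zeta>"
  have \<xi>: "\<xi> (\<zeta> i) = i" if "i \<in> I" for i
    using that bij unfolding \<xi>_def bij_betw_def by simp
  have \<xi>': "\<xi> j \<in> I" "\<zeta> (\<xi> j) = j" if "j \<in> I'" for j
    using that bij unfolding \<xi>_def bij_betw_def by (auto intro: inv_into_into f_inv_into_f)
  \<comment> \<open>Reindexed by the inverse matching, the sum defining \<open>g x\<close> is its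
    decomposition along the second splitting.\<close>
  have cg: "S'.c (\<zeta> i) (g x) = h i (S.c i x)" if i: "i \<in> I" for i x
  proof -
    have "\<forall>j\<in>I'. h (\<xi> j) (S.c (\<xi> j) x) \<in> Vs' j" using h_V S.c_mem \<xi>' by metis
    moreover have "g x = (\<Sum>j\<in>I'. h (\<xi> j) (S.c (\<xi> j) x))"
      unfolding reindex g_def by (intro sum.cong) (auto simp: \<xi>)
    ultimately show ?thesis using S'.c_unique[of "\<lambda>j. h (\<xi> j) (S.c (\<xi> j) x)" "g x" "\<zeta> i"] \<zeta> i \<xi> by simp
  qed
  have g_add: "g (x + y) = g x + g y" for x y
    by (simp add: g_def S.c_add S.c_mem h_add sum.distrib)
  have g_scale: "g (sc a x) = sc a (g x)" for a x
    by (simp add: g_def S.c_scale S.c_mem h_scale scale_sum_right)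
  have g_M: "g x \<in> \<Lambda> s \<longleftrightarrow> x \<in> \<Lambda> s" for x s
  proof -
    have "g x \<in> \<Lambda> s \<longleftrightarrow> (\<forall>j\<in>I'. S'.c j (g x) \<in> \<Lambda> s)" by (rule S'.mem_lattice_iff[of \<Lambda> s, OF spl(2)])
    also have "\<dots> \<longleftrightarrow> (\<forall>i\<in>I. S'.c (\<zeta> i) (g x) \<in> \<Lambda> s)"
      using bij unfolding bij_betw_def by blast
    also have "\<dots> \<longleftrightarrow> (\<forall>i\<in>I. S.c i x \<in> \<Lambda> s)"
    proof (rule ball_cong[OF refl])
      fix i assume i: "i \<in> I"
      show "S'.c (\<zeta> i) (g x) \<in> \<Lambda> s \<longleftrightarrow> S.c i x \<in> \<Lambda> s"
        unfolding cg[OF i] using h_M[OF i S.c_mem[OF i]] h_V[OF i S.c_mem[OF i]] S.c_mem[OF i] by blast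
    qed
    also have "\<dots> \<longleftrightarrow> x \<in> \<Lambda> s" by (rule S.mem_lattice_iff[of \<Lambda> s, OF spl(1), symmetric])
    finally show ?thesis .
  qed
  \<comment> \<open>\<open>g\<close> preserves membership in every \<open>\<Lambda> t\<close> in
    both directions, and these lattices intersect in 0.\<close>
  have "inj g"
  proof (rule injI)
    fix x y assume "g x = g y"
    then have "g (x - y) = 0" using g_add[of "x - y" y] by simp
    then have "x - y \<in> \<Lambda> t" for t using g_M[of "x - y" t] L.M_0 by simp
    then show "x = y" using L.M_eq_0[of "x - y"] by simp
  qed
  moreover have "surj g"
  proof (rule surjI)
    fix y
    let ?f = "\<lambda>i. inv_into (Vs i) (h i) (S'.c (\<zeta> i) y)"
    have f: "?f i \<in> Vs i" "h i (?f i) = S'.c (\<zeta> i) y" if "i \<in> I" for i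
      using S'.c_mem[OF \<zeta>[OF that], of y] h_surj[OF that] inv_into_into f_inv_into_f by metis+
    have "g (\<Sum>i\<in>I. ?f i) = (\<Sum>i\<in>I. h i (?f i))"
      unfolding g_def using S.c_unique[of ?f "\<Sum>i\<in>I. ?f i"] f by simp
    also have "\<dots> = (\<Sum>j\<in>I'. S'.c j y)" unfolding reindex using f by simp
    finally show "g (\<Sum>i\<in>I. ?f i) = y" by (simp add: S'.c_sum)
  qed
  ultimately have bij_g: "bij g" by (simp add: bij_def)
  define k where "k = inv g"
  have gk: "g (k x) = x" and kg: "k (g x) = x" for x
    unfolding k_def using bij_g by (simp_all add: bij_def surj_f_inv_f)
  have k_add: "k (x + y) = k x + k y" for x y
    using g_add[of "k x" "k y"] kg[of "k x + k y"] by (simp add: gk)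
  have k_scale: "k (sc a x) = sc a (k x)" for a x
    using g_scale[of a "k x"] kg[of "sc a (k x)"] by (simp add: gk)
  have endo_g: "endo sc UNIV g" and endo_k: "endo sc UNIV k"
    by (simp_all add: endo_def g_add g_scale k_add k_scale)
  have id: "idW UNIV = (id :: 'v \<Rightarrow> 'v)" by (auto simp: idW_def)
  have gk': "g \<circ> k = idW UNIV" "k \<circ> g = idW UNIV" by (auto simp: id gk kg)
  have inv: "invE sc UNIV g = k"
    unfolding invE_def
  proof (rule some_equality)
    fix b assume b: "endo sc UNIV b \<and> g \<circ> b = idW UNIV \<and> b \<circ> g = idW UNIV"
    show "b = k"
    proof
      fix x
      have "g (b x) = x" using b unfolding id by (auto simp: fun_eq_iff)
      then show "b x = k x" using kg[of "b x"] by simp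
    qed
  qed (use endo_k gk' in blast)
  have k_M: "k x \<in> \<Lambda> s \<longleftrightarrow> x \<in> \<Lambda> s" for x s using g_M[of "k x" s] by (simp add: gk)
  have "g \<in> Ut sc UNIV \<Lambda>"
    unfolding Ut_def unitE_def L.afil_iff using endo_g endo_k gk' g_M k_M by (auto simp: inv)
  moreover have "strata_equiv v sc UNIV \<Lambda> q r (g \<circ> \<beta> \<circ> k) \<Lambda> q r \<beta>'"
  proof -
    let ?gb = "g \<circ> \<beta> \<circ> k"
    have endo_gb: "endo sc UNIV ?gb"
      using endo_g endo(1) endo_k unfolding endo_def by simp
    have b_M: "\<beta> w \<in> \<Lambda> (t + - q)" if "w \<in> \<Lambda> t" for w t
      using str(1) that unfolding stratum_def L.afil_iff by blast
    have gb: "?gb \<in> afil sc UNIV \<Lambda> (- q)"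
      unfolding L.afil_iff using endo_gb b_M by (simp add: g_M k_M)
    have "?gb y - \<beta>' y \<in> \<Lambda> (t - r)" if y: "y \<in> \<Lambda> t" for y t
    proof -
      define x where "x = k y"
      have x: "x \<in> \<Lambda> t" "y = g x" using y by (simp_all add: x_def k_M gk)
      have "g (\<beta> x) - \<beta>' (g x) \<in> \<Lambda> (t - r)"
      proof -
        have "\<beta>' (g x) = (\<Sum>i\<in>I. S'.c (\<zeta> i) (\<beta>' (g x)))"
          using S'.c_sum[of "\<beta>' (g x)"] unfolding reindex by simp
        also have "\<dots> = (\<Sum>i\<in>I. ?b' (\<zeta> i) (h i (S.c i x)))"
          using S'.c_block[OF b_add(2) diag(2) \<zeta>] cg by (intro sum.cong) simp_all
        finally have "g (\<beta> x) - \<beta>' (g x) = (\<Sum>i\<in>I. h i (?b i (S.c i x)) - ?b' (\<zeta> i) (h i (S.c i x)))"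
          unfolding g_def[of "\<beta> x"] using S.c_block[OF b_add(1) diag(1)] by (simp add: sum_subtractf)
        also have "\<dots> \<in> \<Lambda> (t - r)"
        proof (rule L.M_sum)
          fix i assume i: "i \<in> I"
          have "S.c i x \<in> \<Lambda> t \<inter> Vs i"
            using x(1) i S.mem_lattice_iff[of \<Lambda> t, OF spl(1)] S.c_mem[OF i] by blast
          then show "h i (?b i (S.c i x)) - ?b' (\<zeta> i) (h i (S.c i x)) \<in> \<Lambda> (t - r)"
            using h_b[OF i] by blast
        qed
        finally show ?thesis .
      qed
      then show ?thesis by (simp add: x_def gk)
    qed
    then have diff: "(\<lambda>x. ?gb x - \<beta>' x) \<in> afil sc UNIV \<Lambda> (- r)"
      unfolding L.afil_iff using L.endo_diff[OF endo_gb endo(2)] by simp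
    show ?thesis
      unfolding strata_equiv_def
    proof (intro conjI allI impI str(2))
      show "stratum v sc UNIV \<Lambda> q r ?gb" using str(1) gb unfolding stratum_def by blast
      fix j :: int assume "0 \<le> j"
      then have d: "(\<lambda>x. ?gb x - \<beta>' x) \<in> afil sc UNIV \<Lambda> (- r - j)"
        by (intro L.afil_antimono[OF _ diff]) simp
      have "coset \<beta>' (afil sc UNIV \<Lambda> (- r - j)) = coset ?gb (afil sc UNIV \<Lambda> (- r - j))"
        by (rule coset_eqI[OF L.afil_diff L.afil_add d])
      then show "coset ?gb (afil sc UNIV \<Lambda> (- r - j)) = coset \<beta>' (afil sc UNIV \<Lambda> (- r - j))"
        by (rule sym)
    qed
  qed
  ultimately show ?thesis by (intro bexI[of _ g]) (simp_all only: inv)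
qed

end
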